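(* Let $M$ be a compact oriented 2-dimensional manifold with boundary $\partial M$, and let $\mathbf{R}:M\to\mathbb{R}^3$ be a smooth immersion which can be parametrized by curvature line coordinates near each point. Let $\mathbf{V}=\boldsymbol{\eta}+v_n\mathbf{N}$ be a smooth variation vector field along $\mathbf{R}$, with tangential component $\boldsymbol{\eta}$ and normal component $v_n=\mathbf{V}\cdot\mathbf{N}$. Then the first variation of the algebraic volume $V=\frac13\int_M(\mathbf{R}\cdot\mathbf{N})\,dA$ under the deformation $\mathbf{r}=\mathbf{R}+t\mathbf{V}$ is $$\delta V=\int_M v_n\,dA+\frac13\int_{\partial M}\big((\mathbf{R}\cdot\mathbf{N})\boldsymbol{\eta}-v_n\mathbf{R}\big)\cdot\mathbf{t}\,ds,$$ where $\mathbf{t}$ is the outward-pointing unit conormal vector and $ds$ is the line element of $\partial M$.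
   Context: Local coordinates $(\alpha,\beta)$ are curvature line coordinates if the first and second fundamental forms are both diagonal in them; they are taken compatible with the orientation. $\mathbf{N}$ is the unit normal $\mathbf{R}_\alpha\times\mathbf{R}_\beta/\|\mathbf{R}_\alpha\times\mathbf{R}_\beta\|$, where subscripts denote partial derivatives. The area element is $dA=\|\mathbf{R}_\alpha\times\mathbf{R}_\beta\|\,d\alpha\,d\beta$, so $(\mathbf{R}\cdot\mathbf{N})\,dA=\mathbf{R}\cdot(\mathbf{R}_\alpha\times\mathbf{R}_\beta)\,d\alpha\,d\beta$. For a quantity $Q$ depending on the immersion, $\delta Q=\frac{d}{dt}\big|_{t=0}Q(\mathbf{r}_t)$, where $\mathbf{r}_t=\mathbf{R}+t\mathbf{V}$, $|t|\ll1$ (for the volume, the unit normal and area element are those of $\mathbf{r}_t$). The unit conormal $\mathbf{t}$ is tangent to the surface and orthogonal to the boundary curve. *)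

theory Defs
  imports "HOL-Analysis.Analysis"
begin

text \<open>
  A surface with boundary is a topological space \<open>X\<close> together with an oriented smooth atlas \<open>A\<close>
  of charts into the half plane.  A chart is a pair \<open>c = (U, \<phi>)\<close>; the values of \<open>\<phi>\<close> outside \<open>U\<close> are
  irrelevant.
\<close>

type_synonym 'a chart = "'a set \<times> ('a \<Rightarrow> real^2)"

abbreviation chart_image :: "'a chart \<Rightarrow> (real^2) set"
  where "chart_image c \<equiv> snd c ` fst c"

abbreviation chart_inv :: "'a chart \<Rightarrow> real^2 \<Rightarrow> 'a"
  where "chart_inv c \<equiv> inv_into (fst c) (snd c)"

definition half_plane :: "(real^2) set"
  where "half_plane = {x. x $ 2 \<ge> 0}"


subsection \<open>Smooth functions\<close>

primrec Ck_on ::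
    "nat \<Rightarrow> 'a::euclidean_space set \<Rightarrow> ('a \<Rightarrow> 'b::real_normed_vector) \<Rightarrow> bool" where
  "Ck_on 0 S f \<longleftrightarrow> continuous_on S f"
| "Ck_on (Suc k) S f \<longleftrightarrow>
     (\<forall>x\<in>S. f differentiable (at x)) \<and>
     (\<forall>i\<in>Basis. Ck_on k S (\<lambda>x. frechet_derivative f (at x) i))"

text \<open>On a set that need not be open, smooth means: locally extendable to a smooth function on an
  open set.\<close>

definition smooth_on ::
    "'a::euclidean_space set \<Rightarrow> ('a \<Rightarrow> 'b::real_normed_vector) \<Rightarrow> bool" where
  "smooth_on S f \<longleftrightarrow>
     (\<forall>x\<in>S. \<exists>W F. open W \<and> x \<in> W \<and> (\<forall>k. Ck_on k W F) \<and> (\<forall>y\<in>S \<inter> W. F y = f y))"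

definition smooth_map :: "'a chart set \<Rightarrow> ('a \<Rightarrow> 'b::real_normed_vector) \<Rightarrow> bool" where
  "smooth_map A f \<longleftrightarrow> (\<forall>c\<in>A. smooth_on (chart_image c) (f \<circ> chart_inv c))"

text \<open>The differential at the point \<open>p\<close>, and the partial derivative with respect to the \<open>i\<close>-th
  coordinate, of a map on the surface read in the chart \<open>c\<close>.  The derivative is taken within the
  chart image, so that it makes sense (and is unique) at boundary points as well.\<close>

definition chart_differential ::
    "'a chart \<Rightarrow> ('a \<Rightarrow> 'b::real_normed_vector) \<Rightarrow> 'a \<Rightarrow> real^2 \<Rightarrow> 'b" where
  "chart_differential c f p =
     frechet_derivative (f \<circ> chart_inv c) (at (snd c p) within chart_image c)"

definition coord_deriv ::
    "'a chart \<Rightarrow> 2 \<Rightarrow> ('a \<Rightarrow> 'b::real_normed_vector) \<Rightarrow> 'a \<Rightarrow> 'b" where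
  "coord_deriv c i f p = chart_differential c f p (axis i 1)"


subsection \<open>Compact oriented surfaces with boundary\<close>

text \<open>Local coordinates compatible with the smooth structure and the orientation given by \<open>A\<close>.
  Their image is not required to lie in the half plane: near a boundary point it may be any plane
  region with smooth boundary, so boundary curves need not be coordinate lines.\<close>

definition oriented_coords :: "'a topology \<Rightarrow> 'a chart set \<Rightarrow> 'a chart \<Rightarrow> bool" where
  "oriented_coords X A c \<longleftrightarrow>
     openin X (fst c) \<and>
     homeomorphic_map (subtopology X (fst c)) (top_of_set (chart_image c)) (snd c) \<and>
     (\<forall>c'\<in>A. smooth_on (snd c' ` (fst c \<inter> fst c')) (snd c \<circ> chart_inv c') \<and>
        (\<forall>p\<in>fst c \<inter> fst c'. det (matrix (chart_differential c' (snd c) p)) > 0))"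

text \<open>The atlas need not be maximal; second countability follows from compactness.\<close>

definition compact_oriented_surface :: "'a topology \<Rightarrow> 'a chart set \<Rightarrow> bool" where
  "compact_oriented_surface X A \<longleftrightarrow>
     compact_space X \<and> Hausdorff_space X \<and>
     (\<Union>c\<in>A. fst c) = topspace X \<and>
     (\<forall>c\<in>A. oriented_coords X A c \<and> openin (top_of_set half_plane) (chart_image c))"

definition surface_boundary :: "'a chart set \<Rightarrow> 'a set" where
  "surface_boundary A = {p. \<exists>c\<in>A. p \<in> fst c \<and> snd c p $ 2 = 0}"


subsection \<open>Geometry of an immersed surface\<close>

definition smooth_immersion :: "'a chart set \<Rightarrow> ('a \<Rightarrow> real^3) \<Rightarrow> bool" where
  "smooth_immersion A r \<longleftrightarrow>
     smooth_map A r \<and> (\<forall>c\<in>A. \<forall>p\<in>fst c. inj (chart_differential c r p))"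

definition tangent_plane :: "'a chart set \<Rightarrow> ('a \<Rightarrow> real^3) \<Rightarrow> 'a \<Rightarrow> (real^3) set" where
  "tangent_plane A r p = {w. \<exists>c\<in>A. p \<in> fst c \<and> w \<in> range (chart_differential c r p)}"

definition chart_normal :: "'a chart \<Rightarrow> ('a \<Rightarrow> real^3) \<Rightarrow> 'a \<Rightarrow> real^3" where
  "chart_normal c r p =
     cross3 (coord_deriv c 1 r p) (coord_deriv c 2 r p) /\<^sub>R
     norm (cross3 (coord_deriv c 1 r p) (coord_deriv c 2 r p))"

text \<open>The next two vectors do not depend on the chart used to compute them.\<close>

definition unit_normal :: "'a chart set \<Rightarrow> ('a \<Rightarrow> real^3) \<Rightarrow> 'a \<Rightarrow> real^3" where
  "unit_normal A r p = (THE n. \<exists>c\<in>A. p \<in> fst c \<and> n = chart_normal c r p)"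

text \<open>At a boundary point the first coordinate direction is tangent to the boundary curve, and the
  tangent vectors with negative second component point out of the surface.\<close>

definition outward_conormal :: "'a chart set \<Rightarrow> ('a \<Rightarrow> real^3) \<Rightarrow> 'a \<Rightarrow> real^3" where
  "outward_conormal A r p =
     (THE w. \<exists>c\<in>A. p \<in> fst c \<and>
        w \<in> chart_differential c r p ` {a. a $ 2 < 0} \<and>
        w \<bullet> coord_deriv c 1 r p = 0 \<and> norm w = 1)"

definition first_fundamental_form :: "'a chart \<Rightarrow> ('a \<Rightarrow> real^3) \<Rightarrow> 'a \<Rightarrow> real^2^2" where
  "first_fundamental_form c r p = (\<chi> i j. coord_deriv c i r p \<bullet> coord_deriv c j r p)"

definition second_fundamental_form :: "'a chart \<Rightarrow> ('a \<Rightarrow> real^3) \<Rightarrow> 'a \<Rightarrow> real^2^2" where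
  "second_fundamental_form c r p =
     (\<chi> i j. coord_deriv c j (coord_deriv c i r) p \<bullet> chart_normal c r p)"

definition diagonal_matrix :: "real^'n^'n \<Rightarrow> bool" where
  "diagonal_matrix Q \<longleftrightarrow> (\<forall>i j. i \<noteq> j \<longrightarrow> Q $ i $ j = 0)"

definition curvature_line_coords ::
    "'a topology \<Rightarrow> 'a chart set \<Rightarrow> ('a \<Rightarrow> real^3) \<Rightarrow> 'a chart \<Rightarrow> bool" where
  "curvature_line_coords X A r c \<longleftrightarrow>
     oriented_coords X A c \<and>
     (\<forall>p\<in>fst c. diagonal_matrix (first_fundamental_form c r p) \<and>
        diagonal_matrix (second_fundamental_form c r p))"


subsection \<open>Integration\<close>

definition partition_of_unity ::
    "'a topology \<Rightarrow> 'a chart set \<Rightarrow> 'a chart set \<Rightarrow> ('a chart \<Rightarrow> 'a \<Rightarrow> real) \<Rightarrow> bool" where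
  "partition_of_unity X A C \<rho> \<longleftrightarrow>
     finite C \<and> C \<subseteq> A \<and>
     (\<forall>c\<in>C. smooth_map A (\<rho> c) \<and> (\<forall>p\<in>topspace X. \<rho> c p \<ge> 0) \<and>
        X closure_of {p \<in> topspace X. \<rho> c p \<noteq> 0} \<subseteq> fst c) \<and>
     (\<forall>p\<in>topspace X. (\<Sum>c\<in>C. \<rho> c p) = 1)"

text \<open>The integrals over the surface (against the area element induced by \<open>r\<close>) and over its boundary
  (against the line element induced by \<open>r\<close>) are computed in charts with a partition of unity.  For
  continuous integrands and smooth \<open>r\<close> they do not depend on the partition of unity, and the
  description below singles out the common value.\<close>

definition surface_integral ::
    "'a topology \<Rightarrow> 'a chart set \<Rightarrow> ('a \<Rightarrow> real^3) \<Rightarrow> ('a \<Rightarrow> real) \<Rightarrow> real" where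
  "surface_integral X A r f =
     (THE I. \<exists>C \<rho>. partition_of_unity X A C \<rho> \<and>
        I = (\<Sum>c\<in>C. integral (chart_image c)
               (\<lambda>x. let p = chart_inv c x in
                  \<rho> c p * f p * norm (cross3 (coord_deriv c 1 r p) (coord_deriv c 2 r p)))))"

definition boundary_integral ::
    "'a topology \<Rightarrow> 'a chart set \<Rightarrow> ('a \<Rightarrow> real^3) \<Rightarrow> ('a \<Rightarrow> real) \<Rightarrow> real" where
  "boundary_integral X A r g =
     (THE I. \<exists>C \<rho>. partition_of_unity X A C \<rho> \<and>
        I = (\<Sum>c\<in>C. integral {s. vector [s, 0] \<in> chart_image c}
               (\<lambda>s. let p = chart_inv c (vector [s, 0]) in
                  \<rho> c p * g p * norm (coord_deriv c 1 r p))))"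

definition algebraic_volume :: "'a topology \<Rightarrow> 'a chart set \<Rightarrow> ('a \<Rightarrow> real^3) \<Rightarrow> real" where
  "algebraic_volume X A r = 1/3 * surface_integral X A r (\<lambda>p. r p \<bullet> unit_normal A r p)"

end

theory Submission
  imports Defs
begin

text \<open>
  For \<open>r = R + t V\<close> the density \<open>(r \<bullet> N) dA = r \<bullet> (r\<^sub>1 \<times> r\<^sub>2) du\<^sub>1 du\<^sub>2\<close> is a cubic polynomial
  in \<open>t\<close>.  Its linear coefficient is
  \<open>V \<bullet> (R\<^sub>1 \<times> R\<^sub>2) + R \<bullet> (V\<^sub>1 \<times> R\<^sub>2) + R \<bullet> (R\<^sub>1 \<times> V\<^sub>2) = 3 V \<bullet> (R\<^sub>1 \<times> R\<^sub>2) + d\<omega>\<close> with the 1-form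
  \<open>\<omega> = (R \<times> V) \<bullet> dR\<close>; this uses only the symmetry of second derivatives.  The first summand gives the
  integral of \<open>v\<^sub>n\<close>.  The second is integrated with a partition of unity \<open>\<rho>\<close>: the divergence theorem
  in the half plane turns \<open>d (\<rho>\<^sub>c \<omega>)\<close> into a boundary integral, and the error terms \<open>d\<rho>\<^sub>c \<and> \<omega>\<close> add
  up to \<open>0\<close>, because they are independent of the chart and \<open>\<Sum> d\<rho>\<^sub>c = 0\<close>.  On the boundary,
  \<open>(R \<times> V) \<bullet> R\<^sub>1\<close> equals \<open>((R \<bullet> N) \<eta> - v\<^sub>n R) \<bullet> t\<close> times \<open>|R\<^sub>1|\<close>, since \<open>|R\<^sub>1| t = R\<^sub>1 \<times> N\<close>.
\<close>

subsection \<open>Calculus of smooth functions\<close>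

text \<open>Both integrals are definite descriptions, so neither has a usable value until a
  partition of unity is known to exist and all partitions are known to give the same sum. The second
  point rests on changing variables between charts, which works for coefficients that transform like
  forms; hence every integrand, error terms included, is handled as a density with a transformation
  law. Each error term is integrated in its own chart, so the cancellation can be used only after
  all of them have been redistributed to common charts by that law. The constants come from
  \<open>triple_density\<close>, which is symmetric in its last two arguments and doubles the
  ordinary triple product when these agree. The volume therefore carries 1/3 * 1/2 = 1/6. As the
  volume is exactly a cubic polynomial in \<open>t\<close>, nothing has to be differentiated under
  the integral sign. Derivatives are taken within subsets of the half plane, so uniqueness and
  symmetry of derivatives have to be secured at edge points too.\<close>

declare Ck_on.simps(2) [simp del]

section \<open>Functions of class C^k on open sets\<close>

lemma Ck_on_cong:
  assumes "open S" "Ck_on k S f" "\<And>x. x \<in> S \<Longrightarrow> f x = g x"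
  shows "Ck_on k S g"
  using assms
proof (induction k arbitrary: f g)
  case 0
  then show ?case using continuous_on_cong[of S S f g] by simp
next
  case (Suc k)
  have d: "f differentiable (at x)" if "x \<in> S" for x
    using Suc.prems(2) that by (simp only: Ck_on.simps)
  have dg: "g differentiable (at x)" if "x \<in> S" for x
    by (rule differentiableI, rule has_derivative_transform_within_open
        [OF frechet_derivative_works[THEN iffD1, OF d[OF that]] Suc.prems(1) that Suc.prems(3)])
  have eq: "frechet_derivative f (at x) = frechet_derivative g (at x)" if "x \<in> S" for x
    by (rule frechet_derivative_transform_within_open[OF d[OF that] Suc.prems(1) that Suc.prems(3)])
  show ?case
    unfolding Ck_on.simps
  proof (intro conjI ballI dg)
    fix i :: 'a assume "i \<in> Basis"
    then have "Ck_on k S (\<lambda>x. frechet_derivative f (at x) i)"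
      using Suc.prems(2) by (simp only: Ck_on.simps)
    then show "Ck_on k S (\<lambda>x. frechet_derivative g (at x) i)"
      by (rule Suc.IH[OF Suc.prems(1)]) (simp only: eq)
  qed
qed

lemma Ck_on_SucE:
  assumes "Ck_on (Suc k) S f"
  shows "\<And>x. x \<in> S \<Longrightarrow> (f has_derivative frechet_derivative f (at x)) (at x)"
    and "\<And>i. i \<in> Basis \<Longrightarrow> Ck_on k S (\<lambda>x. frechet_derivative f (at x) i)"
  using assms unfolding Ck_on.simps frechet_derivative_works by blast+

lemma Ck_on_imp_continuous_on: "Ck_on k S f \<Longrightarrow> continuous_on S f"
  by (cases k) (auto intro!: continuous_at_imp_continuous_on has_derivative_continuous dest: Ck_on_SucE(1))

lemma Ck_on_SucD: "Ck_on (Suc k) S f \<Longrightarrow> Ck_on k S f"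
proof (induction k arbitrary: f)
  case 0
  then show ?case using Ck_on_imp_continuous_on[OF 0] by simp
next
  case (Suc k)
  show ?case
    unfolding Ck_on.simps(2)[of k]
  proof (intro conjI ballI)
    show "f differentiable (at x)" if "x \<in> S" for x
      using Ck_on_SucE(1)[OF Suc.prems that] by (rule differentiableI)
    show "Ck_on k S (\<lambda>x. frechet_derivative f (at x) i)" if "i \<in> Basis" for i
      by (rule Suc.IH) (rule Ck_on_SucE(2)[OF Suc.prems that])
  qed
qed

lemma Ck_on_subset: "Ck_on k S f \<Longrightarrow> T \<subseteq> S \<Longrightarrow> Ck_on k T f"
proof (induction k arbitrary: f)
  case 0
  then show ?case using continuous_on_subset by auto
next
  case (Suc k)
  then show ?case unfolding Ck_on.simps by blast
qed

text \<open>Lets a closure proof supply its own derivative \<open>f'\<close> in place of the chosen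
  \<open>frechet_derivative\<close>; since \<open>S\<close> is open, agreement of the two on
  \<open>S\<close> is inherited by their further derivatives.\<close>

lemma Ck_on_SucI:
  assumes "open S" and der: "\<And>x. x \<in> S \<Longrightarrow> (f has_derivative f' x) (at x)"
    and "\<And>i. i \<in> Basis \<Longrightarrow> Ck_on k S (\<lambda>x. f' x i)"
  shows "Ck_on (Suc k) S f"
  unfolding Ck_on.simps
proof (intro conjI ballI)
  show "f differentiable at x" if "x \<in> S" for x
    using der[OF that] by (rule differentiableI)
  show "Ck_on k S (\<lambda>x. frechet_derivative f (at x) i)" if "i \<in> Basis" for i
    by (rule Ck_on_cong[OF assms(1) assms(3)[OF that]]) (use frechet_derivative_at[OF der] in auto)
qed

lemma Ck_on_const: "open S \<Longrightarrow> Ck_on k S (\<lambda>x. c)"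
proof (induction k arbitrary: c)
  case (Suc k)
  show ?case
    by (rule Ck_on_SucI[OF Suc.prems has_derivative_const Suc.IH[OF Suc.prems]])
qed simp

lemma Ck_on_bounded_linear_compose:
  assumes "open S" "Ck_on k S f" "bounded_linear L"
  shows "Ck_on k S (\<lambda>x. L (f x))"
  using assms(2)
proof (induction k arbitrary: f)
  case 0
  then show ?case using assms(3) by (simp add: linear_continuous_on_compose bounded_linear.continuous_on)
next
  case (Suc k)
  show ?case
    using Ck_on_SucE[OF Suc.prems] Suc.IH
    by (intro Ck_on_SucI[where f' = "\<lambda>x h. L (frechet_derivative f (at x) h)"] \<open>open S\<close>)
      (auto intro: bounded_linear.has_derivative[OF assms(3)])
qed

lemma Ck_on_ident: "open S \<Longrightarrow> Ck_on k S (\<lambda>x. x)"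
proof (cases k)
  case (Suc m)
  assume "open S"
  then show ?thesis
    unfolding Suc by (rule Ck_on_SucI[OF _ has_derivative_ident Ck_on_const[OF \<open>open S\<close>]])
qed simp

lemma Ck_on_bounded_linear: "open S \<Longrightarrow> bounded_linear L \<Longrightarrow> Ck_on k S L"
  using Ck_on_bounded_linear_compose[OF _ Ck_on_ident] by blast

lemma Ck_on_add:
  assumes "open S" "Ck_on k S f" "Ck_on k S g"
  shows "Ck_on k S (\<lambda>x. f x + g x)"
  using assms(2,3)
proof (induction k arbitrary: f g)
  case 0
  then show ?case by (simp add: continuous_on_add)
next
  case (Suc k)
  show ?case
    using Ck_on_SucE[OF Suc.prems(1)] Ck_on_SucE[OF Suc.prems(2)] Suc.IH
    by (intro Ck_on_SucI[where f' = "\<lambda>x h. frechet_derivative f (at x) h + frechet_derivative g (at x) h"]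
        \<open>open S\<close>) (auto intro: has_derivative_add)
qed

lemma Ck_on_sum:
  assumes "open S" "\<And>i. i \<in> I \<Longrightarrow> Ck_on k S (f i)"
  shows "Ck_on k S (\<lambda>x. \<Sum>i\<in>I. f i x)"
  using assms(2)
  by (induction I rule: infinite_finite_induct) (auto intro!: Ck_on_const Ck_on_add \<open>open S\<close>)

text \<open>The product rule leaves one factor undifferentiated, so the induction hypothesis for
  \<open>k\<close> meets a factor of class \<open>Suc k\<close>; \<open>Ck_on_SucD\<close> lowers
  it.\<close>

lemma Ck_on_scaleR:
  assumes "open S" "Ck_on k S f" "Ck_on k S g"
  shows "Ck_on k S (\<lambda>x. f x *\<^sub>R g x)"
  using assms(2,3)
proof (induction k arbitrary: f g)
  case 0
  then show ?case by (simp add: continuous_on_scaleR)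
next
  case (Suc k)
  show ?case
  proof (rule Ck_on_SucI[OF \<open>open S\<close>])
    show "((\<lambda>x. f x *\<^sub>R g x) has_derivative
        (\<lambda>h. f x *\<^sub>R frechet_derivative g (at x) h + frechet_derivative f (at x) h *\<^sub>R g x)) (at x)"
      if "x \<in> S" for x
      using Ck_on_SucE(1)[OF Suc.prems(1) that] Ck_on_SucE(1)[OF Suc.prems(2) that]
      by (rule has_derivative_scaleR)
    show "Ck_on k S (\<lambda>x. f x *\<^sub>R frechet_derivative g (at x) i + frechet_derivative f (at x) i *\<^sub>R g x)"
      if "i \<in> Basis" for i
      by (rule Ck_on_add[OF \<open>open S\<close> Suc.IH[OF Ck_on_SucD[OF Suc.prems(1)] Ck_on_SucE(2)[OF Suc.prems(2) that]]
            Suc.IH[OF Ck_on_SucE(2)[OF Suc.prems(1) that] Ck_on_SucD[OF Suc.prems(2)]]])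
  qed
qed

text \<open>\<open>Ck_on\<close> controls derivatives only in basis directions. The inner derivative
  is therefore expanded in the basis of \<open>'b\<close>, which turns the chain rule into a finite
  sum of products to which the induction hypothesis applies.\<close>

lemma Ck_on_compose:
  fixes f :: "'a::euclidean_space \<Rightarrow> 'b::euclidean_space"
  assumes "open S" "f ` S \<subseteq> T" "Ck_on k S f" "Ck_on k T g"
  shows "Ck_on k S (\<lambda>x. g (f x))"
  using assms(2-4)
proof (induction k arbitrary: g)
  case 0
  then show ?case by (auto intro: continuous_on_compose2)
next
  case (Suc k)
  have inT: "f x \<in> T" if "x \<in> S" for x
    using that Suc.prems(1) by auto
  have lin: "linear (frechet_derivative g (at (f x)))" if "x \<in> S" for x
    using Ck_on_SucE(1)[OF Suc.prems(3) inT[OF that]] has_derivative_linear by blast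
  have eq: "frechet_derivative g (at (f x)) (frechet_derivative f (at x) h) =
      (\<Sum>j\<in>Basis. (frechet_derivative f (at x) h \<bullet> j) *\<^sub>R frechet_derivative g (at (f x)) j)"
    if "x \<in> S" for x h
    by (subst euclidean_representation[symmetric, of "frechet_derivative f (at x) h"])
      (simp add: linear_sum[OF lin[OF that]] linear_scale[OF lin[OF that]] del: euclidean_representation)
  have "Ck_on k S f"
    using Suc.prems(2) by (rule Ck_on_SucD)
  show ?case
  proof (rule Ck_on_SucI[OF \<open>open S\<close>])
    show "((\<lambda>x. g (f x)) has_derivative
        (\<lambda>h. \<Sum>j\<in>Basis. (frechet_derivative f (at x) h \<bullet> j) *\<^sub>R frechet_derivative g (at (f x)) j)) (at x)"
      if "x \<in> S" for x
      using has_derivative_compose[OF Ck_on_SucE(1)[OF Suc.prems(2) that]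
          Ck_on_SucE(1)[OF Suc.prems(3) inT[OF that]]] eq[OF that] by simp
    show "Ck_on k S (\<lambda>x. \<Sum>j\<in>Basis. (frechet_derivative f (at x) i \<bullet> j) *\<^sub>R frechet_derivative g (at (f x)) j)"
      if "i \<in> Basis" for i
    proof (rule Ck_on_sum[OF \<open>open S\<close>])
      fix j :: 'b assume "j \<in> Basis"
      show "Ck_on k S (\<lambda>x. (frechet_derivative f (at x) i \<bullet> j) *\<^sub>R frechet_derivative g (at (f x)) j)"
        by (rule Ck_on_scaleR[OF \<open>open S\<close>
              Ck_on_bounded_linear_compose[OF \<open>open S\<close> Ck_on_SucE(2)[OF Suc.prems(2) that]
                bounded_linear_inner_left[of j]]
              Suc.IH[OF Suc.prems(1) \<open>Ck_on k S f\<close> Ck_on_SucE(2)[OF Suc.prems(3) \<open>j \<in> Basis\<close>]]])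
    qed
  qed
qed

section \<open>A smooth bump function\<close>

lemma tendsto_exp_minus_inverse_div_power:
  "((\<lambda>t. exp (- (1/t)) / t ^ m) \<longlongrightarrow> 0) (at_right (0::real))"
proof -
  \<comment> \<open>With \<open>x = 1/t\<close> the quotient becomes a power over an exponential at
    infinity.\<close>
  have "((\<lambda>x. (inverse x) ^ m / exp (inverse x)) \<longlongrightarrow> 0) (at_right (0::real))"
    using tendsto_power_div_exp_0 filterlim_inverse_at_top_right by (rule filterlim_compose)
  then show ?thesis
    by (rule Lim_transform_eventually)
      (auto simp: exp_minus field_simps inverse_eq_divide intro!: always_eventually)
qed

text \<open>The functions \<open>t \<mapsto> exp (-1/t) / t^m\<close>, cut off at \<open>0\<close>, are closed under
  differentiation, which gives smoothness by induction.\<close>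

definition flat_exp :: "nat \<Rightarrow> real \<Rightarrow> real"
  where "flat_exp m t = (if t > 0 then exp (- (1/t)) / t ^ m else 0)"

lemma flat_exp_tendsto_0: "(flat_exp m \<longlongrightarrow> 0) (at 0)"
proof -
  have "(flat_exp m \<longlongrightarrow> 0) (at_right 0)"
    by (rule Lim_transform_eventually[OF tendsto_exp_minus_inverse_div_power[of m]])
      (auto simp: flat_exp_def eventually_at intro: exI[of _ 1])
  moreover have "(flat_exp m \<longlongrightarrow> 0) (at_left 0)"
    by (rule Lim_transform_eventually[OF tendsto_const])
      (auto simp: flat_exp_def eventually_at intro: exI[of _ 1])
  ultimately show ?thesis
    by (simp add: filterlim_at_split)
qed

text \<open>Away from 0 this is the usual calculus. At 0 the difference quotient of
  \<open>flat_exp m\<close> is \<open>flat_exp (m + 1)\<close>, which tends to 0, the value the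
  formula has there.\<close>

lemma flat_exp_has_real_derivative:
  "(flat_exp m has_real_derivative flat_exp (m + 2) t - real m * flat_exp (m + 1) t) (at t)"
proof -
  consider "t > 0" | "t = 0" | "t < 0" by linarith
  then show ?thesis
  proof cases
    case 1
    have "((\<lambda>t. exp (- (1/t)) / t ^ m) has_real_derivative
        flat_exp (m + 2) t - real m * flat_exp (m + 1) t) (at t)"
      using 1 by (auto intro!: derivative_eq_intros simp: flat_exp_def power2_eq_square)
        (cases m; simp add: field_simps power2_eq_square)
    then show ?thesis
      by (rule has_field_derivative_transform_within[where d = t]) (use 1 in \<open>auto simp: flat_exp_def dist_real_def\<close>)
  next
    case 2
    have "((\<lambda>h. (flat_exp m (0 + h) - flat_exp m 0) / h) \<longlongrightarrow> 0) (at 0)"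
      by (rule Lim_transform_eventually[OF flat_exp_tendsto_0[of "m + 1"]])
        (auto simp: flat_exp_def)
    then show ?thesis
      using 2 by (simp add: DERIV_def flat_exp_def)
  next
    case 3
    have "((\<lambda>t. 0) has_real_derivative 0) (at t)" by simp
    then have "(flat_exp m has_real_derivative 0) (at t)"
      by (rule has_field_derivative_transform_within[where d = "-t"]) (use 3 in \<open>auto simp: flat_exp_def dist_real_def\<close>)
    then show ?thesis using 3 by (simp add: flat_exp_def)
  qed
qed

lemma Ck_on_flat_exp: "Ck_on k UNIV (flat_exp m)"
proof (induction k arbitrary: m)
  case 0
  show ?case
    by (auto intro!: continuous_at_imp_continuous_on DERIV_isCont flat_exp_has_real_derivative)
next
  case (Suc k)
  have *: "Ck_on k UNIV (\<lambda>t. flat_exp (m + 2) t + (- real m) *\<^sub>R flat_exp (m + 1) t)"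
    using Suc.IH by (intro Ck_on_add Ck_on_scaleR Ck_on_const) auto
  show ?case
    by (rule Ck_on_SucI[OF open_UNIV flat_exp_has_real_derivative[unfolded has_field_derivative_def]])
      (use * in auto)
qed

text \<open>All exponents are treated at once so that the induction closes under differentiation;
  exponent 1 yields smoothness of quotients.\<close>

lemma Ck_on_inverse_power: "Ck_on k {0<..} (\<lambda>t::real. 1 / t ^ m)"
proof (induction k arbitrary: m)
  case 0
  show ?case by (auto intro!: continuous_intros)
next
  case (Suc k)
  have *: "Ck_on k {0<..} (\<lambda>t::real. (- real m) *\<^sub>R (1 / t ^ (m + 1)))"
    by (intro Ck_on_scaleR Ck_on_const Suc.IH) auto
  have d: "((\<lambda>t::real. 1 / t ^ m) has_real_derivative (- real m) *\<^sub>R (1 / t ^ (m + 1))) (at t)"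
    if "t > 0" for t
    using that by (auto intro!: derivative_eq_intros) (cases m; simp add: field_simps)
  show ?case
    by (rule Ck_on_SucI[OF _ d[unfolded has_field_derivative_def]]) (use * in auto)
qed

lemma Ck_on_norm_diff_sq:
  fixes a :: "'a::euclidean_space"
  assumes "open S"
  shows "Ck_on k S (\<lambda>x. (norm (x - a))\<^sup>2)"
proof -
  have "Ck_on k S (\<lambda>x. \<Sum>b\<in>Basis. (x \<bullet> b + (- (a \<bullet> b))) *\<^sub>R (x \<bullet> b + (- (a \<bullet> b))))"
    by (intro Ck_on_sum Ck_on_scaleR Ck_on_add Ck_on_const Ck_on_bounded_linear assms
        bounded_linear_inner_left)
  then show ?thesis
    by (rule Ck_on_cong[OF assms])
      (subst power2_norm_eq_inner, subst euclidean_inner, simp add: inner_diff_left)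
qed

text \<open>The squared distance is used because the distance itself is not differentiable at the
  centre \<open>a\<close>.\<close>

definition bump :: "'a::euclidean_space \<Rightarrow> real \<Rightarrow> 'a \<Rightarrow> real"
  where "bump a r x = flat_exp 0 (r\<^sup>2 - (norm (x - a))\<^sup>2)"

lemma Ck_on_bump: "Ck_on k UNIV (bump a r)"
proof -
  have "Ck_on k UNIV (\<lambda>x. r\<^sup>2 + (-1) *\<^sub>R (norm (x - a))\<^sup>2)"
    by (intro Ck_on_add Ck_on_scaleR Ck_on_const Ck_on_norm_diff_sq open_UNIV)
  from Ck_on_compose[OF open_UNIV subset_UNIV this Ck_on_flat_exp[of k 0]] show ?thesis
    by (simp add: bump_def[abs_def])
qed

lemma bump_pos_iff: "r > 0 \<Longrightarrow> bump a r x > 0 \<longleftrightarrow> x \<in> ball a r"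
  by (auto simp: bump_def flat_exp_def dist_norm norm_minus_commute power2_less_imp_less
      intro!: power_strict_mono)

lemma bump_nonneg: "bump a r x \<ge> 0"
  by (simp add: bump_def flat_exp_def)

section \<open>Smoothness on sets that need not be open\<close>

lemma smooth_onE:
  assumes "smooth_on S f" "x \<in> S"
  obtains W F where "open W" "x \<in> W" "\<forall>k. Ck_on k W F" "\<forall>y\<in>S \<inter> W. F y = f y"
  using bspec[OF assms(1)[unfolded smooth_on_def] assms(2)] by (elim exE conjE)

lemma smooth_onI:
  assumes "\<And>x. x \<in> S \<Longrightarrow> \<exists>W F. open W \<and> x \<in> W \<and> (\<forall>k. Ck_on k W F) \<and> (\<forall>y\<in>S \<inter> W. F y = f y)"
  shows "smooth_on S f"
  unfolding smooth_on_def by (rule ballI) (rule assms)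

lemma smooth_on_cong:
  assumes "smooth_on S f" "\<And>x. x \<in> S \<Longrightarrow> f x = g x"
  shows "smooth_on S g"
proof (rule smooth_onI)
  fix x assume "x \<in> S"
  then obtain W F where "open W" "x \<in> W" "\<forall>k. Ck_on k W F" "\<forall>y\<in>S \<inter> W. F y = f y"
    by (rule smooth_onE[OF assms(1)])
  then show "\<exists>W F. open W \<and> x \<in> W \<and> (\<forall>k. Ck_on k W F) \<and> (\<forall>y\<in>S \<inter> W. F y = g y)"
    using assms(2) by (intro exI[of _ W] exI[of _ F]) auto
qed

text \<open>Used to glue a function from different formulas on a relatively open cover; the local
  extension is cut down to the open set that cuts \<open>T\<close> out of \<open>S\<close>.\<close>

lemma smooth_on_locally:
  assumes "\<And>x. x \<in> S \<Longrightarrow> \<exists>T. openin (top_of_set S) T \<and> x \<in> T \<and> smooth_on T f"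
  shows "smooth_on S f"
proof (rule smooth_onI)
  fix x assume "x \<in> S"
  then obtain T where T: "openin (top_of_set S) T" "x \<in> T" "smooth_on T f"
    using assms by blast
  then obtain W F where WF: "open W" "x \<in> W" "\<forall>k. Ck_on k W F" "\<forall>y\<in>T \<inter> W. F y = f y"
    by (elim smooth_onE)
  obtain U where U: "open U" "T = S \<inter> U"
    using T(1) by (auto simp: openin_open)
  show "\<exists>W F. open W \<and> x \<in> W \<and> (\<forall>k. Ck_on k W F) \<and> (\<forall>y\<in>S \<inter> W. F y = f y)"
    using WF U T(2) by (intro exI[of _ "W \<inter> U"] exI[of _ F]) (auto intro: Ck_on_subset)
qed

lemma smooth_on_const: "smooth_on S (\<lambda>x. c)"
  by (rule smooth_onI) (intro exI[of _ UNIV] exI[of _ "\<lambda>x. c"], simp add: Ck_on_const)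

lemma smooth_on_compose:
  fixes f :: "'a::euclidean_space \<Rightarrow> 'b::euclidean_space"
  assumes "smooth_on S f" "open T" "f ` S \<subseteq> T" "\<And>k. Ck_on k T g"
  shows "smooth_on S (\<lambda>x. g (f x))"
proof (rule smooth_onI)
  fix x assume "x \<in> S"
  then obtain W F where WF: "open W" "x \<in> W" "\<forall>k. Ck_on k W F" "\<forall>y\<in>S \<inter> W. F y = f y"
    by (rule smooth_onE[OF assms(1)])
  \<comment> \<open>\<open>F\<close> agrees with \<open>f\<close> only on \<open>S\<close>, so
    elsewhere it may leave \<open>T\<close>; the extension is restricted to the part where it does
    not.\<close>
  let ?W = "W \<inter> F -` T"
  have "open ?W"
    using Ck_on_imp_continuous_on[OF WF(3)[rule_format]] WF(1) assms(2) by (rule continuous_open_preimage)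
  moreover have "x \<in> ?W" using \<open>x \<in> S\<close> WF assms(3) by auto
  moreover have "Ck_on k ?W (\<lambda>x. g (F x))" for k
    by (rule Ck_on_compose[OF \<open>open ?W\<close> _ _ assms(4)]) (auto intro: Ck_on_subset[OF WF(3)[rule_format]])
  ultimately show "\<exists>W F. open W \<and> x \<in> W \<and> (\<forall>k. Ck_on k W F) \<and> (\<forall>y\<in>S \<inter> W. F y = g (f y))"
    using WF(4) by (intro exI[of _ ?W] exI[of _ "\<lambda>x. g (F x)"]) auto
qed

lemma smooth_on_binary:
  fixes S :: "'a::euclidean_space set"
  assumes "\<And>k (W::'a set) F G. open W \<Longrightarrow> Ck_on k W F \<Longrightarrow> Ck_on k W G \<Longrightarrow> Ck_on k W (\<lambda>x. B (F x) (G x))"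
    and "smooth_on S f" "smooth_on S g"
  shows "smooth_on S (\<lambda>x. B (f x) (g x))"
proof (rule smooth_onI)
  fix x assume "x \<in> S"
  obtain W F where W: "open W" "x \<in> W" "\<forall>k. Ck_on k W F" "\<forall>y\<in>S \<inter> W. F y = f y"
    by (rule smooth_onE[OF assms(2) \<open>x \<in> S\<close>])
  obtain V G where V: "open V" "x \<in> V" "\<forall>k. Ck_on k V G" "\<forall>y\<in>S \<inter> V. G y = g y"
    by (rule smooth_onE[OF assms(3) \<open>x \<in> S\<close>])
  have "Ck_on k (W \<inter> V) (\<lambda>x. B (F x) (G x))" for k
    by (rule assms(1)) (use W V Ck_on_subset[of k W F "W \<inter> V"] Ck_on_subset[of k V G "W \<inter> V"] in auto)
  then show "\<exists>W F. open W \<and> x \<in> W \<and> (\<forall>k. Ck_on k W F) \<and> (\<forall>y\<in>S \<inter> W. F y = B (f y) (g y))"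
    using W V by (intro exI[of _ "W \<inter> V"] exI[of _ "\<lambda>x. B (F x) (G x)"]) auto
qed

lemma smooth_on_add: "smooth_on S f \<Longrightarrow> smooth_on S g \<Longrightarrow> smooth_on S (\<lambda>x. f x + g x)"
  by (rule smooth_on_binary[where B = "(+)"]) (auto intro: Ck_on_add)

lemma smooth_on_scaleR: "smooth_on S f \<Longrightarrow> smooth_on S g \<Longrightarrow> smooth_on S (\<lambda>x. f x *\<^sub>R g x)"
  by (rule smooth_on_binary[where B = "(*\<^sub>R)"]) (auto intro: Ck_on_scaleR)

lemma smooth_on_sum:
  "(\<And>i. i \<in> I \<Longrightarrow> smooth_on S (f i)) \<Longrightarrow> smooth_on S (\<lambda>x. \<Sum>i\<in>I. f i x)"
  by (induction I rule: infinite_finite_induct) (auto intro!: smooth_on_const smooth_on_add)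

lemma smooth_on_divide:
  fixes f g :: "'a::euclidean_space \<Rightarrow> real"
  assumes "smooth_on S f" "smooth_on S g" "\<And>x. x \<in> S \<Longrightarrow> g x > 0"
  shows "smooth_on S (\<lambda>x. f x / g x)"
proof -
  have "smooth_on S (\<lambda>x. 1 / (g x) ^ 1)"
    by (rule smooth_on_compose[OF assms(2) _ _ Ck_on_inverse_power]) (use assms(3) in auto)
  from smooth_on_scaleR[OF assms(1) this] show ?thesis by simp
qed

lemma smooth_on_imp_continuous_on:
  assumes "smooth_on S f"
  shows "continuous_on S f"
  unfolding continuous_on_eq_continuous_within
proof
  fix x assume "x \<in> S"
  then obtain W F where WF: "open W" "x \<in> W" "\<forall>k. Ck_on k W F" "\<forall>y\<in>S \<inter> W. F y = f y"
    by (rule smooth_onE[OF assms])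
  have "continuous (at x within S) F"
    using Ck_on_imp_continuous_on[OF WF(3)[rule_format]] WF(1,2)
    by (simp add: continuous_on_eq_continuous_at continuous_at_imp_continuous_at_within)
  moreover obtain d where d: "d > 0" "ball x d \<subseteq> W"
    using WF(1,2) open_contains_ball by blast
  moreover have "F y = f y" if "y \<in> S" "dist y x < d" for y
  proof -
    have "y \<in> W"
      by (rule subsetD[OF d(2)]) (use that(2) in \<open>simp add: dist_commute\<close>)
    then show ?thesis using WF(4) that(1) by simp
  qed
  ultimately show "continuous (at x within S) f"
    using \<open>x \<in> S\<close> by (intro continuous_transform_within[of x S F d f])
qed

section \<open>Symmetry of second derivatives\<close>

lemma mixed_difference:
  fixes F :: "'a::euclidean_space \<Rightarrow> real"
  assumes "Ck_on 2 W F" "ball x r \<subseteq> W" "i \<in> Basis" "j \<in> Basis" "0 < h" "2 * h < r"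
  shows "\<exists>z. dist x z \<le> 2 * h \<and> F (x + h *\<^sub>R i + h *\<^sub>R j) - F (x + h *\<^sub>R i) - F (x + h *\<^sub>R j) + F x =
    h * h * frechet_derivative (\<lambda>y. frechet_derivative F (at y) i) (at z) j"
proof -
  let ?G = "\<lambda>y. frechet_derivative F (at y) i"
  let ?H = "\<lambda>y. frechet_derivative ?G (at y) j"
  have F2: "Ck_on (Suc (Suc 0)) W F"
    using assms(1) by (simp only: numeral_2_eq_2)
  note F1 = Ck_on_SucE(1)[OF F2] and G1 = Ck_on_SucE(1)[OF Ck_on_SucE(2)[OF F2 \<open>i \<in> Basis\<close>]]
  have near: "dist x (x + s *\<^sub>R i + t *\<^sub>R j) \<le> 2 * h" if "0 \<le> s" "s \<le> h" "0 \<le> t" "t \<le> h" for s t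
  proof -
    have "dist x (x + s *\<^sub>R i + t *\<^sub>R j) = norm (s *\<^sub>R i + t *\<^sub>R j)"
      by (metis add.assoc add_diff_cancel_left' dist_commute dist_norm)
    also have "\<dots> \<le> s + t"
      using norm_triangle_ineq[of "s *\<^sub>R i" "t *\<^sub>R j"] that assms(3,4) by simp
    finally show ?thesis using that by simp
  qed
  have inW: "x + s *\<^sub>R i + t *\<^sub>R j \<in> W" if "0 \<le> s" "s \<le> h" "0 \<le> t" "t \<le> h" for s t
    using near[OF that] assms(2,6) by (auto simp: subset_iff)
  have inW0: "x + s *\<^sub>R i \<in> W" if "0 \<le> s" "s \<le> h" for s
    using inW[of s 0] that \<open>0 < h\<close> by simp
  have dF: "((\<lambda>s. F (x + s *\<^sub>R i + c)) has_real_derivative ?G (x + s *\<^sub>R i + c)) (at s)"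
    if "x + s *\<^sub>R i + c \<in> W" for s c
  proof -
    have "((\<lambda>s. x + s *\<^sub>R i + c) has_derivative (\<lambda>k. k *\<^sub>R i)) (at s)"
      by (auto intro!: derivative_eq_intros)
    from has_derivative_compose[OF this F1[OF that]]
    show ?thesis
      using linear_scale[OF has_derivative_linear[OF F1[OF that]]]
      by (simp add: has_field_derivative_def mult.commute[of _ "?G _"] fun_eq_iff
          mult_commute_abs)
  qed
  have dG: "((\<lambda>t. ?G (x + s *\<^sub>R i + t *\<^sub>R j)) has_real_derivative ?H (x + s *\<^sub>R i + t *\<^sub>R j)) (at t)"
    if "x + s *\<^sub>R i + t *\<^sub>R j \<in> W" for s t
  proof -
    have "((\<lambda>t. x + s *\<^sub>R i + t *\<^sub>R j) has_derivative (\<lambda>k. k *\<^sub>R j)) (at t)"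
      by (auto intro!: derivative_eq_intros)
    from has_derivative_compose[OF this G1[OF that]]
    show ?thesis
      using linear_scale[OF has_derivative_linear[OF G1[OF that]]]
      by (simp add: has_field_derivative_def mult.commute[of _ "?H _"] fun_eq_iff
          mult_commute_abs)
  qed
  \<comment> \<open>The second difference over a square of side \<open>h\<close> is a first
    difference along \<open>i\<close> of the increments along \<open>j\<close>; the mean value
    theorem is applied to these increments.\<close>
  have "\<exists>s. 0 < s \<and> s < h \<and>
      (F (x + h *\<^sub>R i + h *\<^sub>R j) - F (x + h *\<^sub>R i + 0)) - (F (x + 0 *\<^sub>R i + h *\<^sub>R j) - F (x + 0 *\<^sub>R i + 0)) =
      (h - 0) * (?G (x + s *\<^sub>R i + h *\<^sub>R j) - ?G (x + s *\<^sub>R i + 0))"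
    by (rule MVT2[OF \<open>0 < h\<close>, where f = "\<lambda>s. F (x + s *\<^sub>R i + h *\<^sub>R j) - F (x + s *\<^sub>R i + 0)"])
      (use inW inW0 \<open>0 < h\<close> in \<open>intro DERIV_diff dF; simp\<close>)
  then obtain s where s: "0 < s" "s < h" "F (x + h *\<^sub>R i + h *\<^sub>R j) - F (x + h *\<^sub>R i) - F (x + h *\<^sub>R j) + F x =
      h * (?G (x + s *\<^sub>R i + h *\<^sub>R j) - ?G (x + s *\<^sub>R i))"
    by auto
  \<comment> \<open>The remaining increment along \<open>j\<close> of the first derivative is
    treated by the mean value theorem once more.\<close>
  have "\<exists>t. 0 < t \<and> t < h \<and> ?G (x + s *\<^sub>R i + h *\<^sub>R j) - ?G (x + s *\<^sub>R i + 0 *\<^sub>R j) =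
      (h - 0) * ?H (x + s *\<^sub>R i + t *\<^sub>R j)"
    by (rule MVT2[OF \<open>0 < h\<close>]) (use s inW in \<open>intro dG; simp\<close>)
  then obtain t where t: "0 < t" "t < h" "?G (x + s *\<^sub>R i + h *\<^sub>R j) - ?G (x + s *\<^sub>R i) =
      h * ?H (x + s *\<^sub>R i + t *\<^sub>R j)"
    by auto
  show ?thesis
    using s t near[of s t] by (intro exI[of _ "x + s *\<^sub>R i + t *\<^sub>R j"]) simp
qed

text \<open>The second difference is symmetric in \<open>i\<close> and \<open>j\<close>, so the two
  mixed derivatives take a common value at points \<open>z\<close> and \<open>w\<close> arbitrarily
  close to \<open>x\<close>; continuity excludes that they differ at \<open>x\<close>.\<close>

lemma mixed_partials_real:
  fixes F :: "'a::euclidean_space \<Rightarrow> real"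
  assumes "open W" "Ck_on 2 W F" "x \<in> W" "i \<in> Basis" "j \<in> Basis"
  shows "frechet_derivative (\<lambda>y. frechet_derivative F (at y) i) (at x) j =
    frechet_derivative (\<lambda>y. frechet_derivative F (at y) j) (at x) i"
proof (rule ccontr)
  let ?H = "\<lambda>i j z. frechet_derivative (\<lambda>y. frechet_derivative F (at y) i) (at z) j"
  assume "?H i j x \<noteq> ?H j i x"
  then have e: "\<bar>?H i j x - ?H j i x\<bar> / 2 > 0" by simp
  have F2: "Ck_on (Suc (Suc 0)) W F"
    using assms(2) by (simp only: numeral_2_eq_2)
  have cont: "continuous_on W (?H i j)" if "i \<in> Basis" "j \<in> Basis" for i j
    using Ck_on_SucE(2)[OF Ck_on_SucE(2)[OF F2 that(1)] that(2)] by simp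
  obtain d1 where d1: "d1 > 0" "\<And>z. z \<in> W \<Longrightarrow> dist z x < d1 \<Longrightarrow> dist (?H i j z) (?H i j x) < \<bar>?H i j x - ?H j i x\<bar> / 2"
    using cont[OF assms(4,5)] assms(3) e unfolding continuous_on_iff by blast
  obtain d2 where d2: "d2 > 0" "\<And>z. z \<in> W \<Longrightarrow> dist z x < d2 \<Longrightarrow> dist (?H j i z) (?H j i x) < \<bar>?H i j x - ?H j i x\<bar> / 2"
    using cont[OF assms(5,4)] assms(3) e unfolding continuous_on_iff by blast
  obtain r where r: "r > 0" "ball x r \<subseteq> W"
    using assms(1,3) open_contains_ball by blast
  \<comment> \<open>Division by 3 makes \<open>2 * h\<close>, the distance bound of
    \<open>mixed_difference\<close>, strictly smaller than all three radii.\<close>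
  define h where "h = min r (min d1 d2) / 3"
  have h: "0 < h" "2 * h < r" "2 * h < d1" "2 * h < d2"
    using r d1(1) d2(1) by (auto simp: h_def)
  obtain z where z: "dist x z \<le> 2 * h" "F (x + h *\<^sub>R i + h *\<^sub>R j) - F (x + h *\<^sub>R i) - F (x + h *\<^sub>R j) + F x = h * h * ?H i j z"
    using mixed_difference[OF assms(2) r(2) assms(4,5) h(1,2)] by blast
  obtain w where w: "dist x w \<le> 2 * h" "F (x + h *\<^sub>R j + h *\<^sub>R i) - F (x + h *\<^sub>R j) - F (x + h *\<^sub>R i) + F x = h * h * ?H j i w"
    using mixed_difference[OF assms(2) r(2) assms(5,4) h(1,2)] by blast
  have comm: "x + h *\<^sub>R j + h *\<^sub>R i = x + h *\<^sub>R i + h *\<^sub>R j"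
    by (simp add: algebra_simps)
  have "h * h * ?H i j z = h * h * ?H j i w"
    using z(2) w(2) unfolding comm by linarith
  then have eq: "?H i j z = ?H j i w"
    using h(1) by simp
  have "dist (?H i j z) (?H i j x) < \<bar>?H i j x - ?H j i x\<bar> / 2"
    by (rule d1(2)) (use z(1) h r(2) in \<open>auto simp: dist_commute\<close>)
  moreover have "dist (?H j i w) (?H j i x) < \<bar>?H i j x - ?H j i x\<bar> / 2"
    by (rule d2(2)) (use w(1) h r(2) in \<open>auto simp: dist_commute\<close>)
  ultimately have "dist (?H i j x) (?H j i x) < \<bar>?H i j x - ?H j i x\<bar>"
    unfolding eq by (rule dist_triangle_half_r)
  then show False
    by (simp add: dist_real_def)
qed

text \<open>Reduction to components, since the mean value argument is real valued.\<close>

lemma mixed_partials: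
  fixes F :: "'a::euclidean_space \<Rightarrow> 'b::euclidean_space"
  assumes "open W" "Ck_on 2 W F" "x \<in> W" "i \<in> Basis" "j \<in> Basis"
  shows "frechet_derivative (\<lambda>y. frechet_derivative F (at y) i) (at x) j =
    frechet_derivative (\<lambda>y. frechet_derivative F (at y) j) (at x) i"
proof (rule euclidean_eqI)
  fix b :: 'b assume "b \<in> Basis"
  have F2: "Ck_on (Suc (Suc 0)) W F"
    using assms(2) by (simp only: numeral_2_eq_2)
  have inner1: "frechet_derivative (\<lambda>y. F y \<bullet> b) (at y) = (\<lambda>h. frechet_derivative F (at y) h \<bullet> b)"
    if "y \<in> W" for y
    by (rule frechet_derivative_at[symmetric], rule has_derivative_inner_left, rule Ck_on_SucE(1)[OF F2 that])
  have inner2: "frechet_derivative (\<lambda>y. frechet_derivative (\<lambda>y. F y \<bullet> b) (at y) i) (at x) j =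
      frechet_derivative (\<lambda>y. frechet_derivative F (at y) i) (at x) j \<bullet> b" if "i \<in> Basis" for i j
  proof -
    have "((\<lambda>y. frechet_derivative F (at y) i \<bullet> b) has_derivative
        (\<lambda>h. frechet_derivative (\<lambda>y. frechet_derivative F (at y) i) (at x) h \<bullet> b)) (at x)"
      by (rule has_derivative_inner_left, rule Ck_on_SucE(1)[OF Ck_on_SucE(2)[OF F2 that] \<open>x \<in> W\<close>])
    then have "((\<lambda>y. frechet_derivative (\<lambda>y. F y \<bullet> b) (at y) i) has_derivative
        (\<lambda>h. frechet_derivative (\<lambda>y. frechet_derivative F (at y) i) (at x) h \<bullet> b)) (at x)"
      by (rule has_derivative_transform_within_open[OF _ \<open>open W\<close> \<open>x \<in> W\<close>]) (simp add: inner1)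
    from frechet_derivative_at[OF this, symmetric] show ?thesis by simp
  qed
  have "Ck_on 2 W (\<lambda>y. F y \<bullet> b)"
    by (rule Ck_on_bounded_linear_compose[OF assms(1,2) bounded_linear_inner_left])
  from mixed_partials_real[OF assms(1) this assms(3-5)]
  show "frechet_derivative (\<lambda>y. frechet_derivative F (at y) i) (at x) j \<bullet> b =
      frechet_derivative (\<lambda>y. frechet_derivative F (at y) j) (at x) i \<bullet> b"
    by (simp add: inner2 assms)
qed


subsection \<open>Partial derivatives on relatively open subsets of the half plane\<close>

abbreviation half_open :: "(real^2) set \<Rightarrow> bool"
  where "half_open U \<equiv> openin (top_of_set half_plane) U"

text \<open>Differentiating within \<open>U\<close> keeps the notion meaningful at points on the
  edge of the half plane; for \<open>U\<close> a chart image this is \<open>coord_deriv\<close> read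
  in coordinates.\<close>

definition pd :: "(real^2) set \<Rightarrow> 2 \<Rightarrow> (real^2 \<Rightarrow> 'b::real_normed_vector) \<Rightarrow> real^2 \<Rightarrow> 'b"
  where "pd U i f x = frechet_derivative f (at x within U) (axis i 1)"

lemma at_within_openin:
  assumes "openin (top_of_set S) T" "x \<in> T"
  shows "at x within T = at x within S"
proof -
  obtain V where "open V" "T = S \<inter> V"
    using assms(1) by (auto simp: openin_open)
  then show ?thesis
    using assms(2) by (intro at_within_nhd[of x V]) auto
qed

lemma half_open_ball:
  assumes "half_open U" "x \<in> U"
  obtains r where "r > 0" "ball x r \<inter> half_plane \<subseteq> U"
  using assms unfolding openin_contains_ball by blast

text \<open>Both basis vectors have a nonnegative second component, so a short positive step along
  either of them stays in \<open>U\<close> even from an edge point. Such steps already determine a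
  derivative.\<close>

lemma frechet_within_eq:
  assumes "half_open U" "x \<in> U" "(f has_derivative f') (at x within U)"
  shows "frechet_derivative f (at x within U) = f'"
proof (rule frechet_derivative_unique_within[where S = U and f = f and x = x])
  show "(f has_derivative frechet_derivative f (at x within U)) (at x within U)"
    using frechet_derivative_works assms(3) differentiableI by blast
  fix i :: "real^2" and e :: real assume "i \<in> Basis" "e > 0"
  obtain r where r: "r > 0" "ball x r \<inter> half_plane \<subseteq> U"
    using half_open_ball[OF assms(1,2)] .
  define d where "d = min e r / 2"
  have d: "0 < d" "d < e" "d < r" using r(1) \<open>e > 0\<close> by (auto simp: d_def)
  have "i $ 2 \<ge> 0" using \<open>i \<in> Basis\<close> by (auto simp: Basis_vec_def axis_def)
  moreover have "x $ 2 \<ge> 0"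
    using openin_imp_subset[OF assms(1)] assms(2) by (auto simp: half_plane_def)
  moreover have "x + d *\<^sub>R i \<in> ball x r"
    using d \<open>i \<in> Basis\<close> by (simp add: dist_norm)
  ultimately have "x + d *\<^sub>R i \<in> U"
    using r(2) d(1) by (auto simp: half_plane_def)
  then show "\<exists>d. 0 < \<bar>d\<bar> \<and> \<bar>d\<bar> < e \<and> x + d *\<^sub>R i \<in> U"
    using d by (intro exI[of _ d]) auto
qed (rule assms(3))

lemma pd_eqI:
  "half_open U \<Longrightarrow> x \<in> U \<Longrightarrow> (f has_derivative f') (at x within U) \<Longrightarrow> pd U i f x = f' (axis i 1)"
  by (simp add: pd_def frechet_within_eq)

text \<open>Any local smooth extension may be used to compute the derivative within
  \<open>U\<close>; by \<open>frechet_within_eq\<close> the result is the same for all extensions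
  when \<open>U\<close> is relatively open in the half plane.\<close>

lemma smooth_on_local_derivative:
  assumes "x \<in> U" "open W" "x \<in> W" "Ck_on (Suc k) W F" "\<forall>y\<in>U \<inter> W. F y = f y"
  shows "(f has_derivative frechet_derivative F (at x)) (at x within U)"
proof -
  have "(F has_derivative frechet_derivative F (at x)) (at x within U \<inter> W)"
    using Ck_on_SucE(1)[OF assms(4,3)] has_derivative_at_withinI by blast
  then have "(f has_derivative frechet_derivative F (at x)) (at x within U \<inter> W)"
    using assms by (elim has_derivative_transform[rotated -1]) auto
  moreover have "at x within U \<inter> W = at x within U"
    by (rule at_within_openin) (use assms in \<open>auto simp: openin_open\<close>)
  ultimately show ?thesis by simp
qed

lemma smooth_on_has_derivative:
  assumes "smooth_on U f" "x \<in> U"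
  shows "(f has_derivative frechet_derivative f (at x within U)) (at x within U)"
proof -
  obtain W F where WF: "open W" "x \<in> W" "\<forall>k. Ck_on k W F" "\<forall>y\<in>U \<inter> W. F y = f y"
    by (rule smooth_onE[OF assms])
  from smooth_on_local_derivative[OF assms(2) WF(1,2) WF(3)[rule_format] WF(4)]
  show ?thesis
    using frechet_derivative_works differentiableI by blast
qed

lemma smooth_on_pd_local:
  assumes "half_open U" "open W" "\<forall>k. Ck_on k W F" "\<forall>y\<in>U \<inter> W. F y = f y" "y \<in> U \<inter> W"
  shows "pd U i f y = frechet_derivative F (at y) (axis i 1)"
  by (rule pd_eqI[OF assms(1)])
    (use assms smooth_on_local_derivative[OF _ assms(2) _ assms(3)[rule_format] assms(4)] in auto)

lemma smooth_on_pd: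
  assumes "half_open U" "smooth_on U f"
  shows "smooth_on U (pd U i f)"
proof (rule smooth_onI)
  fix x assume "x \<in> U"
  then obtain W F where WF: "open W" "x \<in> W" "\<forall>k. Ck_on k W F" "\<forall>y\<in>U \<inter> W. F y = f y"
    by (rule smooth_onE[OF assms(2)])
  have "Ck_on k W (\<lambda>y. frechet_derivative F (at y) (axis i 1))" for k
    by (rule Ck_on_SucE(2)[OF WF(3)[rule_format]]) simp
  then show "\<exists>W F. open W \<and> x \<in> W \<and> (\<forall>k. Ck_on k W F) \<and> (\<forall>y\<in>U \<inter> W. F y = pd U i f y)"
    using WF smooth_on_pd_local[OF assms(1) WF(1,3,4)]
    by (intro exI[of _ W] exI[of _ "\<lambda>y. frechet_derivative F (at y) (axis i 1)"]) auto
qed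

text \<open>Near \<open>x\<close> all these partial derivatives are those of a single smooth
  extension \<open>F\<close> on an open set, where second derivatives are symmetric.\<close>

lemma pd_commute:
  fixes f :: "real^2 \<Rightarrow> 'b::euclidean_space"
  assumes "half_open U" "smooth_on U f" "x \<in> U"
  shows "pd U i (pd U j f) x = pd U j (pd U i f) x"
proof -
  obtain W F where WF: "open W" "x \<in> W" "\<forall>k. Ck_on k W F" "\<forall>y\<in>U \<inter> W. F y = f y"
    by (rule smooth_onE[OF assms(2,3)])
  have *: "pd U i (pd U j f) x = frechet_derivative (\<lambda>y. frechet_derivative F (at y) (axis j 1)) (at x) (axis i 1)"
    for i j
  proof (rule smooth_on_pd_local[OF assms(1) WF(1)])
    show "\<forall>k. Ck_on k W (\<lambda>y. frechet_derivative F (at y) (axis j 1))"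
      by (intro allI, rule Ck_on_SucE(2)[OF WF(3)[rule_format]]) simp
    show "\<forall>y\<in>U \<inter> W. frechet_derivative F (at y) (axis j 1) = pd U j f y"
      using smooth_on_pd_local[OF assms(1) WF(1,3,4)] by simp
  qed (use WF assms in auto)
  show ?thesis
    unfolding * by (rule mixed_partials[OF WF(1) WF(3)[rule_format] WF(2)]) auto
qed

lemma frechet_eq_pd:
  assumes "(f has_derivative frechet_derivative f (at x within U)) (at x within U)"
  shows "frechet_derivative f (at x within U) v = v $ 1 *\<^sub>R pd U 1 f x + v $ 2 *\<^sub>R pd U 2 f x"
proof -
  have "v = v $ 1 *\<^sub>R axis 1 1 + v $ 2 *\<^sub>R axis 2 1"
    by (simp add: vec_eq_iff forall_2 axis_def)
  then have "frechet_derivative f (at x within U) v =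
      frechet_derivative f (at x within U) (v $ 1 *\<^sub>R axis 1 1 + v $ 2 *\<^sub>R axis 2 1)" by simp
  also have "\<dots> = v $ 1 *\<^sub>R pd U 1 f x + v $ 2 *\<^sub>R pd U 2 f x"
    using has_derivative_linear[OF assms] by (simp add: linear_add linear_scale pd_def)
  finally show ?thesis .
qed

subsection \<open>Integrals of compactly supported functions\<close>

text \<open>\<open>U\<close> and \<open>S - K\<close> form a relatively open cover of
  \<open>S\<close>, and the two definitions agree on their overlap.\<close>

lemma continuous_on_extend_zero:
  fixes g :: "'a::t2_space \<Rightarrow> 'b::real_normed_vector"
  assumes "openin (top_of_set S) U" "compact K" "K \<subseteq> U" "continuous_on U g"
    and "\<And>x. x \<in> U \<Longrightarrow> x \<notin> K \<Longrightarrow> g x = 0"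
  shows "continuous_on S (\<lambda>x. if x \<in> U then g x else 0)"
proof -
  have US: "U \<subseteq> S" using assms(1) by (rule openin_imp_subset)
  have eq: "U \<union> (S - K) = S" using US assms(3) by auto
  have "closedin (top_of_set S) K"
    by (rule closed_subset) (use US assms(2,3) in \<open>auto intro: compact_imp_closed\<close>)
  then have "openin (top_of_set S) (S - K)"
    by (metis openin_diff openin_subtopology_self)
  then have "continuous_on (U \<union> (S - K)) (\<lambda>x. if x \<in> U then g x else 0)"
    using assms by (intro continuous_on_cases_local_open) (auto simp: eq)
  then show ?thesis by (simp only: eq)
qed

text \<open>\<open>U\<close> may be unbounded and \<open>g\<close> unbounded near its rim, so
  integrability is taken from the compact set \<open>K\<close> and transferred to
  \<open>U\<close>.\<close>

lemma absolutely_integrable_compact_support: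
  fixes g :: "'a::euclidean_space \<Rightarrow> 'b::euclidean_space"
  assumes "compact K" "K \<subseteq> U" "continuous_on U g" "\<And>x. x \<in> U \<Longrightarrow> x \<notin> K \<Longrightarrow> g x = 0"
  shows "g absolutely_integrable_on U"
proof -
  have "integrable lborel (\<lambda>x. indicator K x *\<^sub>R g x)"
    using assms by (intro borel_integrable_compact) (auto intro: continuous_on_subset)
  then have "set_integrable lebesgue K g"
    unfolding set_integrable_def by (rule integrable_completion[THEN iffD2, rotated])
      (use \<open>integrable lborel _\<close> in \<open>simp add: borel_measurable_integrable\<close>)
  then show ?thesis
    by (rule absolutely_integrable_spike_set) (use assms in \<open>auto intro: empty_imp_negligible\<close>)
qed

lemma integral_zero_outside:
  fixes f g :: "'a::euclidean_space \<Rightarrow> 'b::euclidean_space"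
  assumes "\<And>x. x \<in> S \<inter> T \<Longrightarrow> f x = g x" "\<And>x. x \<in> S - T \<Longrightarrow> f x = 0" "\<And>x. x \<in> T - S \<Longrightarrow> g x = 0"
  shows "integral S f = integral T g"
proof -
  have "integral S f = integral UNIV (\<lambda>x. if x \<in> S then f x else 0)"
    by (simp add: integral_restrict_UNIV)
  also have "(\<lambda>x. if x \<in> S then f x else 0) = (\<lambda>x. if x \<in> T then g x else 0)"
    using assms by fastforce
  also have "integral UNIV \<dots> = integral T g"
    by (simp add: integral_restrict_UNIV)
  finally show ?thesis .
qed

lemma vector_2_eq_axis: "(vector [s, t] :: real^2) = s *\<^sub>R axis 1 1 + t *\<^sub>R axis 2 1"
  by (simp add: vec_eq_iff forall_2 axis_def)

lemma mem_cbox_vector_2: "x \<in> cbox (vector [a, c]) (vector [b, d] :: real^2) \<longleftrightarrow>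
    a \<le> x $ 1 \<and> x $ 1 \<le> b \<and> c \<le> x $ 2 \<and> x $ 2 \<le> d"
  by (auto simp: mem_box_cart forall_2)

text \<open>The measure-preserving identification \<open>?g\<close> of \<open>real^2\<close> with
  the product type carries the integral to the setting of iterated integrals.\<close>

lemma integral_cbox_vector_2:
  fixes f :: "real^2 \<Rightarrow> real"
  assumes "continuous_on (cbox (vector [a, c]) (vector [b, d])) f"
  shows "integral (cbox (vector [a, c]) (vector [b, d])) f =
    integral {a..b} (\<lambda>s. integral {c..d} (\<lambda>t. f (vector [s, t])))"
proof -
  let ?g = "\<lambda>x::real^2. (x $ 1, x $ 2)"
  let ?h = "\<lambda>p. vector [fst p, snd p] :: real^2"
  have hg: "?h (?g x) = x" for x by (simp add: vec_eq_iff forall_2)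
  have hg': "vector [x $ 1, x $ 2] = x" for x :: "real^2" by (simp add: vec_eq_iff forall_2)
  have gh: "?g (?h p) = p" for p by simp
  have gbox: "?g ` cbox u v = cbox (u $ 1, u $ 2) (v $ 1, v $ 2)" for u v
  proof (rule antisym)
    show "?g ` cbox u v \<subseteq> cbox (u $ 1, u $ 2) (v $ 1, v $ 2)"
      by (auto simp: mem_box_cart forall_2 cbox_Pair_eq)
    show "cbox (u $ 1, u $ 2) (v $ 1, v $ 2) \<subseteq> ?g ` cbox u v"
    proof
      fix p assume "p \<in> cbox (u $ 1, u $ 2) (v $ 1, v $ 2)"
      then show "p \<in> ?g ` cbox u v"
        by (intro image_eqI[where x = "?h p"]) (auto simp: mem_box_cart forall_2 cbox_Pair_eq)
    qed
  qed
  have hbox: "?h ` cbox u v = cbox (?h u) (?h v)" for u v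
  proof -
    have "cbox u v = ?g ` cbox (?h u) (?h v)" by (simp add: gbox)
    then show ?thesis by (simp add: image_image hg')
  qed
  have conth: "continuous_on A ?h" for A
    unfolding vector_2_eq_axis by (intro continuous_intros)
  have contfh: "continuous_on (cbox (a, c) (b, d)) (\<lambda>p. f (?h p))"
    by (rule continuous_on_compose2[OF assms conth])
      (use hbox[of "(a, c)" "(b, d)"] in simp)
  have cont_g: "measure lborel (?g ` cbox u v) = 1 * measure lborel (cbox u v)" for u v
  proof (cases "u $ 1 \<le> v $ 1 \<and> u $ 2 \<le> v $ 2")
    case True
    then have "cbox u v \<noteq> {}" by (auto simp: interval_ne_empty_cart forall_2)
    then show ?thesis
      using True unfolding gbox content_Pair by (simp add: content_cbox_cart UNIV_2)
  next
    case False
    then have "cbox u v = {}" by (auto simp: interval_eq_empty_cart not_le intro: exI)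
    then show ?thesis by simp
  qed
  have "((\<lambda>p. f (?h p)) has_integral integral (cbox (a, c) (b, d)) (\<lambda>p. f (?h p))) (cbox (a, c) (b, d))"
    using contfh by (intro integrable_integral integrable_continuous)
  then have "((\<lambda>x. f (?h (?g x))) has_integral (1 / 1) *\<^sub>R integral (cbox (a, c) (b, d)) (\<lambda>p. f (?h p)))
      (?h ` cbox (a, c) (b, d))"
    by (intro has_integral_twiddle[where f = "\<lambda>p. f (?h p)" and g = ?g and h = ?h])
      (use hg gh gbox hbox cont_g in \<open>auto intro!: continuous_intros simp: continuous_Pair\<close>)
  then have "(f has_integral integral (cbox (a, c) (b, d)) (\<lambda>p. f (?h p))) (cbox (vector [a, c]) (vector [b, d]))"
    by (simp add: hg' hbox)
  then show ?thesis
    using integral_prod_continuous[OF contfh] by (simp add: integral_unique)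
qed

subsection \<open>The divergence theorem on the half plane\<close>

text \<open>After extension by zero the integral is taken over a box. By the fundamental theorem of
  calculus the \<open>F\<close> term reduces to values on the left and right edges, which vanish,
  and the \<open>G\<close> term to its value on the bottom edge. That edge is the lower limit of
  integration, hence the minus sign.\<close>

theorem half_plane_divergence:
  fixes F G :: "real^2 \<Rightarrow> real"
  assumes U: "half_open U" and K: "compact K" "K \<subseteq> U"
    and F0: "\<And>x. x \<in> U \<Longrightarrow> x \<notin> K \<Longrightarrow> F x = 0" and G0: "\<And>x. x \<in> U \<Longrightarrow> x \<notin> K \<Longrightarrow> G x = 0"
    and dF: "\<And>x. x \<in> U \<Longrightarrow> (F has_derivative F' x) (at x within U)"
    and dG: "\<And>x. x \<in> U \<Longrightarrow> (G has_derivative G' x) (at x within U)"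
    and cF: "continuous_on U (\<lambda>x. F' x (axis 1 1))" and cG: "continuous_on U (\<lambda>x. G' x (axis 2 1))"
  shows "integral U (\<lambda>x. F' x (axis 1 1) + G' x (axis 2 1)) =
    - integral {s. vector [s, 0] \<in> U} (\<lambda>s. G (vector [s, 0]))"
proof -
  have UH: "U \<subseteq> half_plane" using U by (rule openin_imp_subset)
  define ext where "ext = (\<lambda>(g :: real^2 \<Rightarrow> real) x. if x \<in> U then g x else 0)"
  have clK: "openin (top_of_set half_plane) (half_plane - K)"
    using compact_imp_closed[OF K(1)] by (simp add: Diff_eq openin_open_Int open_Compl)
  \<comment> \<open>\<open>U\<close> and \<open>half_plane - K\<close> are relatively open and cover
    the half plane: on the first the given derivative is kept, on the second the extension is
    zero.\<close>
  have ext_der: "(ext g has_derivative (\<lambda>v. ext (\<lambda>x. g' x v) x)) (at x within half_plane)"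
    if g0: "\<And>x. x \<in> U \<Longrightarrow> x \<notin> K \<Longrightarrow> g x = 0" and dg: "\<And>x. x \<in> U \<Longrightarrow> (g has_derivative g' x) (at x within U)"
      and x: "x \<in> half_plane" for g g' x
  proof (cases "x \<in> U")
    case True
    have "(ext g has_derivative g' x) (at x within U)"
      by (rule has_derivative_transform[OF True _ dg[OF True]]) (simp add: ext_def)
    then show ?thesis
      using True at_within_openin[OF U True] by (simp add: ext_def)
  next
    case False
    then have xK: "x \<in> half_plane - K" using x K by auto
    have "((\<lambda>x. 0::real) has_derivative (\<lambda>v. 0)) (at x within half_plane - K)" by simp
    then have "(ext g has_derivative (\<lambda>v. 0)) (at x within half_plane - K)"
      by (rule has_derivative_transform[OF xK, rotated]) (use g0 in \<open>auto simp: ext_def\<close>)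
    then show ?thesis
      using False at_within_openin[OF clK xK] by (simp add: ext_def)
  qed
  \<comment> \<open>Off \<open>K\<close> the function is zero on a relatively open set, so its
    derivative vanishes too. This makes the extended derivatives continuous and allows the integral
    over \<open>U\<close> to be replaced by one over the box.\<close>
  have der0: "g' x v = 0"
    if g0: "\<And>x. x \<in> U \<Longrightarrow> x \<notin> K \<Longrightarrow> g x = 0" and dg: "\<And>x. x \<in> U \<Longrightarrow> (g has_derivative g' x) (at x within U)"
      and x: "x \<in> U" "x \<notin> K" for g :: "real^2 \<Rightarrow> real" and g' x v
  proof -
    have xK: "x \<in> half_plane - K" using x UH by auto
    have "((\<lambda>x. 0::real) has_derivative (\<lambda>v. 0)) (at x within half_plane - K)" by simp
    then have "(ext g has_derivative (\<lambda>v. 0)) (at x within half_plane - K)"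
      by (rule has_derivative_transform[OF xK, rotated]) (use g0 in \<open>auto simp: ext_def\<close>)
    then have "(ext g has_derivative (\<lambda>v. 0)) (at x within U)"
      using at_within_openin[OF clK xK] at_within_openin[OF U x(1)] by simp
    then have "(g has_derivative (\<lambda>v. 0)) (at x within U)"
      by (rule has_derivative_transform[OF x(1), rotated]) (simp add: ext_def)
    from frechet_within_eq[OF U x(1) this] frechet_within_eq[OF U x(1) dg[OF x(1)]]
    show ?thesis by metis
  qed
  let ?D1 = "ext (\<lambda>x. F' x (axis 1 1))" and ?D2 = "ext (\<lambda>x. G' x (axis 2 1))"
  have c1: "continuous_on half_plane ?D1"
    unfolding ext_def by (rule continuous_on_extend_zero[OF U K cF der0[OF F0 dF]])
  have c2: "continuous_on half_plane ?D2"
    unfolding ext_def by (rule continuous_on_extend_zero[OF U K cG der0[OF G0 dG]])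
  obtain M where M: "M > 0" "\<And>x. x \<in> K \<Longrightarrow> norm x < M"
    using compact_imp_bounded[OF K(1)] by (auto simp: bounded_pos_less)
  have M1: "\<bar>x $ i\<bar> < M" if "x \<in> K" for x i
    using M(2)[OF that] component_le_norm_cart[of x i] by linarith
  have ext0: "ext g x = 0" if "\<And>x. x \<in> U \<Longrightarrow> x \<notin> K \<Longrightarrow> g x = 0" "x \<notin> K" for g x
    using that by (auto simp: ext_def)
  \<comment> \<open>The strict bound \<open>M\<close> keeps \<open>K\<close> away from the left,
    right and top edges; the bottom edge lies on the boundary line.\<close>
  let ?B = "cbox (vector [-M, 0]) (vector [M, M]) :: (real^2) set"
  have BH: "?B \<subseteq> half_plane" by (auto simp: half_plane_def mem_cbox_vector_2)
  have KB: "K \<subseteq> ?B"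
  proof
    fix x assume "x \<in> K"
    then have "x $ 2 \<ge> 0" using K(2) UH by (auto simp: half_plane_def)
    then show "x \<in> ?B" using M1[OF \<open>x \<in> K\<close>, of 1] M1[OF \<open>x \<in> K\<close>, of 2] by (auto simp: mem_cbox_vector_2)
  qed
  have "integral U (\<lambda>x. F' x (axis 1 1) + G' x (axis 2 1)) = integral ?B (\<lambda>x. ?D1 x + ?D2 x)"
  proof (rule integral_zero_outside)
    fix x assume "x \<in> U - ?B"
    then have "x \<in> U" "x \<notin> K" using KB by auto
    then show "F' x (axis 1 1) + G' x (axis 2 1) = 0"
      using der0[OF F0 dF] der0[OF G0 dG] by simp
  qed (auto simp: ext_def)
  also have "\<dots> = integral ?B ?D1 + integral ?B ?D2"
    using c1 c2 BH by (intro integral_add integrable_continuous) (auto intro: continuous_on_subset)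
  also have "integral ?B ?D1 = integral {-M..M} (\<lambda>s. integral {0..M} (\<lambda>t. ?D1 (vector [s, t])))"
    by (rule integral_cbox_vector_2) (use c1 BH in \<open>auto intro: continuous_on_subset\<close>)
  \<comment> \<open>The order is exchanged so that the inner integral runs along the direction of
    differentiation.\<close>
  also have "\<dots> = integral {0..M} (\<lambda>t. integral {-M..M} (\<lambda>s. ?D1 (vector [s, t])))"
  proof -
    have "continuous_on (cbox (-M, 0) (M, M)) (\<lambda>p. ?D1 (vector [fst p, snd p]))"
      by (rule continuous_on_compose2[OF c1])
        (auto intro!: continuous_intros simp: vector_2_eq_axis half_plane_def axis_def cbox_Pair_eq)
    then have "continuous_on (cbox (-M, 0) (M, M)) (\<lambda>(s, t). ?D1 (vector [s, t]))"
      by (simp add: case_prod_unfold)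
    from integral_swap_continuous[OF this] show ?thesis by simp
  qed
  also have "\<dots> = integral {0..M} (\<lambda>t. 0)"
  proof (rule integral_cong)
    fix t assume t: "t \<in> {0..M}"
    have "((\<lambda>s. ?D1 (vector [s, t])) has_integral (ext F (vector [M, t]) - ext F (vector [-M, t]))) {-M..M}"
    proof (rule fundamental_theorem_of_calculus)
      fix s assume "s \<in> {-M..M}"
      have inH: "vector [s, t] \<in> half_plane" for s using t by (simp add: half_plane_def)
      have "((\<lambda>s. vector [s, t] :: real^2) has_derivative (\<lambda>k. k *\<^sub>R axis 1 1)) (at s within {-M..M})"
        unfolding vector_2_eq_axis by (auto intro!: derivative_eq_intros)
      then have "((\<lambda>s. ext F (vector [s, t])) has_derivative (\<lambda>k. ext (\<lambda>x. F' x (k *\<^sub>R axis 1 1)) (vector [s, t])))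
          (at s within {-M..M})"
        by (rule has_derivative_in_compose2[OF ext_der[OF F0 dF], rotated -1]) (use inH \<open>s \<in> _\<close> in auto)
      moreover have "ext (\<lambda>x. F' x (k *\<^sub>R axis 1 1)) y = k *\<^sub>R ?D1 y" for k y
        using linear_scale[OF has_derivative_linear[OF dF]] by (simp add: ext_def)
      ultimately show "((\<lambda>s. ext F (vector [s, t])) has_vector_derivative ?D1 (vector [s, t])) (at s within {-M..M})"
        by (simp add: has_vector_derivative_def)
    qed (use M in simp)
    moreover have "ext F (vector [M, t]) = 0" "ext F (vector [-M, t]) = 0"
      using M1[of "vector [M, t]" 1] M1[of "vector [-M, t]" 1] by (auto intro!: ext0[OF F0])
    ultimately show "integral {-M..M} (\<lambda>s. ?D1 (vector [s, t])) = 0"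
      by (simp add: integral_unique)
  qed
  also have "integral ?B ?D2 = integral {-M..M} (\<lambda>s. integral {0..M} (\<lambda>t. ?D2 (vector [s, t])))"
    by (rule integral_cbox_vector_2) (use c2 BH in \<open>auto intro: continuous_on_subset\<close>)
  also have "\<dots> = integral {-M..M} (\<lambda>s. - ext G (vector [s, 0]))"
  proof (rule integral_cong)
    fix s assume s: "s \<in> {-M..M}"
    have "((\<lambda>t. ?D2 (vector [s, t])) has_integral (ext G (vector [s, M]) - ext G (vector [s, 0]))) {0..M}"
    proof (rule fundamental_theorem_of_calculus)
      fix t assume t: "t \<in> {0..M}"
      have inH: "vector [s, t] \<in> half_plane" if "t \<in> {0..M}" for t using that by (simp add: half_plane_def)
      have "((\<lambda>t. vector [s, t] :: real^2) has_derivative (\<lambda>k. k *\<^sub>R axis 2 1)) (at t within {0..M})"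
        unfolding vector_2_eq_axis by (auto intro!: derivative_eq_intros)
      then have "((\<lambda>t. ext G (vector [s, t])) has_derivative (\<lambda>k. ext (\<lambda>x. G' x (k *\<^sub>R axis 2 1)) (vector [s, t])))
          (at t within {0..M})"
        by (rule has_derivative_in_compose2[OF ext_der[OF G0 dG], rotated -1]) (use inH t in auto)
      moreover have "ext (\<lambda>x. G' x (k *\<^sub>R axis 2 1)) y = k *\<^sub>R ?D2 y" for k y
        using linear_scale[OF has_derivative_linear[OF dG]] by (simp add: ext_def)
      ultimately show "((\<lambda>t. ext G (vector [s, t])) has_vector_derivative ?D2 (vector [s, t])) (at t within {0..M})"
        by (simp add: has_vector_derivative_def)
    qed (use M in simp)
    moreover have "ext G (vector [s, M]) = 0"
      using M1[of "vector [s, M]" 2] by (auto intro!: ext0[OF G0])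
    ultimately show "integral {0..M} (\<lambda>t. ?D2 (vector [s, t])) = - ext G (vector [s, 0])"
      by (simp add: integral_unique)
  qed
  also have "\<dots> = - integral {-M..M} (\<lambda>s. ext G (vector [s, 0]))"
    by simp
  also have "integral {-M..M} (\<lambda>s. ext G (vector [s, 0])) =
      integral {s. vector [s, 0] \<in> U} (\<lambda>s. G (vector [s, 0]))"
  proof (rule integral_zero_outside)
    fix s assume s: "s \<in> {s. vector [s, 0] \<in> U} - {-M..M}"
    then have "(vector [s, 0] :: real^2) \<notin> K" using M1[of "vector [s, 0]" 1] by auto
    then show "G (vector [s, 0]) = 0" using s G0 by auto
  qed (auto simp: ext_def)
  finally show ?thesis by simp
qed

subsection \<open>Charts and partitions of unity\<close>

locale compact_surface =
  fixes X :: "'a topology" and A :: "'a chart set"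
  assumes surf: "compact_oriented_surface X A"
begin

lemma compact_X: "compact_space X" and Hausdorff_X: "Hausdorff_space X"
  and ex_chart: "p \<in> topspace X \<Longrightarrow> \<exists>c\<in>A. p \<in> fst c"
  using surf unfolding compact_oriented_surface_def by blast+

lemma chart_coords: "c \<in> A \<Longrightarrow> oriented_coords X A c"
  and half_open_chart: "c \<in> A \<Longrightarrow> half_open (chart_image c)"
  using surf unfolding compact_oriented_surface_def by blast+

lemma openin_dom: "c \<in> A \<Longrightarrow> openin X (fst c)"
  and chart_homeo: "c \<in> A \<Longrightarrow> homeomorphic_map (subtopology X (fst c)) (top_of_set (chart_image c)) (snd c)"
  and transition_smooth: "c \<in> A \<Longrightarrow> c' \<in> A \<Longrightarrow> smooth_on (snd c' ` (fst c \<inter> fst c')) (snd c \<circ> chart_inv c')"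
  and transition_det: "c \<in> A \<Longrightarrow> c' \<in> A \<Longrightarrow> p \<in> fst c \<Longrightarrow> p \<in> fst c' \<Longrightarrow>
    det (matrix (chart_differential c' (snd c) p)) > 0"
  using chart_coords unfolding oriented_coords_def by blast+

lemma dom_subset: "c \<in> A \<Longrightarrow> fst c \<subseteq> topspace X"
  using openin_dom openin_subset by blast

lemma dom_topspace [simp]: "c \<in> A \<Longrightarrow> topspace (subtopology X (fst c)) = fst c"
  by (simp add: Int_absorb1 dom_subset)

lemma chart_inj: "c \<in> A \<Longrightarrow> inj_on (snd c) (fst c)"
  using homeomorphic_imp_injective_map[OF chart_homeo] dom_topspace by metis

lemma chart_inv_chart: "c \<in> A \<Longrightarrow> p \<in> fst c \<Longrightarrow> chart_inv c (snd c p) = p"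
  by (simp add: chart_inj)

lemma openin_chart_image:
  assumes "c \<in> A" "openin X S" "S \<subseteq> fst c"
  shows "half_open (snd c ` S)" "openin (top_of_set (chart_image c)) (snd c ` S)"
proof -
  have "openin (subtopology X (fst c)) S"
    using assms(2,3) by (auto simp: openin_subtopology)
  then show "openin (top_of_set (chart_image c)) (snd c ` S)"
    using homeomorphic_imp_open_map[OF chart_homeo[OF assms(1)]] unfolding open_map_def by blast
  then show "half_open (snd c ` S)"
    using half_open_chart[OF assms(1)] by (rule openin_trans)
qed

lemma openin_chart_preimage:
  assumes "c \<in> A" "open T"
  shows "openin X {p \<in> fst c. snd c p \<in> T}"
proof -
  have "openin (subtopology X (fst c)) {p \<in> topspace (subtopology X (fst c)). snd c p \<in> chart_image c \<inter> T}"
    using homeomorphic_imp_continuous_map[OF chart_homeo[OF assms(1)]] openin_open_Int[OF assms(2)]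
    by (rule openin_continuous_map_preimage)
  then have "openin (subtopology X (fst c)) {p \<in> fst c. snd c p \<in> T}"
    unfolding dom_topspace[OF assms(1)] by (rule back_subst) auto
  then show ?thesis
    using openin_dom[OF assms(1)] by (rule openin_trans_full)
qed

text \<open>In the compact Hausdorff space \<open>X\<close> closed and compact sets coincide, and
  compactness is carried over by the chart. Closed supports inside a chart thus become compact sets
  in the plane.\<close>

lemma compact_chart_image:
  assumes "c \<in> A" "S \<subseteq> fst c"
  shows "compact (snd c ` S) \<longleftrightarrow> closedin X S"
proof -
  have "compactin (subtopology X (fst c)) S \<longleftrightarrow> compactin (top_of_set (chart_image c)) (snd c ` S)"
    using homeomorphic_map_compactness[OF chart_homeo[OF assms(1)], of S] assms dom_topspace by metis
  moreover have "compactin (subtopology X (fst c)) S \<longleftrightarrow> compactin X S"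
    using assms(2) by (simp add: compactin_subtopology)
  moreover have "compactin (top_of_set (chart_image c)) (snd c ` S) \<longleftrightarrow> compact (snd c ` S)"
    using assms(2) by (auto simp: compactin_subtopology)
  moreover have "compactin X S \<longleftrightarrow> closedin X S"
    using compactin_imp_closedin[OF Hausdorff_X] closedin_compact_space[OF compact_X] by blast
  ultimately show ?thesis by blast
qed

text \<open>A bump in chart coordinates, extended by zero. The extension is smooth because it is
  supported in \<open>K\<close>, the preimage of a closed half disc: \<open>K\<close> is compact,
  hence closed in \<open>X\<close> and not just relatively closed in \<open>fst c\<close>.\<close>

lemma ex_bump_function:
  assumes "p \<in> topspace X"
  shows "\<exists>c b. c \<in> A \<and> smooth_map A b \<and> (\<forall>q\<in>topspace X. 0 \<le> b q) \<and> b p > (0::real) \<and>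
    openin X {q \<in> topspace X. b q > 0} \<and> X closure_of {q \<in> topspace X. b q \<noteq> 0} \<subseteq> fst c"
proof -
  obtain c where c: "c \<in> A" "p \<in> fst c" using ex_chart[OF assms] by blast
  obtain r' where r': "r' > 0" "ball (snd c p) r' \<inter> half_plane \<subseteq> chart_image c"
    using half_open_ball[OF half_open_chart[OF c(1)]] c(2) by blast
  \<comment> \<open>The smaller radius puts the closed disc, as far as it meets the half plane,
    inside the chart image.\<close>
  define r where "r = r' / 2"
  define K where "K = chart_inv c ` (cball (snd c p) r \<inter> half_plane)"
  define b where "b = (\<lambda>q. if q \<in> fst c then bump (snd c p) r (snd c q) else 0)"
  have r: "r > 0" "cball (snd c p) r \<inter> half_plane \<subseteq> chart_image c"
    using r' by (auto simp: r_def)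
  have "closed half_plane"
    unfolding half_plane_def by (intro closed_Collect_le continuous_intros)
  then have "compact (cball (snd c p) r \<inter> half_plane)"
    by (simp add: compact_Int_closed)
  moreover have "snd c ` K = cball (snd c p) r \<inter> half_plane"
    using r(2) by (force simp: K_def image_image f_inv_into_f)
  moreover have "K \<subseteq> fst c"
    using r(2) by (auto simp: K_def intro: inv_into_into)
  ultimately have K: "closedin X K" "K \<subseteq> fst c"
    using compact_chart_image[OF c(1), of K] by metis+
  have pos: "b q > 0 \<longleftrightarrow> q \<in> fst c \<and> snd c q \<in> ball (snd c p) r" for q
    using bump_pos_iff[OF r(1)] by (auto simp: b_def)
  have nonneg: "0 \<le> b q" for q by (simp add: b_def bump_nonneg)
  have chart_half: "snd c q \<in> half_plane" if "q \<in> fst c" for q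
    using openin_imp_subset[OF half_open_chart[OF c(1)]] that by auto
  have supp: "q \<in> K" if "b q \<noteq> 0" for q
  proof -
    have "q \<in> fst c" "snd c q \<in> ball (snd c p) r"
      using pos[of q] nonneg[of q] that by linarith+
    then show ?thesis
      using chart_half chart_inv_chart[OF c(1), of q]
      unfolding K_def by (intro image_eqI[of q _ "snd c q"]) auto
  qed
  have supp0: "b q = 0" if "q \<notin> K" for q
    using supp that by blast
  have "smooth_map A b"
    unfolding smooth_map_def
  proof (intro ballI smooth_on_locally)
    fix c' x assume c': "c' \<in> A" and x: "x \<in> chart_image c'"
    have q: "chart_inv c' x \<in> fst c'" "x = snd c' (chart_inv c' x)"
      using inv_into_into[OF x] f_inv_into_f[OF x] by simp_all
    show "\<exists>T. openin (top_of_set (chart_image c')) T \<and> x \<in> T \<and> smooth_on T (b \<circ> chart_inv c')"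
    \<comment> \<open>On the overlap the function is the bump after the transition map; at other
      points it vanishes on the neighbourhood \<open>fst c' - K\<close>.\<close>
    proof (cases "chart_inv c' x \<in> fst c")
      case True
      let ?T = "snd c' ` (fst c \<inter> fst c')"
      have "openin (top_of_set (chart_image c')) ?T"
        using openin_chart_image(2)[OF c'] openin_dom c(1) c' by (simp add: openin_Int)
      moreover have "x \<in> ?T"
        by (rule image_eqI[where f = "snd c'" and x = "chart_inv c' x", OF q(2)]) (use True q(1) in simp)
      moreover have "smooth_on ?T (\<lambda>y. bump (snd c p) r ((snd c \<circ> chart_inv c') y))"
        by (rule smooth_on_compose[OF transition_smooth[OF c(1) c'] open_UNIV subset_UNIV Ck_on_bump])
      then have "smooth_on ?T (b \<circ> chart_inv c')"
        by (rule smooth_on_cong) (auto simp: b_def chart_inv_chart[OF c'])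
      ultimately show ?thesis by blast
    next
      case False
      let ?T = "snd c' ` (fst c' - K)"
      have "openin (top_of_set (chart_image c')) ?T"
        by (rule openin_chart_image(2)[OF c']) (use openin_dom[OF c'] K(1) in \<open>auto intro: openin_diff\<close>)
      moreover have "x \<in> ?T"
        by (rule image_eqI[where f = "snd c'" and x = "chart_inv c' x", OF q(2)]) (use False q(1) K(2) in auto)
      moreover have "smooth_on ?T (b \<circ> chart_inv c')"
        by (rule smooth_on_cong[OF smooth_on_const[of _ 0]]) (use supp0 in \<open>auto simp: chart_inv_chart[OF c']\<close>)
      ultimately show ?thesis by blast
    qed
  qed
  moreover have "{q \<in> topspace X. b q > 0} = {q \<in> fst c. snd c q \<in> ball (snd c p) r}"
    using pos dom_subset[OF c(1)] by blast
  then have "openin X {q \<in> topspace X. b q > 0}"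
    using openin_chart_preimage[OF c(1) open_ball] by simp
  moreover have "X closure_of {q \<in> topspace X. b q \<noteq> 0} \<subseteq> K"
    using supp by (intro closure_of_minimal K(1)) auto
  moreover have "b p > 0" using pos c(2) r(1) by simp
  ultimately show ?thesis
    using c(1) K(2) nonneg by (intro exI[of _ c] exI[of _ b]) auto
qed

text \<open>Finitely many of the sets where some bump is positive cover \<open>X\<close>; dividing
  by the sum of these bumps normalizes them.\<close>

lemma ex_partition_of_unity: "\<exists>C \<rho>. partition_of_unity X A C \<rho>"
proof -
  let ?Q = "\<lambda>p z. fst z \<in> A \<and> smooth_map A (snd z) \<and> (\<forall>q\<in>topspace X. 0 \<le> snd z q) \<and> snd z p > (0::real) \<and>
    openin X {q \<in> topspace X. snd z q > 0} \<and> X closure_of {q \<in> topspace X. snd z q \<noteq> 0} \<subseteq> fst (fst z)"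
  have "\<forall>p\<in>topspace X. \<exists>z. ?Q p z"
    using ex_bump_function unfolding split_paired_Ex fst_conv snd_conv by (rule ballI)
  from bchoice[OF this] obtain z where z: "\<forall>p\<in>topspace X. ?Q p (z p)"
    by (elim exE)
  define cc bb where "cc p = fst (z p)" and "bb p = snd (z p)" for p
  have cb:
    "\<And>p. p \<in> topspace X \<Longrightarrow> cc p \<in> A" "\<And>p. p \<in> topspace X \<Longrightarrow> smooth_map A (bb p)"
    "\<And>p q. p \<in> topspace X \<Longrightarrow> q \<in> topspace X \<Longrightarrow> 0 \<le> bb p q"
    "\<And>p. p \<in> topspace X \<Longrightarrow> bb p p > 0"
    "\<And>p. p \<in> topspace X \<Longrightarrow> openin X {q \<in> topspace X. bb p q > 0}"
    "\<And>p. p \<in> topspace X \<Longrightarrow> X closure_of {q \<in> topspace X. bb p q \<noteq> 0} \<subseteq> fst (cc p)"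
    unfolding cc_def bb_def using z by simp_all
  let ?pos = "\<lambda>p. {q \<in> topspace X. bb p q > 0}"
  have "\<exists>\<F>. finite \<F> \<and> \<F> \<subseteq> ?pos ` topspace X \<and> topspace X \<subseteq> \<Union>\<F>"
    using compact_X cb(4,5) unfolding compact_space_alt by (elim allE[of _ "?pos ` topspace X"]) auto
  then obtain \<F> where "finite \<F>" "\<F> \<subseteq> ?pos ` topspace X" and cover: "topspace X \<subseteq> \<Union>\<F>"
    by (elim exE conjE)
  moreover from finite_subset_image[OF this(1,2)] obtain P where
    P: "P \<subseteq> topspace X" "finite P" "\<F> = ?pos ` P" by (elim exE conjE)
  ultimately have P: "finite P" "P \<subseteq> topspace X" "topspace X \<subseteq> \<Union>(?pos ` P)" by simp_all
  define s where "s q = (\<Sum>p\<in>P. bb p q)" for q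
  \<comment> \<open>A partition is indexed by charts, the bumps by points; bumps living in the same
    chart are added.\<close>
  define \<rho> where "\<rho> c q = (\<Sum>p | p \<in> P \<and> cc p = c. bb p q) / s q" for c q
  have s_pos: "s q > 0" if "q \<in> topspace X" for q
  proof -
    from subsetD[OF P(3) that] obtain p where "p \<in> P" "bb p q > 0" by (elim UN_E) simp
    then show ?thesis
      unfolding s_def using P(1,2) cb(3) that by (intro sum_pos2[of P p]) auto
  qed
  have "partition_of_unity X A (cc ` P) \<rho>"
    unfolding partition_of_unity_def
  proof (intro conjI ballI)
    fix c
    let ?Pc = "{p \<in> P. cc p = c}"
    show "smooth_map A (\<rho> c)"
      unfolding smooth_map_def
    proof
      fix c' assume c': "c' \<in> A"
      have sm: "smooth_on (chart_image c') (\<lambda>x. bb p (chart_inv c' x))" if "p \<in> P" for p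
        using cb(2) P(2) that c' unfolding smooth_map_def comp_def by blast
      have "smooth_on (chart_image c') (\<lambda>x. (\<Sum>p\<in>?Pc. bb p (chart_inv c' x)) / (\<Sum>p\<in>P. bb p (chart_inv c' x)))"
      proof (intro smooth_on_divide smooth_on_sum sm)
        fix x assume "x \<in> chart_image c'"
        then have "chart_inv c' x \<in> topspace X"
          by (intro subsetD[OF dom_subset[OF c']] inv_into_into)
        from s_pos[OF this] show "0 < (\<Sum>p\<in>P. bb p (chart_inv c' x))"
          by (simp add: s_def)
      qed auto
      then show "smooth_on (chart_image c') (\<rho> c \<circ> chart_inv c')"
        by (simp add: \<rho>_def s_def comp_def)
    qed
    show "0 \<le> \<rho> c q" if "q \<in> topspace X" for q
      unfolding \<rho>_def using s_pos[OF that] cb(3) P(2) that by (intro divide_nonneg_pos sum_nonneg) auto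
    \<comment> \<open>A finite union of closed supports is closed, so it bounds the closure of the
      set where \<open>\<rho> c\<close> is nonzero.\<close>
    let ?T = "\<Union>p\<in>?Pc. X closure_of {q \<in> topspace X. bb p q \<noteq> 0}"
    have "{q \<in> topspace X. \<rho> c q \<noteq> 0} \<subseteq> ?T"
    proof
      fix q assume q: "q \<in> {q \<in> topspace X. \<rho> c q \<noteq> 0}"
      then have "(\<Sum>p\<in>?Pc. bb p q) \<noteq> 0" by (auto simp: \<rho>_def)
      then obtain p where "p \<in> ?Pc" "bb p q \<noteq> 0" by (meson sum.neutral)
      moreover have "{q \<in> topspace X. bb p q \<noteq> 0} \<subseteq> X closure_of {q \<in> topspace X. bb p q \<noteq> 0}"
        by (rule closure_of_subset) auto
      ultimately show "q \<in> ?T" using q by auto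
    qed
    moreover have "closedin X ?T" using P(1) by (intro closedin_Union) auto
    ultimately have "X closure_of {q \<in> topspace X. \<rho> c q \<noteq> 0} \<subseteq> ?T"
      by (rule closure_of_minimal)
    also have "?T \<subseteq> fst c" using cb(6) P(2) by auto
    finally show "X closure_of {q \<in> topspace X. \<rho> c q \<noteq> 0} \<subseteq> fst c" .
  next
    fix q assume q: "q \<in> topspace X"
    have "(\<Sum>c\<in>cc ` P. \<rho> c q) = (\<Sum>c\<in>cc ` P. \<Sum>p | p \<in> P \<and> cc p = c. bb p q) / s q"
      by (simp add: \<rho>_def sum_divide_distrib)
    also have "(\<Sum>c\<in>cc ` P. \<Sum>p | p \<in> P \<and> cc p = c. bb p q) = s q"
      unfolding s_def by (rule sum.image_gen[OF P(1), symmetric])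
    finally show "(\<Sum>c\<in>cc ` P. \<rho> c q) = 1" using s_pos[OF q] by simp
  qed (use P(1,2) cb(1) in auto)
  then show ?thesis by blast
qed

end

subsection \<open>Change of charts\<close>

context compact_surface
begin

lemma coord_deriv_eq_pd:
  "coord_deriv c i f p = pd (chart_image c) i (f \<circ> chart_inv c) (snd c p)"
  by (simp add: coord_deriv_def chart_differential_def pd_def)

lemma half_open_overlap:
  assumes "c \<in> A" "c' \<in> A"
  shows "half_open (snd c' ` (fst c \<inter> fst c'))"
    and "openin (top_of_set (chart_image c')) (snd c' ` (fst c \<inter> fst c'))"
  using openin_chart_image[OF assms(2), of "fst c \<inter> fst c'"] openin_dom assms by (auto simp: openin_Int)

lemma transition_has_derivative:
  assumes "c \<in> A" "c' \<in> A" "p \<in> fst c" "p \<in> fst c'"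
  shows "((snd c \<circ> chart_inv c') has_derivative chart_differential c' (snd c) p)
    (at (snd c' p) within snd c' ` (fst c \<inter> fst c'))"
proof -
  let ?W = "snd c' ` (fst c \<inter> fst c')"
  have "snd c' p \<in> ?W" using assms by auto
  from smooth_on_has_derivative[OF transition_smooth[OF assms(1,2)] this]
    at_within_openin[OF half_open_overlap(2)[OF assms(1,2)] this]
  show ?thesis by (simp add: chart_differential_def)
qed

text \<open>The chain rule holds within the overlap. This is relatively open in the chart image, so
  differentiating within either set gives the same result.\<close>

lemma chart_differential_chain:
  assumes c: "c \<in> A" "c' \<in> A" and p: "p \<in> fst c" "p \<in> fst c'"
    and f: "smooth_on (chart_image c) (f \<circ> chart_inv c)"
  shows "chart_differential c' f p v = chart_differential c f p (chart_differential c' (snd c) p v)"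
proof -
  let ?W = "snd c' ` (fst c \<inter> fst c')" and ?\<tau> = "snd c \<circ> chart_inv c'"
  let ?D = "chart_differential c f p" and ?J = "chart_differential c' (snd c) p"
  have pW: "snd c' p \<in> ?W" using p by auto
  have \<tau>p: "?\<tau> (snd c' p) = snd c p" using chart_inv_chart[OF c(2) p(2)] by simp
  have \<tau>W: "?\<tau> ` ?W \<subseteq> chart_image c" using chart_inv_chart[OF c(2)] by auto
  have "((f \<circ> chart_inv c) has_derivative ?D) (at (snd c p) within chart_image c)"
    using smooth_on_has_derivative[OF f, of "snd c p"] p(1) by (simp add: chart_differential_def)
  then have "((f \<circ> chart_inv c) has_derivative ?D) (at (?\<tau> (snd c' p)) within ?\<tau> ` ?W)"
    unfolding \<tau>p using \<tau>W by (rule has_derivative_subset)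
  from has_derivative_in_compose[OF transition_has_derivative[OF c p] this]
  have "((\<lambda>x. (f \<circ> chart_inv c) (?\<tau> x)) has_derivative (\<lambda>v. ?D (?J v))) (at (snd c' p) within ?W)" .
  then have "((f \<circ> chart_inv c') has_derivative (\<lambda>v. ?D (?J v))) (at (snd c' p) within ?W)"
    by (rule has_derivative_transform[OF pW, rotated])
      (auto simp: chart_inv_chart[OF c(2)] chart_inv_chart[OF c(1)])
  then have "((f \<circ> chart_inv c') has_derivative (\<lambda>v. ?D (?J v))) (at (snd c' p) within chart_image c')"
    using at_within_openin[OF half_open_overlap(2)[OF c] pW] by simp
  from frechet_within_eq[OF half_open_chart[OF c(2)] _ this] p(2)
  show ?thesis by (simp add: chart_differential_def)
qed

text \<open>The partial derivative of coordinate \<open>j\<close> of \<open>c\<close> with respect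
  to coordinate \<open>i\<close> of \<open>c'\<close>; the index order is transposed against
  \<open>matrix\<close>.\<close>

abbreviation jac :: "'a chart \<Rightarrow> 'a chart \<Rightarrow> 'a \<Rightarrow> 2 \<Rightarrow> 2 \<Rightarrow> real"
  where "jac c c' p i j \<equiv> chart_differential c' (snd c) p (axis i 1) $ j"

lemma chart_differential_eq_coord_deriv:
  assumes "c \<in> A" "p \<in> fst c" "smooth_on (chart_image c) (f \<circ> chart_inv c)"
  shows "chart_differential c f p v = v $ 1 *\<^sub>R coord_deriv c 1 f p + v $ 2 *\<^sub>R coord_deriv c 2 f p"
  unfolding chart_differential_def coord_deriv_eq_pd
  by (rule frechet_eq_pd[OF smooth_on_has_derivative[OF assms(3)]]) (use assms(2) in auto)

lemma coord_deriv_chain: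
  assumes "c \<in> A" "c' \<in> A" "p \<in> fst c" "p \<in> fst c'" "smooth_map A f"
  shows "coord_deriv c' i f p = jac c c' p i 1 *\<^sub>R coord_deriv c 1 f p + jac c c' p i 2 *\<^sub>R coord_deriv c 2 f p"
proof -
  have "smooth_on (chart_image c) (f \<circ> chart_inv c)"
    using assms(1,5) by (auto simp: smooth_map_def)
  then show ?thesis
    unfolding coord_deriv_def[of c'] using assms chart_differential_chain[of c c' p f]
      chart_differential_eq_coord_deriv[of c p f] by simp
qed

lemma jac_det:
  "det (matrix (chart_differential c' (snd c) p)) =
    jac c c' p 1 1 * jac c c' p 2 2 - jac c c' p 2 1 * jac c c' p 1 2"
  by (simp add: det_2 matrix_def)

text \<open>The cross product is alternating, so of the Jacobian only its determinant
  survives.\<close>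

lemma cross3_coord_deriv:
  assumes "c \<in> A" "c' \<in> A" "p \<in> fst c" "p \<in> fst c'" "smooth_map A f"
  shows "cross3 (coord_deriv c' 1 f p) (coord_deriv c' 2 f p) =
    det (matrix (chart_differential c' (snd c) p)) *\<^sub>R cross3 (coord_deriv c 1 f p) (coord_deriv c 2 f p)"
  unfolding jac_det coord_deriv_chain[OF assms]
  by (simp add: cross3_simps forall_3)

text \<open>Otherwise the second coordinate of \<open>c'\<close> would attain its minimum 0 at a
  point interior to the half plane in chart \<open>c\<close>. Its differential would vanish there,
  contradicting the positive determinant.\<close>

lemma chart_boundary_transition:
  assumes c: "c \<in> A" "c' \<in> A" and p: "p \<in> fst c" "p \<in> fst c'" and p0: "snd c' p $ 2 = 0"
  shows "snd c p $ 2 = 0"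
proof (rule ccontr)
  assume "snd c p $ 2 \<noteq> 0"
  let ?W = "snd c ` (fst c' \<inter> fst c)" and ?\<sigma> = "snd c' \<circ> chart_inv c"
  let ?J = "chart_differential c (snd c') p"
  have pW: "snd c p \<in> ?W" using p by auto
  have nonneg: "snd c q $ 2 \<ge> 0" if "c \<in> A" "q \<in> fst c" for c q
    using openin_imp_subset[OF half_open_chart[OF that(1)]] that(2) by (auto simp: half_plane_def)
  obtain V where V: "open V" "?W = half_plane \<inter> V"
    using half_open_overlap(1)[OF c(2,1)] by (auto simp: openin_open)
  \<comment> \<open>Removing the boundary line leaves a neighbourhood open in the plane, on which
    the derivative is unrestricted and the criterion for extrema applies.\<close>
  let ?O = "V \<inter> {x. x $ 2 > 0}"
  have O: "open ?O" by (intro open_Int V open_Collect_less continuous_intros)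
  have OW: "?O \<subseteq> ?W" unfolding V(2) by (auto simp: half_plane_def)
  have pO: "snd c p \<in> ?O"
    using pW V(2) nonneg[OF c(1) p(1)] \<open>snd c p $ 2 \<noteq> 0\<close> by auto
  have "(?\<sigma> has_derivative ?J) (at (snd c p) within ?O)"
    using transition_has_derivative[OF c(2,1) p(2,1)] OW by (rule has_derivative_subset)
  then have "(?\<sigma> has_derivative ?J) (at (snd c p))"
    using at_within_open[OF pO O] by simp
  then have "((\<lambda>x. ?\<sigma> x $ 2) has_derivative (\<lambda>v. ?J v $ 2)) (at (snd c p))"
    by (rule bounded_linear.has_derivative[OF bounded_linear_vec_nth])
  moreover have "\<forall>y\<in>?O. ?\<sigma> (snd c p) $ 2 \<le> ?\<sigma> y $ 2"
  proof
    fix y assume "y \<in> ?O"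
    then obtain q where "q \<in> fst c" "q \<in> fst c'" "y = snd c q" using OW by auto
    then show "?\<sigma> (snd c p) $ 2 \<le> ?\<sigma> y $ 2"
      using p0 nonneg[OF c(2)] by (simp add: chart_inv_chart[OF c(1)] p)
  qed
  ultimately have "(\<lambda>v. ?J v $ 2) = (\<lambda>v. 0)"
    using differential_zero_maxmin[OF pO O] by blast
  then have "det (matrix ?J) = 0"
    unfolding jac_det by (metis mult_zero_left mult_zero_right diff_self)
  then show False
    using transition_det[OF c(2,1) p(2,1)] by simp
qed

text \<open>Along the boundary line the second coordinate of \<open>c\<close> stays 0, which gives
  the vanishing entry; inward it cannot decrease, which gives a nonnegative one. The determinant is
  then the product of the diagonal entries, and its positivity forces both to be positive.\<close>

lemma jac_boundary:
  assumes c: "c \<in> A" "c' \<in> A" and p: "p \<in> fst c" "p \<in> fst c'" and p0: "snd c' p $ 2 = 0"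
  shows "jac c c' p 1 2 = 0" "jac c c' p 1 1 > 0" "jac c c' p 2 2 > 0"
proof -
  let ?W = "snd c' ` (fst c \<inter> fst c')" and ?\<tau> = "snd c \<circ> chart_inv c'"
  let ?J = "chart_differential c' (snd c) p" and ?x = "snd c' p"
  have pW: "?x \<in> ?W" using p by auto
  obtain r where r: "r > 0" "ball ?x r \<inter> half_plane \<subseteq> ?W"
    using half_open_ball[OF half_open_overlap(1)[OF c] pW] .
  \<comment> \<open>\<open>S\<close> will be a two-sided interval for \<open>i = 1\<close> and
    \<open>{0..<r}\<close> for \<open>i = 2\<close>, where only inward steps stay in the half
    plane.\<close>
  have deriv: "((\<lambda>s. ?\<tau> (?x + s *\<^sub>R axis i 1) $ 2) has_real_derivative jac c c' p i 2) (at 0 within S)"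
    if "\<And>s. s \<in> S \<Longrightarrow> ?x + s *\<^sub>R axis i 1 \<in> ?W" for i S
  proof -
    have "((\<lambda>s. ?x + s *\<^sub>R axis i 1) has_derivative (\<lambda>k. k *\<^sub>R axis i 1)) (at 0 within S)"
      by (auto intro!: derivative_eq_intros)
    moreover have "(?\<tau> has_derivative ?J) (at (?x + 0 *\<^sub>R axis i 1) within (\<lambda>s. ?x + s *\<^sub>R axis i 1) ` S)"
      using has_derivative_subset[OF transition_has_derivative[OF c p]] that by (simp add: image_subsetI)
    ultimately have "((\<lambda>s. ?\<tau> (?x + s *\<^sub>R axis i 1)) has_derivative (\<lambda>k. ?J (k *\<^sub>R axis i 1))) (at 0 within S)"
      by (rule has_derivative_in_compose)
    from bounded_linear.has_derivative[OF bounded_linear_vec_nth this]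
    show ?thesis
      using linear_scale[OF has_derivative_linear[OF transition_has_derivative[OF c p]]]
      by (simp add: has_field_derivative_def mult.commute[of _ "?J _ $ _"] fun_eq_iff mult_commute_abs)
  qed
  have near: "?x + s *\<^sub>R axis i 1 \<in> ball ?x r" if "\<bar>s\<bar> < r" for s i
    using that by (simp add: dist_norm)
  have inW1: "?x + s *\<^sub>R axis 1 1 \<in> ?W" if "s \<in> {-r<..<r}" for s
    by (rule subsetD[OF r(2)]) (use that near[of s 1] p0 in \<open>auto simp: half_plane_def axis_def\<close>)
  have inW2: "?x + s *\<^sub>R axis 2 1 \<in> ?W" if "s \<in> {0..<r}" for s
    by (rule subsetD[OF r(2)]) (use that near[of s 2] p0 in \<open>auto simp: half_plane_def axis_def\<close>)
  have val: "?\<tau> y $ 2 = 0" if "y \<in> ?W" "y $ 2 = 0" for y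
    using that chart_boundary_transition[OF c] by (auto simp: chart_inv_chart[OF c(2)])
  have val': "?\<tau> y $ 2 \<ge> 0" if "y \<in> ?W" for y
    using that openin_imp_subset[OF half_open_chart[OF c(1)]]
    by (auto simp: chart_inv_chart[OF c(2)] half_plane_def)
  have zero1: "?\<tau> (?x + s *\<^sub>R axis 1 1) $ 2 = 0" if "s \<in> {-r<..<r}" for s
    by (rule val[OF inW1[OF that]]) (simp add: p0 axis_def)
  have "((\<lambda>s. ?\<tau> (?x + s *\<^sub>R axis 1 1) $ 2) has_real_derivative jac c c' p 1 2) (at 0)"
    using deriv[of "{-r<..<r}", OF inW1] r(1) at_within_open[of 0 "{-r<..<r}"] by simp
  then have "((\<lambda>s. 0) has_real_derivative jac c c' p 1 2) (at 0)"
    by (rule has_field_derivative_transform_within_open[where S = "{-r<..<r}"])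
      (use r(1) zero1 in auto)
  then show J12: "jac c c' p 1 2 = 0"
    using DERIV_unique DERIV_const by blast
  have "jac c c' p 2 2 \<ge> 0"
  proof (rule ccontr)
    assume "\<not> jac c c' p 2 2 \<ge> 0"
    then obtain d where d: "d > 0" "\<And>h. h > 0 \<Longrightarrow> 0 + h \<in> {0..<r} \<Longrightarrow> h < d \<Longrightarrow>
        ?\<tau> (?x + 0 *\<^sub>R axis 2 1) $ 2 > ?\<tau> (?x + (0 + h) *\<^sub>R axis 2 1) $ 2"
      using has_real_derivative_neg_dec_right[OF deriv[of "{0..<r}", OF inW2]] by auto
    define h where "h = min r d / 2"
    have h: "h > 0" "0 + h \<in> {0..<r}" "h < d" using r(1) d(1) by (auto simp: h_def)
    have "?\<tau> (?x + 0 *\<^sub>R axis 2 1) $ 2 = 0" using val[OF pW p0] by simp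
    moreover have "?\<tau> (?x + (0 + h) *\<^sub>R axis 2 1) $ 2 \<ge> 0" by (rule val'[OF inW2[OF h(2)]])
    ultimately show False using d(2)[OF h] by linarith
  qed
  moreover have "jac c c' p 1 1 * jac c c' p 2 2 > 0"
    using transition_det[OF c p] unfolding jac_det J12 by simp
  ultimately show "jac c c' p 1 1 > 0" "jac c c' p 2 2 > 0"
    by (auto simp: zero_less_mult_iff)
qed

end

subsection \<open>Densities and their integrals\<close>

lemma half_open_sets_lebesgue:
  assumes "half_open W"
  shows "W \<in> sets lebesgue"
proof -
  obtain V where V: "open V" "W = half_plane \<inter> V"
    using assms by (auto simp: openin_open)
  have "closed half_plane"
    unfolding half_plane_def by (intro closed_Collect_le continuous_intros)
  then show ?thesis
    unfolding V(2) using V(1) by (intro sets.Int) (auto intro: lebesgue_closedin lebesgue_openin)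
qed

lemma half_open_trace:
  assumes "half_open W"
  shows "open {s::real. vector [s, 0] \<in> W}"
proof -
  obtain V where V: "open V" "W = half_plane \<inter> V"
    using assms by (auto simp: openin_open)
  have "{s::real. vector [s, 0] \<in> W} = (\<lambda>s. vector [s, 0]) -` V"
    by (auto simp: V(2) half_plane_def)
  also have "open \<dots>"
    unfolding vector_2_eq_axis by (intro open_vimage V continuous_intros)
  finally show ?thesis .
qed

text \<open>The trace is the projection to the first coordinate of the part of \<open>K\<close> on
  the boundary line.\<close>

lemma compact_trace:
  assumes "compact (K :: (real^2) set)"
  shows "compact {s. vector [s, 0] \<in> K}"
proof -
  have "compact ((\<lambda>x. x $ 1) ` (K \<inter> {x. x $ 2 = 0}))"
    by (intro compact_continuous_image compact_Int_closed assms closed_Collect_eq continuous_intros)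
  also have "(\<lambda>x. x $ 1) ` (K \<inter> {x. x $ 2 = 0}) = {s. vector [s, 0] \<in> K}"
  proof (intro equalityI subsetI)
    fix s assume "s \<in> (\<lambda>x. x $ 1) ` (K \<inter> {x. x $ 2 = 0})"
    then obtain x where x: "x \<in> K" "x $ 2 = 0" "s = x $ 1" by auto
    then have "x = vector [s, 0]" by (simp add: vec_eq_iff forall_2)
    then show "s \<in> {s. vector [s, 0] \<in> K}" using x(1) by simp
  next
    fix s assume "s \<in> {s. vector [s, 0] \<in> K}"
    then show "s \<in> (\<lambda>x. x $ 1) ` (K \<inter> {x. x $ 2 = 0})"
      by (intro image_eqI[where x = "vector [s, 0]"]) auto
  qed
  finally show ?thesis .
qed

text \<open>The scalar integrand passes through the vector-valued theorem as a map into
  \<open>real^1\<close>.\<close>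

lemma integral_change_of_variables_2_real:
  fixes f :: "real^2 \<Rightarrow> real" and g :: "real^2 \<Rightarrow> real^2"
  assumes "S \<in> sets lebesgue" "\<And>x. x \<in> S \<Longrightarrow> (g has_derivative g' x) (at x within S)"
    and "inj_on g S" "f absolutely_integrable_on g ` S"
  shows "integral (g ` S) f = integral S (\<lambda>x. \<bar>det (matrix (g' x))\<bar> * f (g x))"
proof -
  have "(\<lambda>x. vec (f x) :: real^1) absolutely_integrable_on g ` S"
    using assms(4) by (simp add: absolutely_integrable_on_1_iff)
  then have "integral (g ` S) (\<lambda>x. vec (f x) :: real^1) =
      integral S (\<lambda>x. \<bar>det (matrix (g' x))\<bar> *\<^sub>R vec (f (g x)))"
    using integral_change_of_variables[OF assms(1-3)] by blast
  then show ?thesis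
    by (simp add: integral_on_1_eq vec_eq_iff)
qed

text \<open>What integrals over the surface and over its boundary have in common: a family \<open>m\<close> of
  functions, one for each chart, is integrated over parameter domains \<open>D c\<close>.  The families in
  \<open>dens\<close> are those that transform in such a way that the integral of a function supported in
  two charts does not depend on the chart.\<close>

locale chart_integral = compact_surface X A for X :: "'a topology" and A :: "'a chart set" +
  fixes D :: "'a chart \<Rightarrow> 'b::euclidean_space set" and \<pi> :: "'a chart \<Rightarrow> 'b \<Rightarrow> 'a"
    and dens :: "('a chart \<Rightarrow> 'a \<Rightarrow> real) \<Rightarrow> bool"
  assumes param_in_dom: "c \<in> A \<Longrightarrow> x \<in> D c \<Longrightarrow> \<pi> c x \<in> fst c"
    and dens_mult: "dens m \<Longrightarrow> smooth_map A f \<Longrightarrow> dens (\<lambda>c p. f p * m c p)"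
    and dens_integrable: "dens m \<Longrightarrow> c \<in> A \<Longrightarrow> closedin X K \<Longrightarrow> K \<subseteq> fst c \<Longrightarrow>
      (\<And>p. p \<in> fst c \<Longrightarrow> p \<notin> K \<Longrightarrow> m c p = 0) \<Longrightarrow> (\<lambda>x. m c (\<pi> c x)) integrable_on D c"
    and dens_swap: "dens m \<Longrightarrow> c \<in> A \<Longrightarrow> c' \<in> A \<Longrightarrow> closedin X K \<Longrightarrow> K \<subseteq> fst c \<inter> fst c' \<Longrightarrow>
      (\<And>p. p \<in> fst c \<Longrightarrow> p \<notin> K \<Longrightarrow> m c p = 0) \<Longrightarrow> (\<And>p. p \<in> fst c' \<Longrightarrow> p \<notin> K \<Longrightarrow> m c' p = 0) \<Longrightarrow>
      integral (D c) (\<lambda>x. m c (\<pi> c x)) = integral (D c') (\<lambda>x. m c' (\<pi> c' x))"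

context compact_surface
begin

lemma partition_facts:
  assumes "partition_of_unity X A C \<rho>"
  shows "finite C" "C \<subseteq> A" "c \<in> C \<Longrightarrow> smooth_map A (\<rho> c)"
    and "p \<in> topspace X \<Longrightarrow> (\<Sum>c\<in>C. \<rho> c p) = 1"
  using assms unfolding partition_of_unity_def by blast+

lemma partition_support:
  assumes "partition_of_unity X A C \<rho>" "c \<in> C"
  obtains K where "closedin X K" "K \<subseteq> fst c" "\<And>p. p \<in> topspace X \<Longrightarrow> p \<notin> K \<Longrightarrow> \<rho> c p = 0"
proof
  let ?K = "X closure_of {p \<in> topspace X. \<rho> c p \<noteq> 0}"
  show "closedin X ?K" by simp
  show "?K \<subseteq> fst c" using assms unfolding partition_of_unity_def by blast
  show "\<rho> c p = 0" if "p \<in> topspace X" "p \<notin> ?K" for p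
  proof (rule ccontr)
    assume "\<rho> c p \<noteq> 0"
    then have "p \<in> {p \<in> topspace X. \<rho> c p \<noteq> 0}" using that by simp
    moreover have "{p \<in> topspace X. \<rho> c p \<noteq> 0} \<subseteq> ?K" by (rule closure_of_subset) auto
    ultimately show False using that(2) by auto
  qed
qed

end

context chart_integral
begin

text \<open>Inserting the factor \<Sum> \<sigma>_d = 1 splits the integrand; each piece is supported
  in a closed subset of \<open>fst c \<inter> fst d\<close> and can be moved to chart
  \<open>d\<close>. Vanishing off \<open>K\<close> is asked for in every chart because it is used
  again in chart \<open>d\<close>.\<close>

lemma localized_integral:
  assumes m: "dens m" and c: "c \<in> A" and K: "closedin X K" "K \<subseteq> fst c"
    and m0: "\<And>c' p. c' \<in> A \<Longrightarrow> p \<in> fst c' \<Longrightarrow> p \<notin> K \<Longrightarrow> m c' p = 0"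
    and P: "partition_of_unity X A C \<sigma>"
  shows "integral (D c) (\<lambda>x. m c (\<pi> c x)) =
    (\<Sum>d\<in>C. integral (D d) (\<lambda>x. \<sigma> d (\<pi> d x) * m d (\<pi> d x)))"
proof -
  note PF = partition_facts[OF P]
  have dm: "dens (\<lambda>c p. \<sigma> d p * m c p)" if "d \<in> C" for d
    by (rule dens_mult[OF m PF(3)[OF that]])
  have "integral (D c) (\<lambda>x. m c (\<pi> c x)) = integral (D c) (\<lambda>x. \<Sum>d\<in>C. \<sigma> d (\<pi> c x) * m c (\<pi> c x))"
  proof (rule integral_cong)
    fix x assume "x \<in> D c"
    then have "\<pi> c x \<in> topspace X" using param_in_dom[OF c] dom_subset[OF c] by auto
    then show "m c (\<pi> c x) = (\<Sum>d\<in>C. \<sigma> d (\<pi> c x) * m c (\<pi> c x))"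
      using PF(4) by (simp add: sum_distrib_right[symmetric])
  qed
  also have "\<dots> = (\<Sum>d\<in>C. integral (D c) (\<lambda>x. \<sigma> d (\<pi> c x) * m c (\<pi> c x)))"
  proof (rule integral_sum[OF PF(1)])
    fix d assume "d \<in> C"
    show "(\<lambda>x. \<sigma> d (\<pi> c x) * m c (\<pi> c x)) integrable_on D c"
      by (rule dens_integrable[OF dm[OF \<open>d \<in> C\<close>] c K]) (simp add: m0[OF c])
  qed
  also have "\<dots> = (\<Sum>d\<in>C. integral (D d) (\<lambda>x. \<sigma> d (\<pi> d x) * m d (\<pi> d x)))"
  proof (rule sum.cong[OF refl])
    fix d assume d: "d \<in> C"
    then have dA: "d \<in> A" using PF(2) by auto
    obtain L where L: "closedin X L" "L \<subseteq> fst d" "\<And>p. p \<in> topspace X \<Longrightarrow> p \<notin> L \<Longrightarrow> \<sigma> d p = 0"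
      using partition_support[OF P d] by blast
    have van: "\<sigma> d p * m c' p = 0" if "c' \<in> A" "p \<in> fst c'" "p \<notin> K \<inter> L" for c' p
      using that(3) m0[OF that(1,2)] L(3)[OF subsetD[OF dom_subset[OF that(1)] that(2)]] by auto
    show "integral (D c) (\<lambda>x. \<sigma> d (\<pi> c x) * m c (\<pi> c x)) = integral (D d) (\<lambda>x. \<sigma> d (\<pi> d x) * m d (\<pi> d x))"
      by (rule dens_swap[OF dm[OF d] c dA closedin_Int[OF K(1) L(1)]])
        (use K(2) L(2) van[OF c] van[OF dA] in auto)
  qed
  finally show "integral (D c) (\<lambda>x. m c (\<pi> c x)) =
    (\<Sum>d\<in>C. integral (D d) (\<lambda>x. \<sigma> d (\<pi> d x) * m d (\<pi> d x)))" .
qed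

lemma partition_integrable:
  assumes m: "dens m" and P: "partition_of_unity X A C \<sigma>" and d: "d \<in> C"
  shows "(\<lambda>x. \<sigma> d (\<pi> d x) * m d (\<pi> d x)) integrable_on D d"
proof -
  have dA: "d \<in> A" using d partition_facts(2)[OF P] by auto
  obtain L where L: "closedin X L" "L \<subseteq> fst d" "\<And>p. p \<in> topspace X \<Longrightarrow> p \<notin> L \<Longrightarrow> \<sigma> d p = 0"
    using partition_support[OF P d] by blast
  show ?thesis
    by (rule dens_integrable[OF dens_mult[OF m partition_facts(3)[OF P d]] dA L(1,2)])
      (use L(3) dom_subset[OF dA] in auto)
qed

text \<open>The summands may sit in different charts, and the \<open>m i\<close> can be added
  pointwise only after redistribution. This serves twice: with \<open>M\<close> a given density for
  independence of the partition, and with \<open>M\<close> zero for the cancellation of the error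
  terms.\<close>

lemma sum_localized_integrals:
  assumes P: "partition_of_unity X A C \<sigma>" and I: "finite I" "\<And>i. i \<in> I \<Longrightarrow> c i \<in> A"
    and m: "\<And>i. i \<in> I \<Longrightarrow> dens (m i)"
    and K: "\<And>i. i \<in> I \<Longrightarrow> closedin X (K i)" "\<And>i. i \<in> I \<Longrightarrow> K i \<subseteq> fst (c i)"
    and m0: "\<And>i c' p. i \<in> I \<Longrightarrow> c' \<in> A \<Longrightarrow> p \<in> fst c' \<Longrightarrow> p \<notin> K i \<Longrightarrow> m i c' p = 0"
    and M: "\<And>d p. d \<in> A \<Longrightarrow> p \<in> fst d \<Longrightarrow> (\<Sum>i\<in>I. m i d p) = M d p"
  shows "(\<Sum>i\<in>I. integral (D (c i)) (\<lambda>x. m i (c i) (\<pi> (c i) x))) =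
    (\<Sum>d\<in>C. integral (D d) (\<lambda>x. \<sigma> d (\<pi> d x) * M d (\<pi> d x)))"
proof -
  have "(\<Sum>i\<in>I. integral (D (c i)) (\<lambda>x. m i (c i) (\<pi> (c i) x))) =
      (\<Sum>i\<in>I. \<Sum>d\<in>C. integral (D d) (\<lambda>x. \<sigma> d (\<pi> d x) * m i d (\<pi> d x)))"
    by (intro sum.cong refl localized_integral[OF m I(2) K m0 P])
  also have "\<dots> = (\<Sum>d\<in>C. \<Sum>i\<in>I. integral (D d) (\<lambda>x. \<sigma> d (\<pi> d x) * m i d (\<pi> d x)))"
    by (rule sum.swap)
  also have "\<dots> = (\<Sum>d\<in>C. integral (D d) (\<lambda>x. \<sigma> d (\<pi> d x) * M d (\<pi> d x)))"
  proof (rule sum.cong[OF refl])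
    fix d assume d: "d \<in> C"
    then have dA: "d \<in> A" using partition_facts(2)[OF P] by auto
    have "(\<Sum>i\<in>I. integral (D d) (\<lambda>x. \<sigma> d (\<pi> d x) * m i d (\<pi> d x))) =
        integral (D d) (\<lambda>x. \<Sum>i\<in>I. \<sigma> d (\<pi> d x) * m i d (\<pi> d x))"
      by (rule integral_sum[OF I(1), symmetric]) (rule partition_integrable[OF m P d])
    also have "\<dots> = integral (D d) (\<lambda>x. \<sigma> d (\<pi> d x) * M d (\<pi> d x))"
      by (rule integral_cong) (simp add: sum_distrib_left[symmetric] M[OF dA param_in_dom[OF dA]])
    finally show "(\<Sum>i\<in>I. integral (D d) (\<lambda>x. \<sigma> d (\<pi> d x) * m i d (\<pi> d x))) =
        integral (D d) (\<lambda>x. \<sigma> d (\<pi> d x) * M d (\<pi> d x))" .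
  qed
  finally show ?thesis .
qed

text \<open>Each product of \<open>\<rho> c\<close> with \<open>m\<close> is localized in chart
  \<open>c\<close>, so the whole sum can be redistributed along the other partition. This makes the
  descriptions that define the integrals single-valued.\<close>

lemma partition_independent:
  assumes m: "dens m" and P: "partition_of_unity X A C \<rho>" and Q: "partition_of_unity X A E \<sigma>"
  shows "(\<Sum>c\<in>C. integral (D c) (\<lambda>x. \<rho> c (\<pi> c x) * m c (\<pi> c x))) =
    (\<Sum>d\<in>E. integral (D d) (\<lambda>x. \<sigma> d (\<pi> d x) * m d (\<pi> d x)))"
proof -
  note PF = partition_facts[OF P]
  have "\<forall>c\<in>C. \<exists>K. closedin X K \<and> K \<subseteq> fst c \<and> (\<forall>p\<in>topspace X. p \<notin> K \<longrightarrow> \<rho> c p = 0)"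
    using partition_support[OF P] by metis
  from bchoice[OF this] obtain K where
    K: "\<forall>c\<in>C. closedin X (K c) \<and> K c \<subseteq> fst c \<and> (\<forall>p\<in>topspace X. p \<notin> K c \<longrightarrow> \<rho> c p = 0)"
    by (elim exE)
  show ?thesis
  proof (rule sum_localized_integrals[OF Q PF(1), where c = "\<lambda>c. c" and K = K and m = "\<lambda>c d p. \<rho> c p * m d p"])
    show "dens (\<lambda>d p. \<rho> c p * m d p)" if "c \<in> C" for c
      by (rule dens_mult[OF m PF(3)[OF that]])
    show "\<rho> c p * m c' p = 0" if "c \<in> C" "c' \<in> A" "p \<in> fst c'" "p \<notin> K c" for c c' p
      using K that(1,4) subsetD[OF dom_subset[OF that(2)] that(3)] by auto
    show "(\<Sum>c\<in>C. \<rho> c p * m d p) = m d p" if "d \<in> A" "p \<in> fst d" for d p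
      using PF(4) dom_subset[OF that(1)] that(2) by (simp add: sum_distrib_right[symmetric] subset_iff)
  qed (use K PF(2) in auto)
qed

end

section \<open>Area and line densities and their change of variables\<close>

context compact_surface
begin

text \<open>The coefficient of a continuous 2-form: it transforms with the signed determinant, as
  the integrands of \<open>surface_integral\<close> do in an oriented atlas.\<close>

definition surface_density :: "('a chart \<Rightarrow> 'a \<Rightarrow> real) \<Rightarrow> bool" where
  "surface_density m \<longleftrightarrow>
     (\<forall>c\<in>A. continuous_on (chart_image c) (\<lambda>x. m c (chart_inv c x))) \<and>
     (\<forall>c\<in>A. \<forall>c'\<in>A. \<forall>p\<in>fst c \<inter> fst c'.
        m c' p = det (matrix (chart_differential c' (snd c) p)) * m c p)"

text \<open>The coefficient of a 1-form pulled back to the boundary curve. At boundary points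
  \<open>jac c c' p 1 1\<close> is the derivative of the transition map along the boundary
  line.\<close>

definition boundary_density :: "('a chart \<Rightarrow> 'a \<Rightarrow> real) \<Rightarrow> bool" where
  "boundary_density m \<longleftrightarrow>
     (\<forall>c\<in>A. continuous_on {s. vector [s, 0] \<in> chart_image c} (\<lambda>s. m c (chart_inv c (vector [s, 0])))) \<and>
     (\<forall>c\<in>A. \<forall>c'\<in>A. \<forall>p\<in>fst c \<inter> fst c'. snd c' p $ 2 = 0 \<longrightarrow> m c' p = jac c c' p 1 1 * m c p)"

lemma surface_densityI:
  assumes "\<And>c. c \<in> A \<Longrightarrow> continuous_on (chart_image c) (\<lambda>x. m c (chart_inv c x))"
    and "\<And>c c' p. c \<in> A \<Longrightarrow> c' \<in> A \<Longrightarrow> p \<in> fst c \<Longrightarrow> p \<in> fst c' \<Longrightarrow>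
      m c' p = det (matrix (chart_differential c' (snd c) p)) * m c p"
  shows "surface_density m"
  unfolding surface_density_def by (intro conjI ballI assms) (simp_all only: Int_iff)

lemma surface_densityD:
  assumes "surface_density m"
  shows "c \<in> A \<Longrightarrow> continuous_on (chart_image c) (\<lambda>x. m c (chart_inv c x))"
    and "c \<in> A \<Longrightarrow> c' \<in> A \<Longrightarrow> p \<in> fst c \<Longrightarrow> p \<in> fst c' \<Longrightarrow>
      m c' p = det (matrix (chart_differential c' (snd c) p)) * m c p"
  using assms unfolding surface_density_def by blast+

lemma boundary_densityI:
  assumes "\<And>c. c \<in> A \<Longrightarrow> continuous_on {s. vector [s, 0] \<in> chart_image c} (\<lambda>s. m c (chart_inv c (vector [s, 0])))"
    and "\<And>c c' p. c \<in> A \<Longrightarrow> c' \<in> A \<Longrightarrow> p \<in> fst c \<Longrightarrow> p \<in> fst c' \<Longrightarrow> snd c' p $ 2 = 0 \<Longrightarrow>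
      m c' p = jac c c' p 1 1 * m c p"
  shows "boundary_density m"
  unfolding boundary_density_def by (intro conjI ballI impI assms) (simp_all only: Int_iff)

lemma boundary_densityD:
  assumes "boundary_density m"
  shows "c \<in> A \<Longrightarrow> continuous_on {s. vector [s, 0] \<in> chart_image c} (\<lambda>s. m c (chart_inv c (vector [s, 0])))"
    and "c \<in> A \<Longrightarrow> c' \<in> A \<Longrightarrow> p \<in> fst c \<Longrightarrow> p \<in> fst c' \<Longrightarrow> snd c' p $ 2 = 0 \<Longrightarrow>
      m c' p = jac c c' p 1 1 * m c p"
  using assms unfolding boundary_density_def by blast+

lemma smooth_map_continuous_on:
  "smooth_map A f \<Longrightarrow> c \<in> A \<Longrightarrow> continuous_on (chart_image c) (\<lambda>x. f (chart_inv c x))"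
  using smooth_on_imp_continuous_on unfolding smooth_map_def comp_def by blast

lemma continuous_on_trace:
  fixes U :: "(real^2) set"
  assumes "continuous_on U f"
  shows "continuous_on {s::real. vector [s, 0] \<in> U} (\<lambda>s. f (vector [s, 0]))"
proof -
  have "continuous_on {s::real. vector [s, 0] \<in> U} (\<lambda>s. vector [s, 0] :: real^2)"
    unfolding vector_2_eq_axis by (intro continuous_intros)
  then show ?thesis
    by (rule continuous_on_compose2[OF assms]) auto
qed

lemma chart_inv_in: "x \<in> chart_image c \<Longrightarrow> chart_inv c x \<in> fst c"
  and chart_chart_inv: "x \<in> chart_image c \<Longrightarrow> snd c (chart_inv c x) = x"
  by (rule inv_into_into, assumption, rule f_inv_into_f)

lemma transition_image:
  assumes "c \<in> A" "c' \<in> A"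
  shows "(snd c \<circ> chart_inv c') ` (snd c' ` (fst c \<inter> fst c')) = snd c ` (fst c \<inter> fst c')"
  unfolding image_comp by (rule image_cong) (simp_all add: chart_inv_chart[OF assms(2)])

lemma transition_inj:
  assumes "c \<in> A" "c' \<in> A"
  shows "inj_on (snd c \<circ> chart_inv c') (snd c' ` (fst c \<inter> fst c'))"
proof (rule inj_onI)
  fix x y assume x: "x \<in> snd c' ` (fst c \<inter> fst c')" and y: "y \<in> snd c' ` (fst c \<inter> fst c')"
    and eq: "(snd c \<circ> chart_inv c') x = (snd c \<circ> chart_inv c') y"
  from x obtain p where p: "p \<in> fst c" "p \<in> fst c'" "x = snd c' p" by auto
  from y obtain q where q: "q \<in> fst c" "q \<in> fst c'" "y = snd c' q" by auto
  have "snd c p = snd c q"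
    using eq p q by (simp add: chart_inv_chart[OF assms(2)])
  then show "x = y" using inj_onD[OF chart_inj[OF assms(1)]] p q by auto
qed

text \<open>\<open>dens_swap\<close> is the change of variables on the overlap. Orientation makes
  the determinant positive, so the absolute value disappears and the law of
  \<open>surface_density\<close> remains.\<close>

lemma area_chart_integral:
  "chart_integral X A (\<lambda>c. chart_image c) (\<lambda>c. chart_inv c) surface_density"
proof unfold_locales
  show "chart_inv c x \<in> fst c" if "c \<in> A" "x \<in> chart_image c" for c x
    by (rule chart_inv_in[OF that(2)])
  show "surface_density (\<lambda>c p. f p * m c p)" if m: "surface_density m" and f: "smooth_map A f" for m f
  proof (rule surface_densityI)
    show "continuous_on (chart_image c) (\<lambda>x. f (chart_inv c x) * m c (chart_inv c x))" if "c \<in> A" for c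
      by (rule continuous_on_mult[OF smooth_map_continuous_on[OF f that] surface_densityD(1)[OF m that]])
    show "f p * m c' p = det (matrix (chart_differential c' (snd c) p)) * (f p * m c p)"
      if "c \<in> A" "c' \<in> A" "p \<in> fst c" "p \<in> fst c'" for c c' p
      unfolding surface_densityD(2)[OF m that] by (rule mult.left_commute)
  qed
next
  \<comment> \<open>\<open>U\<close> is left free between the image of \<open>K\<close> and the
    chart image: the full image is needed for integrability, the overlap for the change of
    variables.\<close>
  have abs_int: "(\<lambda>x. m c (chart_inv c x)) absolutely_integrable_on U"
    if m: "surface_density m" and c: "c \<in> A" and K: "closedin X K" "K \<subseteq> fst c"
      and m0: "\<And>p. p \<in> fst c \<Longrightarrow> p \<notin> K \<Longrightarrow> m c p = 0" and U: "snd c ` K \<subseteq> U" "U \<subseteq> chart_image c" for m c K U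
  proof (rule absolutely_integrable_compact_support[OF _ U(1)])
    show "compact (snd c ` K)" using compact_chart_image[OF c K(2)] K(1) by simp
    show "continuous_on U (\<lambda>x. m c (chart_inv c x))"
      by (rule continuous_on_subset[OF surface_densityD(1)[OF m c] U(2)])
    show "m c (chart_inv c x) = 0" if "x \<in> U" "x \<notin> snd c ` K" for x
    proof (rule m0)
      have x: "x \<in> chart_image c" using that U(2) by auto
      then show "chart_inv c x \<in> fst c" by (rule chart_inv_in)
      show "chart_inv c x \<notin> K" using that(2) imageI[of "chart_inv c x" K "snd c"] unfolding chart_chart_inv[OF x] by blast
    qed
  qed
  show "(\<lambda>x. m c (chart_inv c x)) integrable_on chart_image c"
    if "surface_density m" "c \<in> A" "closedin X K" "K \<subseteq> fst c"
      "\<And>p. p \<in> fst c \<Longrightarrow> p \<notin> K \<Longrightarrow> m c p = 0" for m c K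
    by (rule set_lebesgue_integral_eq_integral(1), rule abs_int[OF that]) (use that(4) in auto)
  fix m c c' K
  assume m: "surface_density m" and c: "c \<in> A" "c' \<in> A" and K: "closedin X K" "K \<subseteq> fst c \<inter> fst c'"
    and m0: "\<And>p. p \<in> fst c \<Longrightarrow> p \<notin> K \<Longrightarrow> m c p = 0" "\<And>p. p \<in> fst c' \<Longrightarrow> p \<notin> K \<Longrightarrow> m c' p = 0"
  let ?\<tau> = "snd c \<circ> chart_inv c'"
  let ?W' = "snd c' ` (fst c \<inter> fst c')"
  have restrict: "integral (chart_image d) (\<lambda>x. m d (chart_inv d x)) =
      integral (snd d ` (fst c \<inter> fst c')) (\<lambda>x. m d (chart_inv d x))"
    if "fst c \<inter> fst c' \<subseteq> fst d" "\<And>p. p \<in> fst d \<Longrightarrow> p \<notin> K \<Longrightarrow> m d p = 0" for d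
  proof (rule integral_zero_outside)
    fix x assume "x \<in> chart_image d - snd d ` (fst c \<inter> fst c')"
    then have x: "x \<in> chart_image d" "x \<notin> snd d ` (fst c \<inter> fst c')" by simp_all
    show "m d (chart_inv d x) = 0"
    proof (rule that(2))
      show "chart_inv d x \<in> fst d" using x(1) by (rule chart_inv_in)
      show "chart_inv d x \<notin> K"
        using x(2) K(2) imageI[of "chart_inv d x" "fst c \<inter> fst c'" "snd d"]
        unfolding chart_chart_inv[OF x(1)] by blast
    qed
  qed (use that(1) in auto)
  have "integral (chart_image c) (\<lambda>x. m c (chart_inv c x)) = integral (?\<tau> ` ?W') (\<lambda>x. m c (chart_inv c x))"
    unfolding transition_image[OF c] by (rule restrict[OF Int_lower1 m0(1)])
  also have "\<dots> = integral ?W' (\<lambda>x. \<bar>det (matrix (chart_differential c' (snd c) (chart_inv c' x)))\<bar> *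
      m c (chart_inv c (?\<tau> x)))"
  proof (rule integral_change_of_variables_2_real)
    show "?W' \<in> sets lebesgue" by (rule half_open_sets_lebesgue[OF half_open_overlap(1)[OF c]])
    show "inj_on ?\<tau> ?W'" by (rule transition_inj[OF c])
    show "(?\<tau> has_derivative chart_differential c' (snd c) (chart_inv c' x)) (at x within ?W')"
      if "x \<in> ?W'" for x
    proof -
      from that obtain p where p: "p \<in> fst c" "p \<in> fst c'" "x = snd c' p" by auto
      from transition_has_derivative[OF c p(1,2)] show ?thesis
        unfolding p(3) chart_inv_chart[OF c(2) p(2)] .
    qed
    show "(\<lambda>x. m c (chart_inv c x)) absolutely_integrable_on ?\<tau> ` ?W'"
      unfolding transition_image[OF c]
      by (rule abs_int[OF m c(1) K(1) _ m0(1)]) (use K(2) in auto)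
  qed
  also have "\<dots> = integral ?W' (\<lambda>x. m c' (chart_inv c' x))"
  proof (rule integral_cong)
    fix x assume "x \<in> ?W'"
    then obtain p where p: "p \<in> fst c" "p \<in> fst c'" "x = snd c' p" by auto
    have "m c' p = det (matrix (chart_differential c' (snd c) p)) * m c p"
      by (rule surface_densityD(2)[OF m c p(1,2)])
    then show "\<bar>det (matrix (chart_differential c' (snd c) (chart_inv c' x)))\<bar> * m c (chart_inv c (?\<tau> x)) =
        m c' (chart_inv c' x)"
      using transition_det[OF c p(1,2)] unfolding p(3) comp_apply
      by (simp only: chart_inv_chart[OF c(2) p(2)] chart_inv_chart[OF c(1) p(1)] abs_of_pos)
  qed
  also have "\<dots> = integral (chart_image c') (\<lambda>x. m c' (chart_inv c' x))"
    by (rule restrict[OF Int_lower2 m0(2), symmetric])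
  finally show "integral (chart_image c) (\<lambda>x. m c (chart_inv c x)) =
      integral (chart_image c') (\<lambda>x. m c' (chart_inv c' x))" .
qed

text \<open>Transition maps carry the boundary line to the boundary line, so restricting them gives
  a change of variables on the real line. Its derivative is positive by \<open>jac_boundary\<close>,
  which removes the absolute value.\<close>

lemma line_chart_integral:
  "chart_integral X A (\<lambda>c. {s. vector [s, 0] \<in> chart_image c}) (\<lambda>c s. chart_inv c (vector [s, 0])) boundary_density"
proof unfold_locales
  show "chart_inv c (vector [s, 0]) \<in> fst c" if "c \<in> A" "s \<in> {s. vector [s, 0] \<in> chart_image c}" for c s
    by (rule chart_inv_in) (use that(2) in simp)
  show "boundary_density (\<lambda>c p. f p * m c p)" if m: "boundary_density m" and f: "smooth_map A f" for m f
  proof (rule boundary_densityI)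
    show "continuous_on {s. vector [s, 0] \<in> chart_image c}
        (\<lambda>s. f (chart_inv c (vector [s, 0])) * m c (chart_inv c (vector [s, 0])))" if "c \<in> A" for c
      by (rule continuous_on_mult[OF continuous_on_trace[OF smooth_map_continuous_on[OF f that]]
            boundary_densityD(1)[OF m that]])
    show "f p * m c' p = jac c c' p 1 1 * (f p * m c p)"
      if "c \<in> A" "c' \<in> A" "p \<in> fst c" "p \<in> fst c'" "snd c' p $ 2 = 0" for c c' p
      unfolding boundary_densityD(2)[OF m that] by (rule mult.left_commute)
  qed
next
  let ?tr = "\<lambda>U. {s::real. vector [s, 0] \<in> (U :: (real^2) set)}"
  have abs_int: "(\<lambda>s. m c (chart_inv c (vector [s, 0]))) absolutely_integrable_on ?tr U"
    if m: "boundary_density m" and c: "c \<in> A" and K: "closedin X K" "K \<subseteq> fst c"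
      and m0: "\<And>p. p \<in> fst c \<Longrightarrow> p \<notin> K \<Longrightarrow> m c p = 0" and U: "snd c ` K \<subseteq> U" "U \<subseteq> chart_image c" for m c K U
  proof (rule absolutely_integrable_compact_support)
    show "compact (?tr (snd c ` K))" using compact_chart_image[OF c K(2)] K(1) by (intro compact_trace) simp
    show "?tr (snd c ` K) \<subseteq> ?tr U" using U(1) by auto
    show "continuous_on (?tr U) (\<lambda>s. m c (chart_inv c (vector [s, 0])))"
      by (rule continuous_on_subset[OF boundary_densityD(1)[OF m c]]) (use U(2) in auto)
    show "m c (chart_inv c (vector [s, 0])) = 0" if "s \<in> ?tr U" "s \<notin> ?tr (snd c ` K)" for s
    proof (rule m0)
      have x: "vector [s, 0] \<in> chart_image c" using that U(2) by auto
      then show "chart_inv c (vector [s, 0]) \<in> fst c" by (rule chart_inv_in)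
      have "vector [s, 0] \<notin> snd c ` K" using that(2) by simp
      then show "chart_inv c (vector [s, 0]) \<notin> K"
        using imageI[of "chart_inv c (vector [s, 0])" K "snd c"] unfolding chart_chart_inv[OF x] by blast
    qed
  qed
  show "(\<lambda>s. m c (chart_inv c (vector [s, 0]))) integrable_on ?tr (chart_image c)"
    if "boundary_density m" "c \<in> A" "closedin X K" "K \<subseteq> fst c"
      "\<And>p. p \<in> fst c \<Longrightarrow> p \<notin> K \<Longrightarrow> m c p = 0" for m c K
    by (rule set_lebesgue_integral_eq_integral(1), rule abs_int[OF that]) (use that(4) in auto)
  fix m c c' K
  assume m: "boundary_density m" and c: "c \<in> A" "c' \<in> A" and K: "closedin X K" "K \<subseteq> fst c \<inter> fst c'"
    and m0: "\<And>p. p \<in> fst c \<Longrightarrow> p \<notin> K \<Longrightarrow> m c p = 0" "\<And>p. p \<in> fst c' \<Longrightarrow> p \<notin> K \<Longrightarrow> m c' p = 0"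
  let ?\<tau> = "snd c \<circ> chart_inv c'"
  let ?W = "snd c ` (fst c \<inter> fst c')" and ?W' = "snd c' ` (fst c \<inter> fst c')"
  \<comment> \<open>The transition map along the boundary line; its second coordinate is zero there,
    as recorded in the last part of \<open>q\<close>.\<close>
  let ?g = "\<lambda>s. ?\<tau> (vector [s, 0]) $ 1"
  let ?q = "\<lambda>s. chart_inv c' (vector [s, 0])"
  have restrict: "integral (?tr (chart_image d)) (\<lambda>s. m d (chart_inv d (vector [s, 0]))) =
      integral (?tr (snd d ` (fst c \<inter> fst c'))) (\<lambda>s. m d (chart_inv d (vector [s, 0])))"
    if "fst c \<inter> fst c' \<subseteq> fst d" "\<And>p. p \<in> fst d \<Longrightarrow> p \<notin> K \<Longrightarrow> m d p = 0" for d
  proof (rule integral_zero_outside)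
    fix s assume "s \<in> ?tr (chart_image d) - ?tr (snd d ` (fst c \<inter> fst c'))"
    then have x: "vector [s, 0] \<in> chart_image d" "vector [s, 0] \<notin> snd d ` (fst c \<inter> fst c')" by auto
    show "m d (chart_inv d (vector [s, 0])) = 0"
    proof (rule that(2))
      show "chart_inv d (vector [s, 0]) \<in> fst d" using x(1) by (rule chart_inv_in)
      show "chart_inv d (vector [s, 0]) \<notin> K"
        using x(2) K(2) imageI[of "chart_inv d (vector [s, 0])" "fst c \<inter> fst c'" "snd d"]
        unfolding chart_chart_inv[OF x(1)] by blast
    qed
  qed (use that(1) in auto)
  have q: "?q s \<in> fst c" "?q s \<in> fst c'" "snd c' (?q s) = vector [s, 0]" "snd c' (?q s) $ 2 = 0"
    "?\<tau> (vector [s, 0]) = vector [?g s, 0]" if "s \<in> ?tr ?W'" for s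
  proof -
    from that obtain p where p: "p \<in> fst c" "p \<in> fst c'" "vector [s, 0] = snd c' p" by auto
    then have "?q s = p" by (simp add: chart_inv_chart[OF c(2)])
    with p show q: "?q s \<in> fst c" "?q s \<in> fst c'" "snd c' (?q s) = vector [s, 0]" "snd c' (?q s) $ 2 = 0"
      by (simp_all add: p(3)[symmetric])
    show "?\<tau> (vector [s, 0]) = vector [?g s, 0]"
      using chart_boundary_transition[OF c q(1,2,4)] by (simp add: vec_eq_iff forall_2)
  qed
  have image: "?g ` ?tr ?W' = ?tr ?W"
  proof (intro equalityI subsetI)
    fix s assume "s \<in> ?g ` ?tr ?W'"
    then obtain s' where s': "s' \<in> ?tr ?W'" "s = ?g s'" by auto
    have "vector [s, 0] = ?\<tau> (vector [s', 0])" using q(5)[OF s'(1)] s'(2) by simp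
    then show "s \<in> ?tr ?W" using transition_image[OF c] s'(1) by blast
  next
    fix s assume "s \<in> ?tr ?W"
    then obtain p where p: "p \<in> fst c" "p \<in> fst c'" "vector [s, 0] = snd c p" by auto
    have "snd c p $ 2 = 0" by (simp add: p(3)[symmetric])
    \<comment> \<open>The reverse transition also preserves the boundary line, so \<open>?g\<close>
      reaches every point of the trace of the overlap.\<close>
    then have "snd c' p $ 2 = 0" by (rule chart_boundary_transition[OF c(2,1) p(2,1)])
    then have eq: "vector [snd c' p $ 1, 0] = snd c' p" by (simp add: vec_eq_iff forall_2)
    have "snd c' p $ 1 \<in> ?tr ?W'" using p(1,2) by (simp add: eq)
    moreover have "s = ?g (snd c' p $ 1)"
      unfolding eq by (simp add: chart_inv_chart[OF c(2) p(2)] p(3)[symmetric])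
    ultimately show "s \<in> ?g ` ?tr ?W'" by blast
  qed
  have inj: "inj_on ?g (?tr ?W')"
  proof (rule inj_onI)
    fix s s' assume s: "s \<in> ?tr ?W'" "s' \<in> ?tr ?W'" "?g s = ?g s'"
    then have "?\<tau> (vector [s, 0]) = ?\<tau> (vector [s', 0])" using q(5) by metis
    then have "(vector [s, 0] :: real^2) = vector [s', 0]"
      using inj_onD[OF transition_inj[OF c]] s(1,2) by blast
    then show "s = s'" by (metis vector_2(1))
  qed
  have deriv: "(?g has_field_derivative jac c c' (?q s) 1 1) (at s within ?tr ?W')" if s: "s \<in> ?tr ?W'" for s
  proof -
    have "((\<lambda>s. vector [s, 0] :: real^2) has_derivative (\<lambda>k. k *\<^sub>R axis 1 1)) (at s within ?tr ?W')"
      unfolding vector_2_eq_axis by (auto intro!: derivative_eq_intros)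
    moreover have d: "(?\<tau> has_derivative chart_differential c' (snd c) (?q s)) (at (vector [s, 0]) within ?W')"
      using transition_has_derivative[OF c q(1,2)[OF s]] unfolding q(3)[OF s] .
    then have "(?\<tau> has_derivative chart_differential c' (snd c) (?q s))
        (at (vector [s, 0]) within (\<lambda>s. vector [s, 0]) ` ?tr ?W')"
      by (rule has_derivative_subset) auto
    ultimately have "((\<lambda>s. ?\<tau> (vector [s, 0])) has_derivative (\<lambda>k. chart_differential c' (snd c) (?q s) (k *\<^sub>R axis 1 1)))
        (at s within ?tr ?W')"
      by (rule has_derivative_in_compose)
    from bounded_linear.has_derivative[OF bounded_linear_vec_nth this] show ?thesis
      using linear_scale[OF has_derivative_linear[OF d]]
      by (simp add: has_field_derivative_def mult.commute[of _ "chart_differential _ _ _ _ $ _"] fun_eq_iff mult_commute_abs)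
  qed
  have "integral (?tr (chart_image c)) (\<lambda>s. m c (chart_inv c (vector [s, 0]))) =
      integral (?g ` ?tr ?W') (\<lambda>s. m c (chart_inv c (vector [s, 0])))"
    unfolding image by (rule restrict[OF Int_lower1 m0(1)])
  also have "\<dots> = integral (?tr ?W') (\<lambda>s. \<bar>jac c c' (?q s) 1 1\<bar> * m c (chart_inv c (vector [?g s, 0])))"
  proof -
    have meas: "?tr ?W' \<in> sets lebesgue"
      by (rule lebesgue_openin[of UNIV]) (simp_all add: half_open_trace[OF half_open_overlap(1)[OF c]])
    have "(\<lambda>s. m c (chart_inv c (vector [s, 0]))) absolutely_integrable_on ?g ` ?tr ?W'"
      unfolding image by (rule abs_int[OF m c(1) K(1) _ m0(1)]) (use K(2) in auto)
    from conjunct2[OF has_absolute_integral_change_of_variables_1'[OF meas deriv inj, THEN iffD2,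
          OF _ conjI[OF this refl]]]
    show ?thesis by (rule sym)
  qed
  also have "\<dots> = integral (?tr ?W') (\<lambda>s. m c' (?q s))"
  proof (rule integral_cong)
    fix s assume s: "s \<in> ?tr ?W'"
    have "m c' (?q s) = jac c c' (?q s) 1 1 * m c (?q s)"
      by (rule boundary_densityD(2)[OF m c q(1,2,4)[OF s]])
    moreover have "chart_inv c (vector [?g s, 0]) = ?q s"
      unfolding q(5)[OF s, symmetric] unfolding comp_apply by (rule chart_inv_chart[OF c(1) q(1)[OF s]])
    ultimately show "\<bar>jac c c' (?q s) 1 1\<bar> * m c (chart_inv c (vector [?g s, 0])) = m c' (?q s)"
      using jac_boundary(2)[OF c q(1,2,4)[OF s]] by simp
  qed
  also have "\<dots> = integral (?tr (chart_image c')) (\<lambda>s. m c' (?q s))"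
    by (rule restrict[OF Int_lower2 m0(2), symmetric])
  finally show "integral (?tr (chart_image c)) (\<lambda>s. m c (chart_inv c (vector [s, 0]))) =
      integral (?tr (chart_image c')) (\<lambda>s. m c' (?q s))" .
qed

end

subsection \<open>Surface and boundary integrals in charts\<close>

context compact_surface
begin

lemma coord_deriv_chart_inv:
  "x \<in> chart_image c \<Longrightarrow> coord_deriv c i f (chart_inv c x) = pd (chart_image c) i (f \<circ> chart_inv c) x"
  by (simp only: coord_deriv_eq_pd chart_chart_inv)

lemma smooth_map_chart: "smooth_map A f \<Longrightarrow> c \<in> A \<Longrightarrow> smooth_on (chart_image c) (f \<circ> chart_inv c)"
  unfolding smooth_map_def by (rule bspec)

lemma continuous_on_coord_deriv:
  assumes "smooth_map A f" "c \<in> A"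
  shows "continuous_on (chart_image c) (\<lambda>x. coord_deriv c i f (chart_inv c x))"
proof -
  have "continuous_on (chart_image c) (pd (chart_image c) i (f \<circ> chart_inv c))"
    by (rule smooth_on_imp_continuous_on[OF smooth_on_pd[OF half_open_chart[OF assms(2)] smooth_map_chart[OF assms]]])
  then show ?thesis
    by (rule continuous_on_eq) (simp only: coord_deriv_chart_inv)
qed

lemma coord_deriv_eqI:
  assumes "c \<in> A" "p \<in> fst c" "((f \<circ> chart_inv c) has_derivative f') (at (snd c p) within chart_image c)"
  shows "coord_deriv c i f p = f' (axis i 1)"
  unfolding coord_deriv_eq_pd by (rule pd_eqI[OF half_open_chart[OF assms(1)] _ assms(3)]) (use assms(2) in simp)

lemma chart_has_derivative:
  assumes "smooth_map A f" "c \<in> A" "p \<in> fst c"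
  shows "((f \<circ> chart_inv c) has_derivative chart_differential c f p) (at (snd c p) within chart_image c)"
  unfolding chart_differential_def
  by (rule smooth_on_has_derivative[OF smooth_map_chart[OF assms(1,2)]]) (use assms(3) in simp)

lemma coord_deriv_eq_0:
  assumes c: "c \<in> A" "p \<in> fst c" and K: "closedin X K" "p \<notin> K"
    and f: "\<And>q. q \<in> fst c \<Longrightarrow> q \<notin> K \<Longrightarrow> f q = (0 :: 'b::real_normed_vector)"
  shows "coord_deriv c i f p = 0"
proof -
  let ?T = "snd c ` (fst c - K)"
  have T: "openin (top_of_set (chart_image c)) ?T"
    by (rule openin_chart_image(2)[OF c(1)]) (use openin_dom[OF c(1)] K(1) in \<open>auto intro: openin_diff\<close>)
  have pT: "snd c p \<in> ?T" using c K by auto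
  have "((\<lambda>x. 0) has_derivative (\<lambda>v. 0 :: 'b)) (at (snd c p) within ?T)" by simp
  then have "((f \<circ> chart_inv c) has_derivative (\<lambda>v. 0)) (at (snd c p) within ?T)"
    by (rule has_derivative_transform[OF pT, rotated]) (auto simp: chart_inv_chart[OF c(1)] f)
  then have "((f \<circ> chart_inv c) has_derivative (\<lambda>v. 0)) (at (snd c p) within chart_image c)"
    using at_within_openin[OF T pT] by simp
  from coord_deriv_eqI[OF c this] show ?thesis .
qed

lemma coord_deriv_add:
  assumes "smooth_map A f" "smooth_map A g" "c \<in> A" "p \<in> fst c"
  shows "coord_deriv c i (\<lambda>p. f p + g p) p = coord_deriv c i f p + coord_deriv c i g p"
proof -
  have "(\<lambda>p. f p + g p) \<circ> chart_inv c = (\<lambda>x. (f \<circ> chart_inv c) x + (g \<circ> chart_inv c) x)" by (simp add: fun_eq_iff)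
  then show ?thesis
    using has_derivative_add[OF chart_has_derivative[OF assms(1,3,4)] chart_has_derivative[OF assms(2-4)]]
    by (subst coord_deriv_eqI[OF assms(3,4)]) (simp_all add: coord_deriv_def)
qed

lemma coord_deriv_scaleR:
  assumes "smooth_map A f" "c \<in> A" "p \<in> fst c"
  shows "coord_deriv c i (\<lambda>p. t *\<^sub>R f p) p = t *\<^sub>R coord_deriv c i f p"
proof -
  have "(\<lambda>p. t *\<^sub>R f p) \<circ> chart_inv c = (\<lambda>x. t *\<^sub>R (f \<circ> chart_inv c) x)" by (simp add: fun_eq_iff)
  then show ?thesis
    using has_derivative_scaleR_right[OF chart_has_derivative[OF assms]]
    by (subst coord_deriv_eqI[OF assms(2,3)]) (simp_all add: coord_deriv_def)
qed

text \<open>On the chart image the partition functions add up to the constant 1, and the derivative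
  within the image is unique.\<close>

lemma coord_deriv_sum_partition:
  assumes P: "partition_of_unity X A C \<rho>" and c: "c \<in> A" "p \<in> fst c"
  shows "(\<Sum>d\<in>C. coord_deriv c i (\<rho> d) p) = 0"
proof -
  note PF = partition_facts[OF P]
  have "((\<lambda>x. \<Sum>d\<in>C. (\<rho> d \<circ> chart_inv c) x) has_derivative (\<lambda>v. \<Sum>d\<in>C. chart_differential c (\<rho> d) p v))
      (at (snd c p) within chart_image c)"
    by (rule has_derivative_sum) (rule chart_has_derivative[OF PF(3) c])
  then have "((\<lambda>x. 1) has_derivative (\<lambda>v. \<Sum>d\<in>C. chart_differential c (\<rho> d) p v))
      (at (snd c p) within chart_image c)"
  proof (rule has_derivative_transform[rotated 2])
    fix x assume "x \<in> chart_image c"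
    then have "chart_inv c x \<in> topspace X" by (intro subsetD[OF dom_subset[OF c(1)]] chart_inv_in)
    then show "1 = (\<Sum>d\<in>C. (\<rho> d \<circ> chart_inv c) x)" by (simp add: PF(4))
  qed (use c(2) in simp)
  from frechet_within_eq[OF half_open_chart[OF c(1)] _ this]
    frechet_within_eq[OF half_open_chart[OF c(1)] _ has_derivative_const[of "1::real"]] c(2)
  have "(\<lambda>v. \<Sum>d\<in>C. chart_differential c (\<rho> d) p v) = (\<lambda>v. 0)" by simp
  from fun_cong[OF this, of "axis i 1"] show ?thesis by (simp add: coord_deriv_def)
qed

lemma smooth_map_add: "smooth_map A f \<Longrightarrow> smooth_map A g \<Longrightarrow> smooth_map A (\<lambda>p. f p + g p)"
  unfolding smooth_map_def comp_def by (intro ballI smooth_on_add) (rule bspec, assumption+)+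

lemma smooth_map_scaleR: "smooth_map A f \<Longrightarrow> smooth_map A (\<lambda>p. t *\<^sub>R f p)"
  unfolding smooth_map_def comp_def by (intro ballI smooth_on_scaleR smooth_on_const) (rule bspec, assumption+)

text \<open>The positive determinant relating two cross products cancels under normalization. Where
  the cross product is zero, all candidates are 0; thus the lemma covers \<open>R + t V\<close> for
  every \<open>t\<close>, also where this map fails to be an immersion.\<close>

lemma unit_normal_eq:
  assumes r: "smooth_map A r" and c: "c \<in> A" "p \<in> fst c"
  shows "unit_normal A r p = chart_normal c r p"
  unfolding unit_normal_def
proof (rule the_equality)
  fix n assume "\<exists>c'\<in>A. p \<in> fst c' \<and> n = chart_normal c' r p"
  then obtain c' where c': "c' \<in> A" "p \<in> fst c'" "n = chart_normal c' r p" by blast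
  have "det (matrix (chart_differential c' (snd c) p)) > 0"
    by (rule transition_det[OF c(1) c'(1) c(2) c'(2)])
  then show "n = chart_normal c r p"
    unfolding c'(3) chart_normal_def cross3_coord_deriv[OF c(1) c'(1) c(2) c'(2) r]
    by simp
qed (use c in blast)

text \<open>By \<open>partition_independent\<close> the description is resolved by the partition at
  hand. Continuity is asked of the density \<open>m\<close>, that is, of \<open>f\<close> together
  with the area factor.\<close>

lemma surface_integral_eq:
  assumes m: "surface_density m" and P: "partition_of_unity X A C \<rho>"
    and f: "\<And>c p. c \<in> A \<Longrightarrow> p \<in> fst c \<Longrightarrow>
      f p * norm (cross3 (coord_deriv c 1 r p) (coord_deriv c 2 r p)) = m c p"
  shows "surface_integral X A r f =
    (\<Sum>c\<in>C. integral (chart_image c) (\<lambda>x. \<rho> c (chart_inv c x) * m c (chart_inv c x)))"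
proof -
  let ?J = "\<lambda>C \<rho>. \<Sum>c\<in>C. integral (chart_image c) (\<lambda>x. let p = chart_inv c x in
      \<rho> c p * f p * norm (cross3 (coord_deriv c 1 r p) (coord_deriv c 2 r p)))"
  have eq: "?J C \<rho> = (\<Sum>c\<in>C. integral (chart_image c) (\<lambda>x. \<rho> c (chart_inv c x) * m c (chart_inv c x)))"
    if "partition_of_unity X A C \<rho>" for C \<rho>
  proof (intro sum.cong refl integral_cong)
    fix c x assume c: "c \<in> C" and x: "x \<in> chart_image c"
    from f[OF subsetD[OF partition_facts(2)[OF that] c] chart_inv_in[OF x]] show "(let p = chart_inv c x in
        \<rho> c p * f p * norm (cross3 (coord_deriv c 1 r p) (coord_deriv c 2 r p))) = \<rho> c (chart_inv c x) * m c (chart_inv c x)"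
      by (simp add: Let_def mult.assoc)
  qed
  show ?thesis
    unfolding surface_integral_def eq[OF P, symmetric]
  proof (rule the_equality)
    fix I assume "\<exists>C \<rho>. partition_of_unity X A C \<rho> \<and> I = ?J C \<rho>"
    then obtain D \<sigma> where Q: "partition_of_unity X A D \<sigma>" "I = ?J D \<sigma>" by (elim exE conjE)
    show "I = ?J C \<rho>"
      unfolding Q(2) eq[OF P] eq[OF Q(1)]
      by (rule chart_integral.partition_independent[OF area_chart_integral m Q(1) P])
  qed (rule exI[of _ C], rule exI[of _ "\<rho>"], intro conjI P refl)
qed

lemma boundary_integral_eq:
  assumes m: "boundary_density m" and P: "partition_of_unity X A C \<rho>"
    and g: "\<And>c p. c \<in> A \<Longrightarrow> p \<in> fst c \<Longrightarrow> snd c p $ 2 = 0 \<Longrightarrow> g p * norm (coord_deriv c 1 r p) = m c p"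
  shows "boundary_integral X A r g =
    (\<Sum>c\<in>C. integral {s. vector [s, 0] \<in> chart_image c}
      (\<lambda>s. \<rho> c (chart_inv c (vector [s, 0])) * m c (chart_inv c (vector [s, 0]))))"
proof -
  let ?J = "\<lambda>C \<rho>. \<Sum>c\<in>C. integral {s. vector [s, 0] \<in> chart_image c}
      (\<lambda>s. let p = chart_inv c (vector [s, 0]) in \<rho> c p * g p * norm (coord_deriv c 1 r p))"
  have eq: "?J C \<rho> = (\<Sum>c\<in>C. integral {s. vector [s, 0] \<in> chart_image c}
      (\<lambda>s. \<rho> c (chart_inv c (vector [s, 0])) * m c (chart_inv c (vector [s, 0]))))"
    if "partition_of_unity X A C \<rho>" for C \<rho>
  proof (intro sum.cong refl integral_cong)
    fix c s assume "c \<in> C" "s \<in> {s. vector [s, 0] \<in> chart_image c}"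
    then have c: "c \<in> A" and x: "vector [s, 0] \<in> chart_image c" using partition_facts(2)[OF that] by auto
    have "snd c (chart_inv c (vector [s, 0])) $ 2 = 0" unfolding chart_chart_inv[OF x] by simp
    from g[OF c chart_inv_in[OF x] this] show "(let p = chart_inv c (vector [s, 0]) in
        \<rho> c p * g p * norm (coord_deriv c 1 r p)) = \<rho> c (chart_inv c (vector [s, 0])) * m c (chart_inv c (vector [s, 0]))"
      by (simp add: Let_def mult.assoc)
  qed
  show ?thesis
    unfolding boundary_integral_def eq[OF P, symmetric]
  proof (rule the_equality)
    fix I assume "\<exists>C \<rho>. partition_of_unity X A C \<rho> \<and> I = ?J C \<rho>"
    then obtain D \<sigma> where Q: "partition_of_unity X A D \<sigma>" "I = ?J D \<sigma>" by (elim exE conjE)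
    show "I = ?J C \<rho>"
      unfolding Q(2) eq[OF P] eq[OF Q(1)]
      by (rule chart_integral.partition_independent[OF line_chart_integral m Q(1) P])
  qed (rule exI[of _ C], rule exI[of _ "\<rho>"], intro conjI P refl)
qed

subsection \<open>The densities of the volume form\<close>

text \<open>In the notation of differential forms, \<open>triple_density a r s\<close> is \<open>a \<bullet> (dr \<and> ds)\<close> and
  \<open>wedge_density f a r\<close> is \<open>df \<and> (a \<bullet> dr)\<close>.\<close>

definition triple_density :: "('a \<Rightarrow> real^3) \<Rightarrow> ('a \<Rightarrow> real^3) \<Rightarrow> ('a \<Rightarrow> real^3) \<Rightarrow> 'a chart \<Rightarrow> 'a \<Rightarrow> real" where
  "triple_density a r s c p = a p \<bullet>
     (cross3 (coord_deriv c 1 r p) (coord_deriv c 2 s p) - cross3 (coord_deriv c 2 r p) (coord_deriv c 1 s p))"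

definition wedge_density :: "('a \<Rightarrow> real) \<Rightarrow> ('a \<Rightarrow> real^3) \<Rightarrow> ('a \<Rightarrow> real^3) \<Rightarrow> 'a chart \<Rightarrow> 'a \<Rightarrow> real" where
  "wedge_density f a r c p =
     coord_deriv c 1 f p * (a p \<bullet> coord_deriv c 2 r p) - coord_deriv c 2 f p * (a p \<bullet> coord_deriv c 1 r p)"

text \<open>Antisymmetrizing over the coordinate indices is what lets the determinant factor out
  when \<open>r\<close> and \<open>s\<close> differ; for \<open>r = s\<close> the two terms are
  equal and give twice the ordinary triple product.\<close>

lemma surface_density_triple:
  assumes "smooth_map A a" "smooth_map A r" "smooth_map A s"
  shows "surface_density (triple_density a r s)"
proof (rule surface_densityI)
  show "continuous_on (chart_image c) (\<lambda>x. triple_density a r s c (chart_inv c x))" if "c \<in> A" for c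
    unfolding triple_density_def
    by (intro continuous_intros continuous_on_cross smooth_map_continuous_on continuous_on_coord_deriv assms that)
  show "triple_density a r s c' p = det (matrix (chart_differential c' (snd c) p)) * triple_density a r s c p"
    if "c \<in> A" "c' \<in> A" "p \<in> fst c" "p \<in> fst c'" for c c' p
    unfolding triple_density_def jac_det coord_deriv_chain[OF that assms(2)] coord_deriv_chain[OF that assms(3)]
    by (simp add: cross_add_left cross_add_right cross_mult_left cross_mult_right inner_add_right inner_diff_right)
      (simp add: algebra_simps)
qed

lemma surface_density_wedge:
  assumes "smooth_map A f" "smooth_map A r"
    and a: "\<And>c. c \<in> A \<Longrightarrow> continuous_on (chart_image c) (\<lambda>x. a (chart_inv c x))"
  shows "surface_density (wedge_density f a r)"
proof (rule surface_densityI)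
  show "continuous_on (chart_image c) (\<lambda>x. wedge_density f a r c (chart_inv c x))" if "c \<in> A" for c
    unfolding wedge_density_def
    by (intro continuous_intros a continuous_on_coord_deriv assms that)
  show "wedge_density f a r c' p = det (matrix (chart_differential c' (snd c) p)) * wedge_density f a r c p"
    if "c \<in> A" "c' \<in> A" "p \<in> fst c" "p \<in> fst c'" for c c' p
    unfolding wedge_density_def jac_det coord_deriv_chain[OF that assms(1)] coord_deriv_chain[OF that assms(2)]
    by (simp add: inner_add_right) (simp add: algebra_simps)
qed

text \<open>At the boundary \<open>jac c c' p 1 2 = 0\<close>, so the derivative along the first
  coordinate acquires only the factor \<open>jac c c' p 1 1\<close>.\<close>

lemma boundary_density_tangential:
  assumes "smooth_map A r"
    and a: "\<And>c. c \<in> A \<Longrightarrow> continuous_on (chart_image c) (\<lambda>x. a (chart_inv c x))"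
  shows "boundary_density (\<lambda>c p. a p \<bullet> coord_deriv c 1 r p)"
proof (rule boundary_densityI)
  show "continuous_on {s. vector [s, 0] \<in> chart_image c}
      (\<lambda>s. a (chart_inv c (vector [s, 0])) \<bullet> coord_deriv c 1 r (chart_inv c (vector [s, 0])))" if "c \<in> A" for c
    by (rule continuous_on_trace, intro continuous_intros a continuous_on_coord_deriv assms that)
  show "a p \<bullet> coord_deriv c' 1 r p = jac c c' p 1 1 * (a p \<bullet> coord_deriv c 1 r p)"
    if "c \<in> A" "c' \<in> A" "p \<in> fst c" "p \<in> fst c'" "snd c' p $ 2 = 0" for c c' p
    unfolding coord_deriv_chain[OF that(1-4) assms(1)] using jac_boundary(1)[OF that] by simp
qed

text \<open>The pointwise form of d(f \<omega>) = df \<and> \<omega> + f d\<omega>. The terms with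
  the mixed derivative \<open>R12\<close> cancel, and d\<omega> appears as a difference of two
  triple densities.\<close>

lemma stokes_integrand_identity:
  fixes R R1 R2 R12 V V1 V2 :: "real^3" and f f1 f2 :: real
  shows "(f * (cross3 R V \<bullet> R12 + (cross3 R V1 + cross3 R1 V) \<bullet> R2) + f1 * (cross3 R V \<bullet> R2))
      + - (f * (cross3 R V \<bullet> R12 + (cross3 R V2 + cross3 R2 V) \<bullet> R1) + f2 * (cross3 R V \<bullet> R1)) =
    (f1 * (cross3 R V \<bullet> R2) - f2 * (cross3 R V \<bullet> R1)) +
    f * (R \<bullet> (cross3 V1 R2 - cross3 V2 R1) - V \<bullet> (cross3 R1 R2 - cross3 R2 R1))"
  by (simp add: cross3_simps)

text \<open>The divergence theorem for the components f \<omega>_2 and - f \<omega>_1; the sign of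
  the second cancels the minus sign of \<open>half_plane_divergence\<close>, so the boundary line is
  traversed in the direction of the first coordinate.\<close>

lemma chart_stokes:
  assumes c: "c \<in> A" and f: "smooth_map A f" and R: "smooth_map A R" and V: "smooth_map A V"
    and K: "closedin X K" "K \<subseteq> fst c" and f0: "\<And>p. p \<in> fst c \<Longrightarrow> p \<notin> K \<Longrightarrow> f p = 0"
  shows "integral (chart_image c) (\<lambda>x. wedge_density f (\<lambda>p. cross3 (R p) (V p)) R c (chart_inv c x) +
      f (chart_inv c x) * (triple_density R V R c (chart_inv c x) - triple_density V R R c (chart_inv c x))) =
    integral {s. vector [s, 0] \<in> chart_image c} (\<lambda>s. f (chart_inv c (vector [s, 0])) *
      (cross3 (R (chart_inv c (vector [s, 0]))) (V (chart_inv c (vector [s, 0]))) \<bullet>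
        coord_deriv c 1 R (chart_inv c (vector [s, 0]))))"
proof -
  let ?U = "chart_image c"
  define f' R' V' where "f' = f \<circ> chart_inv c" and "R' = R \<circ> chart_inv c" and "V' = V \<circ> chart_inv c"
  define R1 R2 where "R1 = pd ?U 1 R'" and "R2 = pd ?U 2 R'"
  note U = half_open_chart[OF c]
  have sm: "smooth_on ?U f'" "smooth_on ?U R'" "smooth_on ?U V'"
    unfolding f'_def R'_def V'_def by (rule smooth_map_chart[OF _ c], fact)+
  have sm12: "smooth_on ?U R1" "smooth_on ?U R2"
    unfolding R1_def R2_def by (rule smooth_on_pd[OF U sm(2)])+
  let ?D = "\<lambda>g x v. frechet_derivative g (at x within ?U) v"
  have der_cross: "((\<lambda>x. cross3 (R' x) (V' x)) has_derivative
      (\<lambda>v. cross3 (R' x) (?D V' x v) + cross3 (?D R' x v) (V' x))) (at x within ?U)" if "x \<in> ?U" for x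
    using bilinear_conv_bounded_bilinear[THEN iffD1, OF bilinear_cross]
      smooth_on_has_derivative[OF sm(2) that] smooth_on_has_derivative[OF sm(3) that]
    by (rule bounded_bilinear.FDERIV)
  have der: "((\<lambda>x. f' x * (cross3 (R' x) (V' x) \<bullet> S x)) has_derivative
      (\<lambda>v. f' x * (cross3 (R' x) (V' x) \<bullet> ?D S x v +
        (cross3 (R' x) (?D V' x v) + cross3 (?D R' x v) (V' x)) \<bullet> S x) +
        ?D f' x v * (cross3 (R' x) (V' x) \<bullet> S x))) (at x within ?U)"
    if "x \<in> ?U" "smooth_on ?U S" for x S
    by (rule has_derivative_mult[OF smooth_on_has_derivative[OF sm(1) that(1)]
          has_derivative_inner[OF der_cross[OF that(1)] smooth_on_has_derivative[OF that(2,1)]]])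
  have cont_pd: "continuous_on ?U (pd ?U i g)" if "smooth_on ?U g" for i and g :: "real^2 \<Rightarrow> 'z::real_normed_vector"
    by (rule smooth_on_imp_continuous_on[OF smooth_on_pd[OF U that]])
  have cont: "continuous_on ?U (\<lambda>x. f' x * (cross3 (R' x) (V' x) \<bullet> ?D S x (axis i 1) +
        (cross3 (R' x) (?D V' x (axis i 1)) + cross3 (?D R' x (axis i 1)) (V' x)) \<bullet> S x) +
        ?D f' x (axis i 1) * (cross3 (R' x) (V' x) \<bullet> S x))"
    if "smooth_on ?U S" for S i
    unfolding pd_def[symmetric]
    by (intro continuous_intros continuous_on_cross cont_pd smooth_on_imp_continuous_on sm that)
  have van: "f' x = 0" if "x \<in> ?U" "x \<notin> snd c ` K" for x
  proof -
    have "chart_inv c x \<notin> K"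
      using that(2) imageI[of "chart_inv c x" K "snd c"] unfolding chart_chart_inv[OF that(1)] by blast
    then show ?thesis using f0[OF chart_inv_in[OF that(1)]] by (simp add: f'_def)
  qed
  have "integral ?U (\<lambda>x. (f' x * (cross3 (R' x) (V' x) \<bullet> ?D R2 x (axis 1 1) +
        (cross3 (R' x) (?D V' x (axis 1 1)) + cross3 (?D R' x (axis 1 1)) (V' x)) \<bullet> R2 x) +
        ?D f' x (axis 1 1) * (cross3 (R' x) (V' x) \<bullet> R2 x)) +
      - (f' x * (cross3 (R' x) (V' x) \<bullet> ?D R1 x (axis 2 1) +
        (cross3 (R' x) (?D V' x (axis 2 1)) + cross3 (?D R' x (axis 2 1)) (V' x)) \<bullet> R1 x) +
        ?D f' x (axis 2 1) * (cross3 (R' x) (V' x) \<bullet> R1 x))) =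
      - integral {s. vector [s, 0] \<in> ?U} (\<lambda>s. - (f' (vector [s, 0]) *
          (cross3 (R' (vector [s, 0])) (V' (vector [s, 0])) \<bullet> R1 (vector [s, 0]))))"
    by (rule half_plane_divergence[OF U _ _ _ _ der[OF _ sm12(2)] has_derivative_minus[OF der[OF _ sm12(1)]]
          cont[OF sm12(2)] continuous_on_minus[OF cont[OF sm12(1)]], where K = "snd c ` K"])
      (use compact_chart_image[OF c K(2)] K van in auto)
  also have "\<dots> = integral {s. vector [s, 0] \<in> ?U} (\<lambda>s. f' (vector [s, 0]) *
          (cross3 (R' (vector [s, 0])) (V' (vector [s, 0])) \<bullet> R1 (vector [s, 0])))"
    by simp
  also have "\<dots> = integral {s. vector [s, 0] \<in> ?U} (\<lambda>s. f (chart_inv c (vector [s, 0])) *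
      (cross3 (R (chart_inv c (vector [s, 0]))) (V (chart_inv c (vector [s, 0]))) \<bullet>
        coord_deriv c 1 R (chart_inv c (vector [s, 0]))))"
    by (rule integral_cong) (simp add: coord_deriv_chart_inv f'_def R'_def V'_def R1_def)
  also have "integral ?U (\<lambda>x. (f' x * (cross3 (R' x) (V' x) \<bullet> ?D R2 x (axis 1 1) +
        (cross3 (R' x) (?D V' x (axis 1 1)) + cross3 (?D R' x (axis 1 1)) (V' x)) \<bullet> R2 x) +
        ?D f' x (axis 1 1) * (cross3 (R' x) (V' x) \<bullet> R2 x)) +
      - (f' x * (cross3 (R' x) (V' x) \<bullet> ?D R1 x (axis 2 1) +
        (cross3 (R' x) (?D V' x (axis 2 1)) + cross3 (?D R' x (axis 2 1)) (V' x)) \<bullet> R1 x) +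
        ?D f' x (axis 2 1) * (cross3 (R' x) (V' x) \<bullet> R1 x))) =
    integral ?U (\<lambda>x. wedge_density f (\<lambda>p. cross3 (R p) (V p)) R c (chart_inv c x) +
      f (chart_inv c x) * (triple_density R V R c (chart_inv c x) - triple_density V R R c (chart_inv c x)))"
  proof (rule integral_cong)
    fix x assume x: "x \<in> ?U"
    \<comment> \<open>This settles the only second derivatives in the integrand; what remains is
      vector algebra at a single point.\<close>
    have comm: "pd ?U 2 R1 x = pd ?U 1 R2 x"
      unfolding R1_def R2_def by (rule pd_commute[OF U sm(2) x])
    have vals: "f (chart_inv c x) = f' x" "R (chart_inv c x) = R' x" "V (chart_inv c x) = V' x"
      by (simp_all add: f'_def R'_def V'_def)
    show "(f' x * (cross3 (R' x) (V' x) \<bullet> ?D R2 x (axis 1 1) +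
        (cross3 (R' x) (?D V' x (axis 1 1)) + cross3 (?D R' x (axis 1 1)) (V' x)) \<bullet> R2 x) +
        ?D f' x (axis 1 1) * (cross3 (R' x) (V' x) \<bullet> R2 x)) +
      - (f' x * (cross3 (R' x) (V' x) \<bullet> ?D R1 x (axis 2 1) +
        (cross3 (R' x) (?D V' x (axis 2 1)) + cross3 (?D R' x (axis 2 1)) (V' x)) \<bullet> R1 x) +
        ?D f' x (axis 2 1) * (cross3 (R' x) (V' x) \<bullet> R1 x)) =
      wedge_density f (\<lambda>p. cross3 (R p) (V p)) R c (chart_inv c x) +
      f (chart_inv c x) * (triple_density R V R c (chart_inv c x) - triple_density V R R c (chart_inv c x))"
      unfolding pd_def[symmetric] comm wedge_density_def triple_density_def coord_deriv_chart_inv[OF x] vals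
        f'_def[symmetric] R'_def[symmetric] V'_def[symmetric] R1_def[symmetric] R2_def[symmetric]
      by (rule stokes_integrand_identity)
  qed
  finally show ?thesis .
qed

end

subsection \<open>The conormal\<close>

lemma cross3_cross3_right:
  fixes x y z :: "real^3"
  shows "cross3 x (cross3 y z) = (x \<bullet> z) *\<^sub>R y - (x \<bullet> y) *\<^sub>R z"
  by (simp add: cross3_simps forall_3)

lemma inner_cross3_antisym: "x \<bullet> (cross3 a b - cross3 b a) = 2 * (x \<bullet> cross3 a b)"
  unfolding inner_diff_right cross_skew[of b a] inner_minus_right by simp

lemma inner_normalized_times_norm:
  fixes x n :: "'a::real_inner"
  shows "x \<bullet> (n /\<^sub>R norm n) * norm n = x \<bullet> n"
  by (cases "n = 0") simp_all

lemma norm_cross3_orthogonal: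
  fixes x y :: "real^3"
  assumes "x \<bullet> y = 0"
  shows "norm (cross3 x y) = norm x * norm y"
proof -
  have "(norm (cross3 x y))\<^sup>2 = (norm x * norm y)\<^sup>2"
    using norm_cross_dot[of x y] assms by simp
  then show ?thesis by simp
qed

text \<open>In the span of \<open>a\<close> and \<open>b\<close>, orthogonality to \<open>a\<close>
  puts \<open>w\<close> on the line of a \<times> (a \<times> b) = (a \<bullet> b) a - (a \<bullet>
  a) b. The sign of \<open>\<beta>\<close> selects the direction, the unit norm the length.\<close>

lemma conormal_unique:
  fixes a b w :: "real^3"
  assumes n: "cross3 a b \<noteq> 0" and w: "w = \<alpha> *\<^sub>R a + \<beta> *\<^sub>R b" "\<beta> < 0" "w \<bullet> a = 0" "norm w = 1"
  shows "norm a *\<^sub>R w = cross3 a (cross3 a b /\<^sub>R norm (cross3 a b))"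
proof -
  let ?n = "cross3 a b"
  have a: "a \<noteq> 0" using n by auto
  have "\<alpha> * (a \<bullet> a) + \<beta> * (a \<bullet> b) = 0"
    using w(3) unfolding w(1) by (simp add: inner_add_left inner_commute[of b a])
  then have \<alpha>: "\<alpha> * (a \<bullet> a) = - \<beta> * (a \<bullet> b)" by simp
  have "(a \<bullet> a) *\<^sub>R w = (\<alpha> * (a \<bullet> a)) *\<^sub>R a + (\<beta> * (a \<bullet> a)) *\<^sub>R b"
    unfolding w(1) by (simp add: scaleR_add_right mult.commute)
  also have "\<dots> = (- \<beta>) *\<^sub>R ((a \<bullet> b) *\<^sub>R a - (a \<bullet> a) *\<^sub>R b)"
    unfolding \<alpha> by (simp add: scaleR_diff_right)
  finally have aw: "(a \<bullet> a) *\<^sub>R w = (- \<beta>) *\<^sub>R cross3 a ?n"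
    unfolding cross3_cross3_right .
  then have "norm ((a \<bullet> a) *\<^sub>R w) = norm ((- \<beta>) *\<^sub>R cross3 a ?n)" by simp
  then have "a \<bullet> a = (- \<beta>) * (norm a * norm ?n)"
    using w(2,4) norm_cross3_orthogonal[of a ?n] dot_cross_self(1)[of a b] by simp
  moreover have aa: "a \<bullet> a = norm a * norm a"
    by (simp add: power2_norm_eq_inner[symmetric] power2_eq_square)
  ultimately have "norm a * norm a = norm a * ((- \<beta>) * norm ?n)"
    by (simp only: mult.left_commute)
  then have \<beta>: "norm a = (- \<beta>) * norm ?n"
    by (rule iffD1[OF mult_left_cancel, rotated]) (use a in simp)
  have "(norm a * norm a) *\<^sub>R w = (norm a / norm ?n) *\<^sub>R cross3 a ?n"
    using aw n unfolding aa \<beta> by simp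
  then have "norm a *\<^sub>R (norm a *\<^sub>R w) = norm a *\<^sub>R (inverse (norm ?n) *\<^sub>R cross3 a ?n)"
    by (simp add: divide_inverse)
  then have "norm a *\<^sub>R w = inverse (norm ?n) *\<^sub>R cross3 a ?n"
    by (rule scaleR_left_imp_eq[rotated]) (use a in simp)
  then show ?thesis by (simp add: cross_mult_right)
qed

text \<open>Both \<open>\<eta>\<close> and \<open>a\<close> are orthogonal to \<open>N\<close>, so
  \<open>cross3 \<eta> a\<close> is a multiple of \<open>N\<close>, and pairing it with
  \<open>R\<close> involves only \<open>R \<bullet> N\<close>.\<close>

lemma conormal_flux:
  fixes R \<eta> N a V :: "real^3"
  assumes "N \<bullet> N = 1" "\<eta> \<bullet> N = 0" "a \<bullet> N = 0" "V = \<eta> + v *\<^sub>R N"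
  shows "((R \<bullet> N) *\<^sub>R \<eta> - v *\<^sub>R R) \<bullet> cross3 a N = cross3 R V \<bullet> a"
proof -
  \<comment> \<open>The triple product rule gives zero; a second product with the unit vector
    \<open>N\<close> then exhibits \<open>cross3 \<eta> a\<close> as its own projection onto
    \<open>N\<close>.\<close>
  have "cross3 N (cross3 \<eta> a) = 0"
    unfolding cross3_cross3_right using assms(2,3) by (simp add: inner_commute)
  then have "cross3 N (cross3 N (cross3 \<eta> a)) = 0" by simp
  then have x: "cross3 \<eta> a = (N \<bullet> cross3 \<eta> a) *\<^sub>R N"
    unfolding cross3_cross3_right[of N N] using assms(1) by simp
  have "((R \<bullet> N) *\<^sub>R \<eta> - v *\<^sub>R R) \<bullet> cross3 a N = (R \<bullet> N) * (\<eta> \<bullet> cross3 a N) - v * (R \<bullet> cross3 a N)"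
    by (simp add: inner_diff_left)
  also have "\<eta> \<bullet> cross3 a N = N \<bullet> cross3 \<eta> a"
    by (simp add: cross3_simps)
  also have "(R \<bullet> N) * (N \<bullet> cross3 \<eta> a) = R \<bullet> ((N \<bullet> cross3 \<eta> a) *\<^sub>R N)" by simp
  also have "\<dots> = R \<bullet> cross3 \<eta> a" using x by simp
  also have "R \<bullet> cross3 \<eta> a - v * (R \<bullet> cross3 a N) = cross3 R V \<bullet> a"
    unfolding assms(4) by (simp add: cross3_simps)
  finally show ?thesis .
qed

context compact_surface
begin

text \<open>If a \<times> b = 0, then (a \<bullet> b) a - (a \<bullet> a) b = 0 exhibits an element
  of the kernel of the differential. Injectivity forces a = 0, and then \<open>axis 1 1\<close> lies
  in the kernel.\<close>

lemma immersion_cross3_nonzero: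
  assumes R: "smooth_immersion A R" and c: "c \<in> A" "p \<in> fst c"
  shows "cross3 (coord_deriv c 1 R p) (coord_deriv c 2 R p) \<noteq> 0"
proof
  let ?a = "coord_deriv c 1 R p" and ?b = "coord_deriv c 2 R p"
  assume n0: "cross3 ?a ?b = 0"
  have sR: "smooth_map A R" and inj: "inj (chart_differential c R p)"
    using R c unfolding smooth_immersion_def by auto
  note d = chart_differential_eq_coord_deriv[OF c smooth_map_chart[OF sR c(1)]]
  have inj0: "v = 0" if "chart_differential c R p v = 0" for v
    using injD[OF inj, of v 0] that by (simp add: d)
  have "cross3 ?a (cross3 ?a ?b) = 0" unfolding n0 by simp
  then have "chart_differential c R p (vector [?a \<bullet> ?b, - (?a \<bullet> ?a)]) = 0"
    unfolding d cross3_cross3_right by simp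
  from inj0[OF this] have "?a = 0"
    by (simp add: vec_eq_iff forall_2)
  then have "chart_differential c R p (axis 1 1) = 0" by (simp add: coord_deriv_def)
  from inj0[OF this] show False by simp
qed

text \<open>A candidate from another chart is rewritten in chart \<open>c\<close>: by
  \<open>jac_boundary\<close> the boundary direction and the sign of the second component are
  preserved, so \<open>conormal_unique\<close> applies. The factor \<open>norm\<close> stays because
  it is the line element of the boundary integral.\<close>

lemma outward_conormal_eq:
  assumes R: "smooth_immersion A R" and c: "c \<in> A" "p \<in> fst c" and p0: "snd c p $ 2 = 0"
  shows "norm (coord_deriv c 1 R p) *\<^sub>R outward_conormal A R p =
    cross3 (coord_deriv c 1 R p) (chart_normal c R p)"
proof -
  let ?a = "coord_deriv c 1 R p" and ?b = "coord_deriv c 2 R p" and ?N = "chart_normal c R p"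
  let ?Q = "\<lambda>c w. w \<in> chart_differential c R p ` {v. v $ 2 < 0} \<and> w \<bullet> coord_deriv c 1 R p = 0 \<and> norm w = 1"
  have sR: "smooth_map A R" using R by (simp add: smooth_immersion_def)
  have n: "cross3 ?a ?b \<noteq> 0" by (rule immersion_cross3_nonzero[OF R c])
  then have a: "?a \<noteq> 0" by auto
  note d = chart_differential_eq_coord_deriv[OF c smooth_map_chart[OF sR c(1)]]
  define w0 where "w0 = cross3 ?a ?N /\<^sub>R norm ?a"
  have normN: "norm ?N = 1" using n by (simp add: chart_normal_def)
  have aN: "?a \<bullet> ?N = 0" by (simp add: chart_normal_def dot_cross_self)
  have Q0: "?Q c w0"
  proof (intro conjI)
    \<comment> \<open>The vector a \<times> (a \<times> b) has the coordinates a \<bullet> b and -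
      (a \<bullet> a) in the basis a, b, and \<open>?k\<close> normalizes it; the negative second
      coordinate makes it point outward.\<close>
    let ?k = "inverse (norm ?a * norm (cross3 ?a ?b))"
    have "w0 = ?k *\<^sub>R cross3 ?a (cross3 ?a ?b)"
      by (simp add: w0_def chart_normal_def cross_mult_right)
    also have "\<dots> = chart_differential c R p (vector [?k * (?a \<bullet> ?b), - (?k * (?a \<bullet> ?a))])"
      unfolding d cross3_cross3_right by (simp add: scaleR_diff_right)
    finally have "w0 = chart_differential c R p (vector [?k * (?a \<bullet> ?b), - (?k * (?a \<bullet> ?a))])" .
    moreover have "?k * (?a \<bullet> ?a) > 0" using n a by simp
    ultimately show "w0 \<in> chart_differential c R p ` {v. v $ 2 < 0}" by (intro image_eqI) auto
    show "w0 \<bullet> ?a = 0" by (simp add: w0_def inner_commute[of _ ?a] dot_cross_self)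
    show "norm w0 = 1" using a normN norm_cross3_orthogonal[OF aN] by (simp add: w0_def)
  qed
  have uniq: "norm ?a *\<^sub>R w = cross3 ?a ?N" if c': "c' \<in> A" "p \<in> fst c'" and Q: "?Q c' w" for c' w
  proof -
    note cc = c(1) c'(1) c(2) c'(2)
    have p0': "snd c' p $ 2 = 0" by (rule chart_boundary_transition[OF c'(1) c(1) c'(2) c(2) p0])
    note J = jac_boundary[OF cc p0']
    from Q obtain v where v: "v $ 2 < 0" "w = chart_differential c' R p v" by auto
    let ?u = "chart_differential c' (snd c) p v"
    have "?u = chart_differential c' (snd c) p (v $ 1 *\<^sub>R axis 1 1 + v $ 2 *\<^sub>R axis 2 1)"
      by (rule arg_cong) (simp add: vec_eq_iff forall_2 axis_def)
    also have "\<dots> = v $ 1 *\<^sub>R chart_differential c' (snd c) p (axis 1 1) + v $ 2 *\<^sub>R chart_differential c' (snd c) p (axis 2 1)"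
      using has_derivative_linear[OF transition_has_derivative[OF cc]] by (simp add: linear_add linear_scale)
    finally have "?u $ 2 = v $ 2 * jac c c' p 2 2" using J(1) by simp
    then have u: "?u $ 2 < 0" using v(1) J(3) by (simp add: mult_neg_pos)
    have w: "w = ?u $ 1 *\<^sub>R ?a + ?u $ 2 *\<^sub>R ?b"
      unfolding v(2) chart_differential_chain[OF cc smooth_map_chart[OF sR c(1)]] d ..
    have "coord_deriv c' 1 R p = jac c c' p 1 1 *\<^sub>R ?a"
      unfolding coord_deriv_chain[OF cc sR] J(1) by simp
    then have wa: "w \<bullet> ?a = 0" using Q J(2) by simp
    show ?thesis
      unfolding chart_normal_def by (rule conormal_unique[OF n w u wa]) (use Q in simp)
  qed
  have "outward_conormal A R p = w0"
    unfolding outward_conormal_def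
  proof (rule the_equality)
    show "\<exists>c\<in>A. p \<in> fst c \<and> ?Q c w0" using c Q0 by blast
    fix w assume "\<exists>c\<in>A. p \<in> fst c \<and> ?Q c w"
    then obtain c' where "c' \<in> A" "p \<in> fst c'" "?Q c' w" by (elim bexE conjE) simp
    from uniq[OF this, symmetric] show "w = w0"
      using a by (simp add: w0_def)
  qed
  then show ?thesis using a by (simp add: w0_def)
qed

subsection \<open>The first variation\<close>

lemma smooth_map_const: "smooth_map A (\<lambda>p. k)"
  unfolding smooth_map_def comp_def by (intro ballI smooth_on_const)

text \<open>The factor is 1/3 from the volume times 1/2 from the doubling in
  \<open>triple_density r r r\<close>. Multiplying the normal by the area factor removes the
  normalization, also where the cross product is zero.\<close>

lemma algebraic_volume_eq:
  assumes r: "smooth_map A r" and P: "partition_of_unity X A C \<rho>"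
  shows "algebraic_volume X A r =
    1/6 * (\<Sum>c\<in>C. integral (chart_image c) (\<lambda>x. \<rho> c (chart_inv c x) * triple_density r r r c (chart_inv c x)))"
proof -
  have dens: "surface_density (\<lambda>c p. 1/2 * triple_density r r r c p)"
    by (rule chart_integral.dens_mult[OF area_chart_integral surface_density_triple[OF r r r] smooth_map_const])
  have "r p \<bullet> unit_normal A r p * norm (cross3 (coord_deriv c 1 r p) (coord_deriv c 2 r p)) =
      1/2 * triple_density r r r c p" if "c \<in> A" "p \<in> fst c" for c p
    unfolding unit_normal_eq[OF r that] chart_normal_def triple_density_def inner_cross3_antisym
      inner_normalized_times_norm by simp
  from surface_integral_eq[OF dens P this]
  have "surface_integral X A r (\<lambda>p. r p \<bullet> unit_normal A r p) =
    (\<Sum>c\<in>C. integral (chart_image c) (\<lambda>x. 1/2 * (\<rho> c (chart_inv c x) * triple_density r r r c (chart_inv c x))))"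
    by (simp only: mult.left_commute)
  then show ?thesis
    by (simp add: algebraic_volume_def sum_divide_distrib)
qed

text \<open>Trilinear expansion; the coefficients 2 come from the symmetry of
  \<open>triple_density\<close> in its last two arguments.\<close>

lemma triple_density_variation:
  assumes R: "smooth_map A R" and V: "smooth_map A V" and c: "c \<in> A" "p \<in> fst c"
  defines "r \<equiv> \<lambda>t p. R p + t *\<^sub>R V p"
  shows "triple_density (r t) (r t) (r t) c p = triple_density R R R c p +
    t * (triple_density V R R c p + 2 * triple_density R V R c p) +
    t^2 * (triple_density R V V c p + 2 * triple_density V R V c p) + t^3 * triple_density V V V c p"
proof -
  have "coord_deriv c i (r t) p = coord_deriv c i R p + t *\<^sub>R coord_deriv c i V p" for i
    unfolding r_def coord_deriv_add[OF R smooth_map_scaleR[OF V] c] coord_deriv_scaleR[OF V c] ..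
  moreover have "r t p = R p + t *\<^sub>R V p" by (simp add: r_def)
  ultimately show ?thesis
    unfolding triple_density_def inner_diff_right
    by (simp add: cross_skew[of "coord_deriv c 2 _ p"] cross_add_left cross_add_right cross_mult_left
        cross_mult_right inner_add_left inner_add_right inner_diff_right algebra_simps power2_eq_square power3_eq_cube)
qed

text \<open>Stated with densities only, for smooth \<open>R\<close>; normal and conormal enter when
  the two sums are recognized as integrals.\<close>

lemma first_variation:
  assumes R: "smooth_map A R" and V: "smooth_map A V" and P: "partition_of_unity X A C \<rho>"
  shows "((\<lambda>t. algebraic_volume X A (\<lambda>p. R p + t *\<^sub>R V p)) has_real_derivative
     (\<Sum>c\<in>C. integral (chart_image c) (\<lambda>x. \<rho> c (chart_inv c x) * (1/2 * triple_density V R R c (chart_inv c x)))) +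
     1/3 * (\<Sum>c\<in>C. integral {s. vector [s, 0] \<in> chart_image c} (\<lambda>s. \<rho> c (chart_inv c (vector [s, 0])) *
      (cross3 (R (chart_inv c (vector [s, 0]))) (V (chart_inv c (vector [s, 0]))) \<bullet>
        coord_deriv c 1 R (chart_inv c (vector [s, 0])))))) (at 0)"
proof -
  note PF = partition_facts[OF P]
  define I where "I a r s c = integral (chart_image c) (\<lambda>x. \<rho> c (chart_inv c x) * triple_density a r s c (chart_inv c x))"
    for a r s c
  define B where "B c = integral {s. vector [s, 0] \<in> chart_image c} (\<lambda>s. \<rho> c (chart_inv c (vector [s, 0])) *
      (cross3 (R (chart_inv c (vector [s, 0]))) (V (chart_inv c (vector [s, 0]))) \<bullet>
        coord_deriv c 1 R (chart_inv c (vector [s, 0]))))" for c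
  let ?w = "\<lambda>c. wedge_density (\<rho> c) (\<lambda>p. cross3 (R p) (V p)) R"
  have I: "((\<lambda>x. \<rho> c (chart_inv c x) * triple_density a r s c (chart_inv c x)) has_integral I a r s c) (chart_image c)"
    if "c \<in> C" "smooth_map A a" "smooth_map A r" "smooth_map A s" for a r s c
    unfolding I_def
    by (rule integrable_integral, rule chart_integral.partition_integrable
        [OF area_chart_integral surface_density_triple[OF that(2-4)] P that(1)])
  have vol: "algebraic_volume X A (\<lambda>p. R p + t *\<^sub>R V p) =
    1/6 * (\<Sum>c\<in>C. I R R R c + t * (I V R R c + 2 * I R V R c) + t^2 * (I R V V c + 2 * I V R V c) + t^3 * I V V V c)" for t
    unfolding algebraic_volume_eq[OF smooth_map_add[OF R smooth_map_scaleR[OF V]] P]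
  proof (intro arg_cong[where f = "\<lambda>x. 1/6 * x"] sum.cong refl integral_unique)
    fix c assume c: "c \<in> C"
    let ?\<rho> = "\<lambda>x. \<rho> c (chart_inv c x)" and ?T = "\<lambda>a r s x. triple_density a r s c (chart_inv c x)"
    have "((\<lambda>x. ?\<rho> x * ?T R R R x + t * (?\<rho> x * ?T V R R x + 2 * (?\<rho> x * ?T R V R x)) +
        t^2 * (?\<rho> x * ?T R V V x + 2 * (?\<rho> x * ?T V R V x)) + t^3 * (?\<rho> x * ?T V V V x)) has_integral
        I R R R c + t * (I V R R c + 2 * I R V R c) + t^2 * (I R V V c + 2 * I V R V c) + t^3 * I V V V c) (chart_image c)"
      by (intro has_integral_add has_integral_mult_right I c R V)
    then show "((\<lambda>x. ?\<rho> x * triple_density (\<lambda>p. R p + t *\<^sub>R V p) (\<lambda>p. R p + t *\<^sub>R V p) (\<lambda>p. R p + t *\<^sub>R V p) c (chart_inv c x))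
        has_integral
        I R R R c + t * (I V R R c + 2 * I R V R c) + t^2 * (I R V V c + 2 * I V R V c) + t^3 * I V V V c) (chart_image c)"
    proof (rule has_integral_eq[rotated])
      fix x assume x: "x \<in> chart_image c"
      show "?\<rho> x * ?T R R R x + t * (?\<rho> x * ?T V R R x + 2 * (?\<rho> x * ?T R V R x)) +
        t^2 * (?\<rho> x * ?T R V V x + 2 * (?\<rho> x * ?T V R V x)) + t^3 * (?\<rho> x * ?T V V V x) =
        ?\<rho> x * triple_density (\<lambda>p. R p + t *\<^sub>R V p) (\<lambda>p. R p + t *\<^sub>R V p) (\<lambda>p. R p + t *\<^sub>R V p) c (chart_inv c x)"
        unfolding triple_density_variation[OF R V subsetD[OF PF(2) c] chart_inv_in[OF x]]
        by (simp add: algebra_simps)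
    qed
  qed
  have "\<forall>c\<in>C. \<exists>K. closedin X K \<and> K \<subseteq> fst c \<and> (\<forall>p\<in>topspace X. p \<notin> K \<longrightarrow> \<rho> c p = 0)"
    using partition_support[OF P] by metis
  from bchoice[OF this] obtain K where
    K: "\<forall>c\<in>C. closedin X (K c) \<and> K c \<subseteq> fst c \<and> (\<forall>p\<in>topspace X. p \<notin> K c \<longrightarrow> \<rho> c p = 0)"
    by (elim exE)
  have \<rho>0: "\<rho> c p = 0" if "c \<in> C" "d \<in> A" "p \<in> fst d" "p \<notin> K c" for c d p
    using K that(1,4) subsetD[OF dom_subset[OF that(2)] that(3)] by blast
  have w_dens: "surface_density (?w c)" if "c \<in> C" for c
    by (rule surface_density_wedge[OF PF(3)[OF that] R])
      (intro continuous_on_cross smooth_map_continuous_on R V)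
  have w0: "?w c d p = 0" if "c \<in> C" "d \<in> A" "p \<in> fst d" "p \<notin> K c" for c d p
    using coord_deriv_eq_0[OF that(2,3) _ that(4) \<rho>0[OF that(1,2)]] K that(1)
    by (simp add: wedge_density_def)
  have w_int: "(\<lambda>x. ?w c c (chart_inv c x)) integrable_on chart_image c" if c: "c \<in> C" for c
    by (rule chart_integral.dens_integrable[OF area_chart_integral w_dens[OF c] subsetD[OF PF(2) c], of "K c"])
      (use K c w0[OF c subsetD[OF PF(2) c]] in auto)
  \<comment> \<open>Each integral is taken in its own chart. Every \<open>?w c\<close> is a density
    vanishing off \<open>K c\<close>, so all of them can be redistributed; in a fixed chart the sum
    then contains the derivatives of a constant and is zero.\<close>
  have w_sum: "(\<Sum>c\<in>C. integral (chart_image c) (\<lambda>x. ?w c c (chart_inv c x))) = 0"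
  proof -
    have "(\<Sum>c\<in>C. integral (chart_image c) (\<lambda>x. ?w c c (chart_inv c x))) =
        (\<Sum>d\<in>C. integral (chart_image d) (\<lambda>x. \<rho> d (chart_inv d x) * 0))"
    proof (rule chart_integral.sum_localized_integrals[OF area_chart_integral P PF(1) _ w_dens _ _ w0,
          where c = "\<lambda>c. c" and M = "\<lambda>d p. 0"])
      show "(\<Sum>c\<in>C. ?w c d p) = 0" if "d \<in> A" "p \<in> fst d" for d p
        unfolding wedge_density_def sum_subtractf sum_distrib_right[symmetric]
          coord_deriv_sum_partition[OF P that] by simp
    qed (use K PF(2) in auto)
    then show ?thesis by simp
  qed
  have stokes: "integral (chart_image c) (\<lambda>x. ?w c c (chart_inv c x)) + (I R V R c - I V R R c) = B c" if c: "c \<in> C" for c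
  proof -
    have "integral (chart_image c) (\<lambda>x. ?w c c (chart_inv c x) +
        (\<rho> c (chart_inv c x) * triple_density R V R c (chart_inv c x) - \<rho> c (chart_inv c x) * triple_density V R R c (chart_inv c x))) =
        integral (chart_image c) (\<lambda>x. ?w c c (chart_inv c x)) + (I R V R c - I V R R c)"
      by (intro integral_unique has_integral_add has_integral_diff I integrable_integral w_int c R V)
    moreover have "integral (chart_image c) (\<lambda>x. ?w c c (chart_inv c x) +
        \<rho> c (chart_inv c x) * (triple_density R V R c (chart_inv c x) - triple_density V R R c (chart_inv c x))) = B c"
      unfolding B_def
      by (rule chart_stokes[OF subsetD[OF PF(2) c] PF(3)[OF c] R V, of "K c"])
        (use K c \<rho>0[OF c subsetD[OF PF(2) c]] in auto)
    ultimately show ?thesis by (simp add: right_diff_distrib)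
  qed
  have "(\<Sum>c\<in>C. B c) = (\<Sum>c\<in>C. I R V R c) - (\<Sum>c\<in>C. I V R R c)"
    using w_sum by (simp add: stokes[symmetric] sum.distrib sum_subtractf)
  \<comment> \<open>Substituting RVR = VRR + B into \<open>1/6\<close> of VRR + 2 RVR leaves
    \<open>3/6\<close> of VRR and \<open>2/6\<close> of B.\<close>
  then have total: "1/6 * (\<Sum>c\<in>C. I V R R c + 2 * I R V R c) = (\<Sum>c\<in>C. 1/2 * I V R R c) + 1/3 * (\<Sum>c\<in>C. B c)"
    by (simp add: sum.distrib sum_distrib_left[symmetric] sum_divide_distrib[symmetric] field_simps)
  have "((\<lambda>t. algebraic_volume X A (\<lambda>p. R p + t *\<^sub>R V p)) has_real_derivative
      1/6 * (\<Sum>c\<in>C. I V R R c + 2 * I R V R c)) (at 0)"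
    unfolding vol by (auto intro!: derivative_eq_intros)
  then show ?thesis
    unfolding total B_def[symmetric] by (simp add: I_def mult.left_commute[of _ "1/2"])
qed

end

theorem theorem5p3:
  fixes X :: "'a topology" and A :: "'a chart set"
    and R V \<eta> :: "'a \<Rightarrow> real^3" and v\<^sub>n :: "'a \<Rightarrow> real"
  assumes "compact_oriented_surface X A"
    and "smooth_immersion A R"
    and "\<forall>p\<in>topspace X. \<exists>c. p \<in> fst c \<and> curvature_line_coords X A R c"
    and "smooth_map A V"
    and "\<forall>p\<in>topspace X. V p = \<eta> p + v\<^sub>n p *\<^sub>R unit_normal A R p"
    and "\<forall>p\<in>topspace X. \<eta> p \<in> tangent_plane A R p"
    and "\<forall>p\<in>topspace X. v\<^sub>n p = V p \<bullet> unit_normal A R p"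
  shows "((\<lambda>t. algebraic_volume X A (\<lambda>p. R p + t *\<^sub>R V p)) has_real_derivative
           (surface_integral X A R v\<^sub>n +
            1/3 * boundary_integral X A R
              (\<lambda>p. ((R p \<bullet> unit_normal A R p) *\<^sub>R \<eta> p - v\<^sub>n p *\<^sub>R R p) \<bullet> outward_conormal A R p)))
         (at 0)"
proof -
  interpret compact_surface X A by unfold_locales (rule assms(1))
  have R: "smooth_map A R" using assms(2) by (simp add: smooth_immersion_def)
  note V = assms(4)
  obtain C \<rho> where P: "partition_of_unity X A C \<rho>" using ex_partition_of_unity by (elim exE)
  have top: "p \<in> topspace X" if "c \<in> A" "p \<in> fst c" for c p
    by (rule subsetD[OF dom_subset[OF that(1)] that(2)])
  \<comment> \<open>Both integrals are evaluated with the same partition \<open>\<rho>\<close>, so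
    that their values are literally the sums in \<open>first_variation\<close>.\<close>
  have surface: "surface_integral X A R v\<^sub>n =
      (\<Sum>c\<in>C. integral (chart_image c) (\<lambda>x. \<rho> c (chart_inv c x) * (1/2 * triple_density V R R c (chart_inv c x))))"
  proof (rule surface_integral_eq[OF _ P])
    show "surface_density (\<lambda>c p. 1/2 * triple_density V R R c p)"
      by (rule chart_integral.dens_mult[OF area_chart_integral surface_density_triple[OF V R R] smooth_map_const])
    fix c p assume c: "c \<in> A" "p \<in> fst c"
    have "v\<^sub>n p = V p \<bullet> chart_normal c R p"
      using assms(7) top[OF c] unit_normal_eq[OF R c] by simp
    then show "v\<^sub>n p * norm (cross3 (coord_deriv c 1 R p) (coord_deriv c 2 R p)) = 1/2 * triple_density V R R c p"
      unfolding chart_normal_def triple_density_def inner_cross3_antisym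
      by (simp only: inner_normalized_times_norm)
  qed
  have boundary: "boundary_integral X A R
      (\<lambda>p. ((R p \<bullet> unit_normal A R p) *\<^sub>R \<eta> p - v\<^sub>n p *\<^sub>R R p) \<bullet> outward_conormal A R p) =
      (\<Sum>c\<in>C. integral {s. vector [s, 0] \<in> chart_image c} (\<lambda>s. \<rho> c (chart_inv c (vector [s, 0])) *
      (cross3 (R (chart_inv c (vector [s, 0]))) (V (chart_inv c (vector [s, 0]))) \<bullet>
        coord_deriv c 1 R (chart_inv c (vector [s, 0])))))"
  proof (rule boundary_integral_eq[OF _ P, where m = "\<lambda>c p. cross3 (R p) (V p) \<bullet> coord_deriv c 1 R p"])
    show "boundary_density (\<lambda>c p. cross3 (R p) (V p) \<bullet> coord_deriv c 1 R p)"
      by (rule boundary_density_tangential[OF R]) (intro continuous_on_cross smooth_map_continuous_on R V)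
    fix c p assume c: "c \<in> A" "p \<in> fst c" and p0: "snd c p $ 2 = 0"
    let ?a = "coord_deriv c 1 R p" and ?N = "chart_normal c R p"
    have N: "unit_normal A R p = ?N" by (rule unit_normal_eq[OF R c])
    have "norm ?N = 1"
      using immersion_cross3_nonzero[OF assms(2) c] by (simp add: chart_normal_def)
    then have NN: "?N \<bullet> ?N = 1" by (simp add: norm_eq_1)
    have V_eq: "V p = \<eta> p + v\<^sub>n p *\<^sub>R ?N" and v: "v\<^sub>n p = V p \<bullet> ?N"
      using bspec[OF assms(5) top[OF c]] bspec[OF assms(7) top[OF c]] unfolding N .
    \<comment> \<open>Pairing the decomposition of \<open>V p\<close> with the unit vector
      \<open>?N\<close> and comparing with \<open>v\<close> leaves no normal part for
      \<open>\<eta> p\<close>.\<close>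
    have "\<eta> p \<bullet> ?N = 0"
      using v unfolding V_eq by (simp add: inner_add_left NN)
    moreover have "?a \<bullet> ?N = 0" by (simp add: chart_normal_def dot_cross_self)
    ultimately have "((R p \<bullet> ?N) *\<^sub>R \<eta> p - v\<^sub>n p *\<^sub>R R p) \<bullet> cross3 ?a ?N = cross3 (R p) (V p) \<bullet> ?a"
      using NN V_eq by (intro conormal_flux)
    then show "((R p \<bullet> unit_normal A R p) *\<^sub>R \<eta> p - v\<^sub>n p *\<^sub>R R p) \<bullet> outward_conormal A R p * norm ?a =
        cross3 (R p) (V p) \<bullet> ?a"
      unfolding N outward_conormal_eq[OF assms(2) c p0, symmetric] by (simp add: mult.commute)
  qed
  show ?thesis
    unfolding surface boundary by (rule first_variation[OF R V P])
qed

end
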